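(* Let $F=K\cup\bigcup_{i=1}^nP_i$ be a Nyikos decomposition of an orientable $\omega$-bounded surface $F$, and let $\mathcal{M}(F)$, $\mathcal{M}(K)$, $\mathcal{M}(P_i)$ and $\mathcal{N}(F)$ be as defined below. Then: (1) $\mathcal{N}(F)$ is a normal subgroup of $\mathcal{M}(F)$; (2) the map $\theta:\mathcal{M}(K)\times\mathcal{M}(P_1)\times\cdots\times\mathcal{M}(P_n)\to\mathcal{N}(F)$, defined by sending $([h_0],[h_1],\dots,[h_n])$ to the class $[h]$ of the homeomorphism $h:F\to F$ with $h|_K=h_0$ and $h|_{P_i}=h_i$ for each $i$, is a well-defined group epimorphism.
   Context: A surface is a connected Hausdorff space locally homeomorphic to $\mathbb{R}^2$ (possibly with boundary where indicated). A space is $\omega$-bounded if every countable subset has compact closure. A (closed) long pipe is a surface $P$ with boundary homeomorphic to $\mathbb{S}^1$ such that $P=\bigcup_{\alpha<\omega_1}U_\alpha$, where each $U_\alpha$ is an open subset of $P$ containing $\partial P$ and homeomorphic to $\mathbb{S}^1\times[0,\infty)$, and whenever $\alpha<\beta$ we have $\overline{U_\alpha}\subset U_\beta$ and the boundary of $U_\alpha$ in $U_\beta$ is homeomorphic to $\mathbb{S}^1$. A Nyikos decomposition of an $\omega$-bounded surface $F$ is an expression $F=K\cup\bigcup_{i=1}^nP_i$ where $K$ is a compact surface with $n$ boundary circles, $P_1,\dots,P_n$ are pairwise disjoint closed long pipes, and each $P_i$ meets $K$ exactly in $\partial P_i$, which is a boundary component of $K$ (distinct pipes attached along distinct boundary components).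 All homeomorphisms are orientation-preserving. $\mathcal{M}(F)$ is the group of isotopy classes $[h]$ of homeomorphisms $h:F\to F$. $\mathcal{M}(K)$ is the group of classes of homeomorphisms $h:K\to K$ with $h|_{\partial K}=\mathrm{id}$, modulo isotopies fixing $\partial K$ pointwise; $\mathcal{M}(P_i)$ is likewise the group of classes of homeomorphisms $h:P_i\to P_i$ with $h|_{\partial P_i}=\mathrm{id}$, modulo isotopies fixing $\partial P_i$ pointwise. $\mathcal{N}(F)=\{[h]\in\mathcal{M}(F): h(K)=K\text{ and } h(P_i)=P_i\text{ for each } i\}$, i.e. the classes containing a representative leaving $K$ and each $P_i$ invariant. *)

theory Defs
  imports "HOL-Analysis.Analysis" "HOL-Algebra.Product_Groups"
begin

definition upper_half_plane :: "complex set" where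
  "upper_half_plane = {z. Im z \<ge> 0}"

definition plane_chart :: "'a topology \<Rightarrow> ('a \<Rightarrow> complex) \<Rightarrow> 'a set \<Rightarrow> bool" where
  "plane_chart X \<phi> U \<longleftrightarrow> openin X U \<and> open (\<phi> ` U) \<and>
     homeomorphic_map (subtopology X U) (top_of_set (\<phi> ` U)) \<phi>"

definition half_chart :: "'a topology \<Rightarrow> ('a \<Rightarrow> complex) \<Rightarrow> 'a set \<Rightarrow> bool" where
  "half_chart X \<phi> U \<longleftrightarrow> openin X U \<and> openin (top_of_set upper_half_plane) (\<phi> ` U) \<and>
     homeomorphic_map (subtopology X U) (top_of_set (\<phi> ` U)) \<phi>"

definition surface :: "'a topology \<Rightarrow> bool" where
  "surface X \<longleftrightarrow> connected_space X \<and> Hausdorff_space X \<and>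
     (\<forall>p \<in> topspace X. \<exists>\<phi> U. p \<in> U \<and> plane_chart X \<phi> U)"

definition surface_wb :: "'a topology \<Rightarrow> bool" where
  "surface_wb X \<longleftrightarrow> connected_space X \<and> Hausdorff_space X \<and>
     (\<forall>p \<in> topspace X. \<exists>\<phi> U. p \<in> U \<and> half_chart X \<phi> U)"

definition mint :: "'a topology \<Rightarrow> 'a set" where
  "mint X = {p \<in> topspace X. \<exists>\<phi> U. p \<in> U \<and> plane_chart X \<phi> U}"

definition mbdry :: "'a topology \<Rightarrow> 'a set" where
  "mbdry X = topspace X - mint X"

definition omega_bounded :: "'a topology \<Rightarrow> bool" where
  "omega_bounded X \<longleftrightarrow>
     (\<forall>C. C \<subseteq> topspace X \<and> countable C \<longrightarrow> compactin X (X closure_of C))"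

definition circle_top :: "complex topology" where
  "circle_top = top_of_set (sphere 0 1)"

text \<open>The index set I with the well-order r is order-isomorphic to omega_1:
  it is uncountable and every proper initial segment is countable.\<close>
definition long_pipe :: "'a topology \<Rightarrow> bool" where
  "long_pipe Y \<longleftrightarrow> surface_wb Y \<and> subtopology Y (mbdry Y) homeomorphic_space circle_top \<and>
    (\<exists>(I :: 'a set set) r U.
        well_order_on I r \<and> uncountable I \<and>
        (\<forall>\<alpha>\<in>I. countable {\<beta>. (\<beta>, \<alpha>) \<in> r}) \<and>
        (\<Union>\<alpha>\<in>I. U \<alpha>) = topspace Y \<and>
        (\<forall>\<alpha>\<in>I. openin Y (U \<alpha>) \<and> mbdry Y \<subseteq> U \<alpha> \<and>
           subtopology Y (U \<alpha>) homeomorphic_space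
             prod_topology circle_top (top_of_set {0::real..})) \<and>
        (\<forall>\<alpha>\<in>I. \<forall>\<beta>\<in>I. (\<alpha>, \<beta>) \<in> r \<and> \<alpha> \<noteq> \<beta> \<longrightarrow>
           Y closure_of (U \<alpha>) \<subseteq> U \<beta> \<and>
           subtopology Y ((subtopology Y (U \<beta>)) frontier_of (U \<alpha>)) homeomorphic_space circle_top))"

definition nyikos_decomposition ::
  "'a topology \<Rightarrow> 'a set \<Rightarrow> nat \<Rightarrow> (nat \<Rightarrow> 'a set) \<Rightarrow> bool" where
  "nyikos_decomposition X K n P \<longleftrightarrow>
     K \<subseteq> topspace X \<and> (\<forall>i\<in>{1..n}. P i \<subseteq> topspace X) \<and>
     topspace X = K \<union> (\<Union>i\<in>{1..n}. P i) \<and>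
     compact_space (subtopology X K) \<and> surface_wb (subtopology X K) \<and>
     card (connected_components_of (subtopology X (mbdry (subtopology X K)))) = n \<and>
     (\<forall>C \<in> connected_components_of (subtopology X (mbdry (subtopology X K))).
        subtopology X C homeomorphic_space circle_top) \<and>
     (\<forall>i\<in>{1..n}. long_pipe (subtopology X (P i))) \<and>
     (\<forall>i\<in>{1..n}. \<forall>j\<in>{1..n}. i \<noteq> j \<longrightarrow> P i \<inter> P j = {}) \<and>
     (\<forall>i\<in>{1..n}. P i \<inter> K = mbdry (subtopology X (P i)) \<and>
        mbdry (subtopology X (P i)) \<in>
          connected_components_of (subtopology X (mbdry (subtopology X K))))"

text \<open>A map f of an open planar set S is orientation preserving at a:
  the image of a small circle around a winds once positively around f a.\<close>
definition orient_pres_at :: "complex set \<Rightarrow> (complex \<Rightarrow> complex) \<Rightarrow> complex \<Rightarrow> bool" where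
  "orient_pres_at S f a \<longleftrightarrow> (\<exists>r>0. cball a r \<subseteq> S \<and>
     homotopic_loops (- {0})
       (\<lambda>t. f (a + of_real r * cis (2 * pi * t)) - f a)
       (\<lambda>t. cis (2 * pi * t)))"

definition oriented_atlas :: "'a topology \<Rightarrow> (('a \<Rightarrow> complex) \<times> 'a set) set \<Rightarrow> bool" where
  "oriented_atlas X At \<longleftrightarrow>
     (\<forall>(\<phi>, U) \<in> At. plane_chart X \<phi> U) \<and>
     (\<forall>p \<in> topspace X. \<exists>(\<phi>, U) \<in> At. p \<in> U) \<and>
     (\<forall>(\<phi>, U) \<in> At. \<forall>(\<psi>, V) \<in> At. \<forall>p \<in> U \<inter> V.
        orient_pres_at (\<phi> ` (U \<inter> V)) (\<psi> \<circ> inv_into U \<phi>) (\<phi> p))"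

definition orientable :: "'a topology \<Rightarrow> bool" where
  "orientable X \<longleftrightarrow> (\<exists>At. oriented_atlas X At)"

definition orient_pres :: "'a topology \<Rightarrow> (('a \<Rightarrow> complex) \<times> 'a set) set \<Rightarrow> 'a set \<Rightarrow> ('a \<Rightarrow> 'a) \<Rightarrow> bool" where
  "orient_pres X At S h \<longleftrightarrow>
     (\<forall>(\<phi>, U) \<in> At. \<forall>(\<psi>, V) \<in> At.
        let W = {x \<in> U \<inter> (X interior_of S). h x \<in> V} in
        \<forall>p \<in> W. orient_pres_at (\<phi> ` W) (\<psi> \<circ> h \<circ> inv_into U \<phi>) (\<phi> p))"

definition homeos :: "'a topology \<Rightarrow> (('a \<Rightarrow> complex) \<times> 'a set) set \<Rightarrow> 'a set \<Rightarrow> 'a set \<Rightarrow> ('a \<Rightarrow> 'a) set" where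
  "homeos X At S B = {h. homeomorphic_map (subtopology X S) (subtopology X S) h \<and>
                       (\<forall>x\<in>B. h x = x) \<and> orient_pres X At S h}"

definition isotopic :: "'a topology \<Rightarrow> 'a set \<Rightarrow> 'a set \<Rightarrow> ('a \<Rightarrow> 'a) \<Rightarrow> ('a \<Rightarrow> 'a) \<Rightarrow> bool" where
  "isotopic X S B f g \<longleftrightarrow> (\<exists>H.
     continuous_map (prod_topology (top_of_set {0..1::real}) (subtopology X S)) (subtopology X S) H \<and>
     (\<forall>t\<in>{0..1}. homeomorphic_map (subtopology X S) (subtopology X S) (\<lambda>x. H (t, x))) \<and>
     (\<forall>x\<in>S. H (0, x) = f x \<and> H (1, x) = g x) \<and>
     (\<forall>t\<in>{0..1}. \<forall>x\<in>B. H (t, x) = x))"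

definition iso_class :: "'a topology \<Rightarrow> (('a \<Rightarrow> complex) \<times> 'a set) set \<Rightarrow> 'a set \<Rightarrow> 'a set \<Rightarrow> ('a \<Rightarrow> 'a) \<Rightarrow> ('a \<Rightarrow> 'a) set" where
  "iso_class X At S B h = {g \<in> homeos X At S B. isotopic X S B g h}"

definition MCG :: "'a topology \<Rightarrow> (('a \<Rightarrow> complex) \<times> 'a set) set \<Rightarrow> 'a set \<Rightarrow> 'a set \<Rightarrow> ('a \<Rightarrow> 'a) set monoid" where
  "MCG X At S B = \<lparr> carrier = iso_class X At S B ` homeos X At S B,
     monoid.mult = (\<lambda>A C. {g \<in> homeos X At S B. \<exists>f\<in>A. \<exists>k\<in>C. isotopic X S B g (f \<circ> k)}),
     one = iso_class X At S B id \<rparr>"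

definition NF :: "'a topology \<Rightarrow> (('a \<Rightarrow> complex) \<times> 'a set) set \<Rightarrow> 'a set \<Rightarrow> nat \<Rightarrow> (nat \<Rightarrow> 'a set) \<Rightarrow> ('a \<Rightarrow> 'a) set set" where
  "NF X At K n P = {c \<in> carrier (MCG X At (topspace X) {}).
      \<exists>h\<in>c. h ` K = K \<and> (\<forall>i\<in>{1..n}. h ` P i = P i)}"

definition factor_MCG :: "'a topology \<Rightarrow> (('a \<Rightarrow> complex) \<times> 'a set) set \<Rightarrow> 'a set \<Rightarrow> (nat \<Rightarrow> 'a set) \<Rightarrow> nat \<Rightarrow> ('a \<Rightarrow> 'a) set monoid" where
  "factor_MCG X At K P i =
     (if i = 0 then MCG X At K (mbdry (subtopology X K))
      else MCG X At (P i) (mbdry (subtopology X (P i))))"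

definition glue :: "'a set \<Rightarrow> nat \<Rightarrow> (nat \<Rightarrow> 'a set) \<Rightarrow> (nat \<Rightarrow> 'a \<Rightarrow> 'a) \<Rightarrow> 'a \<Rightarrow> 'a" where
  "glue K n P hs x =
     (if x \<in> K then hs 0 x
      else if \<exists>i\<in>{1..n}. x \<in> P i then hs (SOME i. i \<in> {1..n} \<and> x \<in> P i) x
      else x)"

definition theta :: "'a topology \<Rightarrow> (('a \<Rightarrow> complex) \<times> 'a set) set \<Rightarrow> 'a set \<Rightarrow> nat \<Rightarrow> (nat \<Rightarrow> 'a set)
    \<Rightarrow> (nat \<Rightarrow> ('a \<Rightarrow> 'a) set) \<Rightarrow> ('a \<Rightarrow> 'a) set" where
  "theta X At K n P A = iso_class X At (topspace X) {} (glue K n P (\<lambda>i. SOME h. h \<in> A i))"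

end

theory Submission
  imports Defs "HOL-Complex_Analysis.Riemann_Mapping"
begin

text \<open>Surjectivity of \<open>\<theta>\<close>: a homeomorphism preserving K and all pipes restricts to a degree one map of
  each boundary circle (degree minus one would force a fixed point of local orientation minus one).
  A degree one circle map is isotopic to the identity, and the isotopy extends over a bicollar; so the
  homeomorphism can be isotoped to one fixing the boundary of K pointwise, which is glued from its pieces.

  Normality: write h, fixed on the boundary of K, as a product of a map supported in K and a map
  supported in the pipes, and conjugate the factors by g separately. The first conjugate is supported in the
  compact set g(K), the second is the identity off the conjugated pipes. The pipes can be pushed off
  any given compact set by an ambient isotopy, which makes the first conjugate the identity on the pipes and the
  second one the identity on K. This avoids comparing the two decompositions K and g(K),
  for which the annulus theorem would be needed.

  The bicollars come from Connelly's argument: finitely many local pushes across the boundary, each supported in a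
  chart obtained by gluing a half-disc of K to the collar contained in the pipe.\<close>

section \<open>Local orientation in the plane\<close>

text \<open>The hidden obstacle is orientation. \<open>orient_pres\<close> tests chart pairs over
  the interior of a piece, each by one circle of unspecified radius. So a calculus comes first:
  independence of radius and charts, behaviour under composition, inversion and isotopy, and local
  constancy. Local constancy carries orientation across the gluing circles, about which the factors
  of \<open>theta\<close> say nothing; isotopy invariance keeps pushed and twisted maps inside
  \<open>homeos\<close>. The pushing and twisting isotopies are built from moves compactly supported
  in one bicollar. A compact set meets a pipe inside a single member of its exhaustion, so each move
  takes place in one product of a circle and a ray, although the whole pipe is no such product.
  Openness and surjectivity of these moves come from invariance of domain and connectedness of the
  surface. In the degree minus one case the fixed point lets the same chart serve as source and
  target, so a loop can be compared with its own mirror image.\<close>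

lemma homotopic_loops_diff:
  fixes f :: "complex \<Rightarrow> complex" and c :: "real \<times> real \<Rightarrow> complex" and d :: "real \<Rightarrow> complex"
  assumes "continuous_on S f" "inj_on f S"
    and c: "continuous_on ({0..1} \<times> {0..1}) c" and cS: "\<And>u t. u \<in> {0..1} \<Longrightarrow> t \<in> {0..1} \<Longrightarrow> c (u,t) \<in> S"
    and d: "continuous_on {0..1} d" and dS: "\<And>u. u \<in> {0..1} \<Longrightarrow> d u \<in> S"
    and loop: "\<And>u. u \<in> {0..1} \<Longrightarrow> c (u,1) = c (u,0)"
    and ne: "\<And>u t. u \<in> {0..1} \<Longrightarrow> t \<in> {0..1} \<Longrightarrow> c (u,t) \<noteq> d u"
  shows "homotopic_loops (-{0}) (\<lambda>t. f (c (0,t)) - f (d 0)) (\<lambda>t. f (c (1,t)) - f (d 1))"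
  unfolding homotopic_loops
proof (intro exI conjI ballI)
  \<comment> \<open>Injectivity of \<open>f\<close> turns the separation of \<open>c\<close> from
    \<open>d\<close> into nonvanishing of this difference, so the loop and its centre may move at
    the same time.\<close>
  let ?h = "\<lambda>p. f (c p) - f (d (fst p))"
  show "continuous_on ({0..1} \<times> {0..1}) ?h"
    by (intro continuous_intros continuous_on_compose2 [OF assms(1)] c
        continuous_on_compose2 [OF d]) (use cS dS in auto)
  show "?h \<in> {0..1} \<times> {0..1} \<rightarrow> -{0}"
    using cS dS ne assms(2) by (force simp: inj_on_eq_iff)
qed (auto simp: loop pathfinish_def pathstart_def)

text \<open>Centre and radius slide linearly; convexity keeps the moving circle inside
  \<open>T\<close>, and its distance from the moving centre is a convex combination of
  \<open>r\<close> and \<open>s\<close>, hence positive.\<close>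

lemma homotopic_loops_circles:
  fixes f :: "complex \<Rightarrow> complex"
  assumes "continuous_on T f" "inj_on f T" "convex T"
    and "cball p r \<subseteq> T" "cball q s \<subseteq> T" "r > 0" "s > 0"
  shows "homotopic_loops (-{0}) (\<lambda>t. f (p + of_real r * cis (2 * pi * t)) - f p)
           (\<lambda>t. f (q + of_real s * cis (2 * pi * t)) - f q)"
proof -
  define c where "c = (\<lambda>(u,t). (1 - u) *\<^sub>R (p + of_real r * cis (2 * pi * t)) + u *\<^sub>R (q + of_real s * cis (2 * pi * t)))"
  define d where "d = (\<lambda>u::real. (1 - u) *\<^sub>R p + u *\<^sub>R q)"
  have diff: "c (u,t) - d u = of_real ((1 - u) * r + u * s) * cis (2 * pi * t)" for u t
    by (simp add: c_def d_def algebra_simps scaleR_conv_of_real)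
  have pos: "(1 - u) * r + u * s > 0" if "u \<in> {0..1}" for u
    using that assms(6,7)
    by (cases "u = 0") (auto intro!: add_nonneg_pos)
  have "homotopic_loops (-{0}) (\<lambda>t. f (c (0,t)) - f (d 0)) (\<lambda>t. f (c (1,t)) - f (d 1))"
  proof (rule homotopic_loops_diff [OF assms(1,2)])
    show "continuous_on ({0..1} \<times> {0..1}) c"
      unfolding c_def case_prod_unfold by (intro continuous_intros)
    show "continuous_on {0..1} d"
      unfolding d_def by (intro continuous_intros)
    fix u t :: real assume u: "u \<in> {0..1}"
    have "p + of_real r * cis (2 * pi * t) \<in> cball p r" "q + of_real s * cis (2 * pi * t) \<in> cball q s"
      using assms(6,7) by (auto simp: dist_norm norm_mult)
    then have "p + of_real r * cis (2 * pi * t) \<in> T" "q + of_real s * cis (2 * pi * t) \<in> T"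
      using assms(4,5) by blast+
    then show "c (u,t) \<in> T"
      using u assms(3) by (auto simp: c_def convex_alt)
    have "p \<in> T" "q \<in> T" using assms by auto
    then show "d u \<in> T"
      using u assms(3) by (auto simp: d_def convex_alt)
    show "c (u,1) = c (u,0)" by (simp add: c_def)
    have "c (u,t) - d u \<noteq> 0" using pos [OF u] unfolding diff by (auto simp del: of_real_add of_real_mult)
    then show "c (u,t) \<noteq> d u" by auto
  qed
  then show ?thesis by (simp add: c_def d_def)
qed

text \<open>The radial squeeze \<open>\<rho>\<close> sends the punctured plane into the punctured
  ball and moves points along rays only, so the given homotopy can be squeezed and its ends joined
  back to \<open>g\<close> and \<open>h\<close>. This makes room for maps that are defined near the
  centre only.\<close>

lemma homotopic_loops_punctured_ball:
  fixes g h :: "real \<Rightarrow> complex"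
  assumes gh: "homotopic_loops (-{0}) g h"
    and g: "path_image g \<subseteq> ball 0 s" and h: "path_image h \<subseteq> ball 0 s"
  shows "homotopic_loops (ball 0 s - {0}) g h"
proof -
  have s: "s > 0"
    using g pathstart_in_path_image [of g] by (metis centre_in_ball ball_empty empty_iff linorder_not_le subsetD)
  define \<rho> where "\<rho> = (\<lambda>z::complex. (s / (s + norm z)) *\<^sub>R z)"
  have cont: "continuous_on UNIV \<rho>"
    unfolding \<rho>_def using s by (intro continuous_intros) (auto simp: add_nonneg_eq_0_iff)
  have img: "\<rho> z \<in> ball 0 s - {0}" if "z \<noteq> 0" for z
    using s that by (auto simp: \<rho>_def field_simps add_pos_nonneg add_nonneg_eq_0_iff)
  have lin: "homotopic_loops (ball 0 s - {0}) k (\<rho> \<circ> k)"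
    if k: "path k" "pathfinish k = pathstart k" "path_image k \<subseteq> ball 0 s - {0}" for k
  proof (rule homotopic_loops_linear)
    show "path (\<rho> \<circ> k)"
      using k cont by (meson continuous_on_subset path_continuous_image subset_UNIV)
    fix t :: real assume "t \<in> {0..1}"
    then have kt: "k t \<in> ball 0 s - {0}" using k by (auto simp: path_image_def image_subset_iff)
    show "closed_segment (k t) ((\<rho> \<circ> k) t) \<subseteq> ball 0 s - {0}"
    proof
      fix z assume "z \<in> closed_segment (k t) ((\<rho> \<circ> k) t)"
      then obtain u where u: "0 \<le> u" "u \<le> 1" and z: "z = (1 - u) *\<^sub>R k t + u *\<^sub>R \<rho> (k t)"
        by (auto simp: closed_segment_def)
      have z': "z = (1 - u + u * (s / (s + norm (k t)))) *\<^sub>R k t"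
        by (simp add: z \<rho>_def scaleR_add_left)
      have q: "0 < s / (s + norm (k t))" "s / (s + norm (k t)) \<le> 1"
        using s by (auto simp: add_pos_nonneg)
      have "1 - u + u * (s / (s + norm (k t))) > 0"
        using u q s by (cases "u = 1") (auto intro!: add_pos_nonneg divide_nonneg_nonneg)
      moreover have "z \<in> ball 0 s"
        using kt img [of "k t"] u convexD_alt [OF convex_ball, of "k t" 0 s "\<rho> (k t)" u] z by auto
      ultimately show "z \<in> ball 0 s - {0}"
        using kt z' by auto
    qed
  qed (use k in \<open>auto simp: pathfinish_def pathstart_def\<close>)
  have "homotopic_loops (ball 0 s - {0}) (\<rho> \<circ> g) (\<rho> \<circ> h)"
    by (rule homotopic_loops_continuous_image [OF gh])
       (use img cont in \<open>auto intro: continuous_on_subset\<close>)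
  moreover have "homotopic_loops (ball 0 s - {0}) g (\<rho> \<circ> g)" "homotopic_loops (ball 0 s - {0}) h (\<rho> \<circ> h)"
    using lin homotopic_loops_imp_path [OF gh] homotopic_loops_imp_loop [OF gh]
      homotopic_loops_imp_subset [OF gh] g h by auto
  ultimately show ?thesis
    by (meson homotopic_loops_sym homotopic_loops_trans)
qed

lemma homotopic_loops_scaled_circle:
  assumes "c > 0"
  shows "homotopic_loops (-{0}) (\<lambda>t. of_real c * cis (2 * pi * t)) (\<lambda>t. cis (2 * pi * t))"
  using homotopic_loops_circles [of UNIV "\<lambda>z. z" 0 c 0 1] assms by simp

lemma orient_pres_at_cong:
  assumes "\<And>z. z \<in> S \<Longrightarrow> f z = g z"
  shows "orient_pres_at S f a \<longleftrightarrow> orient_pres_at S g a"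
proof -
  have "(\<lambda>t. f (a + of_real r * cis (2 * pi * t)) - f a) = (\<lambda>t. g (a + of_real r * cis (2 * pi * t)) - g a)"
    if "r > 0" "cball a r \<subseteq> S" for r
  proof
    fix t
    have "a + of_real r * cis (2 * pi * t) \<in> S" "a \<in> S"
      using that by (auto intro!: subsetD [OF that(2)] simp: dist_norm norm_mult)
    then show "f (a + of_real r * cis (2 * pi * t)) - f a = g (a + of_real r * cis (2 * pi * t)) - g a"
      using assms by simp
  qed
  then show ?thesis unfolding orient_pres_at_def by (metis (no_types, lifting))
qed

text \<open>On a convex domain of injectivity a single witness circle decides the matter for all
  centres and radii. This is the source of local constancy.\<close>

lemma orient_pres_at_nearby:
  assumes "continuous_on T f" "inj_on f T" "convex T" "cball p r \<subseteq> T" "r > 0" "orient_pres_at S f q"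
    "S \<subseteq> T"
  shows "homotopic_loops (-{0}) (\<lambda>t. f (p + of_real r * cis (2 * pi * t)) - f p) (\<lambda>t. cis (2 * pi * t))"
proof -
  obtain s where s: "s > 0" "cball q s \<subseteq> S"
    "homotopic_loops (-{0}) (\<lambda>t. f (q + of_real s * cis (2 * pi * t)) - f q) (\<lambda>t. cis (2 * pi * t))"
    using assms(6) unfolding orient_pres_at_def by blast
  show ?thesis
    using homotopic_loops_trans [OF homotopic_loops_circles [OF assms(1-4) _ assms(5) s(1)] s(3)] s assms by auto
qed

text \<open>Concentric discs are nested, so the larger one is a convex domain containing both
  circles. The existential radius in \<open>orient_pres_at\<close> may therefore be replaced by any
  admissible one.\<close>

lemma orient_pres_at_radius:
  assumes "continuous_on S f" "inj_on f S" "cball a r \<subseteq> S" "r > 0" "orient_pres_at S f a"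
  shows "homotopic_loops (-{0}) (\<lambda>t. f (a + of_real r * cis (2 * pi * t)) - f a) (\<lambda>t. cis (2 * pi * t))"
proof -
  obtain s where s: "s > 0" "cball a s \<subseteq> S"
    "homotopic_loops (-{0}) (\<lambda>t. f (a + of_real s * cis (2 * pi * t)) - f a) (\<lambda>t. cis (2 * pi * t))"
    using assms(5) unfolding orient_pres_at_def by blast
  have T: "cball a (max r s) \<subseteq> S" using assms(3) s by (simp add: max_def)
  have "orient_pres_at (cball a (max r s)) f a"
    unfolding orient_pres_at_def using s by (intro exI [of _ s]) auto
  then show ?thesis
    using orient_pres_at_nearby [of "cball a (max r s)" f a r "cball a (max r s)" a] assms T
      continuous_on_subset inj_on_subset by (metis convex_cball max.cobounded1 order_refl subset_cball)
qed

lemma orient_pres_at_subset: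
  assumes "continuous_on S f" "inj_on f S" "orient_pres_at S f a" "open T" "a \<in> T" "T \<subseteq> S"
  shows "orient_pres_at T f a"
proof -
  obtain r where r: "r > 0" "cball a r \<subseteq> T" using assms open_contains_cball by meson
  then show ?thesis
    using orient_pres_at_radius [OF assms(1,2), of a r] assms
    unfolding orient_pres_at_def by (intro exI [of _ r]) auto
qed

lemma orient_pres_at_superset:
  "orient_pres_at T f a \<Longrightarrow> T \<subseteq> S \<Longrightarrow> orient_pres_at S f a"
  unfolding orient_pres_at_def by blast

text \<open>Before a second map defined only near \<open>f a\<close> can be applied, the homotopy
  from the image circle to a round circle has to stay in a small punctured disc. Continuity provides
  the radius \<open>r\<close>; the squeeze provides the homotopy.\<close>

lemma small_circle:
  assumes f: "continuous_on S f" "inj_on f S" "open S" "a \<in> S" "orient_pres_at S f a" and s: "s > 0"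
  obtains r where "r > 0" "cball a r \<subseteq> S"
    "\<And>c. 0 < c \<Longrightarrow> c < s \<Longrightarrow> homotopic_loops (ball 0 s - {0})
       (\<lambda>t. f (a + of_real r * cis (2 * pi * t)) - f a) (\<lambda>t. of_real c * cis (2 * pi * t))"
proof -
  have "open (S \<inter> f -` ball (f a) s)"
    using continuous_open_preimage [OF f(1,3)] by simp
  then obtain r where r: "r > 0" "cball a r \<subseteq> S \<inter> f -` ball (f a) s"
    using f(4) s by (metis IntI centre_in_ball open_contains_cball vimage_eq)
  have *: "homotopic_loops (-{0}) (\<lambda>t. f (a + of_real r * cis (2 * pi * t)) - f a) (\<lambda>t. cis (2 * pi * t))"
    by (rule orient_pres_at_radius [OF f(1,2) _ r(1) f(5)]) (use r in auto)
  have "homotopic_loops (ball 0 s - {0})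
       (\<lambda>t. f (a + of_real r * cis (2 * pi * t)) - f a) (\<lambda>t. of_real c * cis (2 * pi * t))"
    if "0 < c" "c < s" for c
  proof (rule homotopic_loops_punctured_ball)
    show "homotopic_loops (-{0}) (\<lambda>t. f (a + of_real r * cis (2 * pi * t)) - f a) (\<lambda>t. of_real c * cis (2 * pi * t))"
      using * homotopic_loops_scaled_circle [OF that(1)] homotopic_loops_trans homotopic_loops_sym by blast
    have "f (a + of_real r * cis (2 * pi * t)) \<in> ball (f a) s" for t
      using r subsetD [OF r(2), of "a + of_real r * cis (2 * pi * t)"] by (auto simp: dist_norm norm_mult)
    then show "path_image (\<lambda>t. f (a + of_real r * cis (2 * pi * t)) - f a) \<subseteq> ball 0 s"
      by (auto simp: path_image_def dist_norm norm_minus_commute)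
    show "path_image (\<lambda>t. of_real c * cis (2 * pi * t)) \<subseteq> ball 0 s"
      using that by (auto simp: path_image_def norm_mult)
  qed
  with r show ?thesis by (intro that) auto
qed

lemma homotopic_loops_image_punctured:
  fixes g :: "complex \<Rightarrow> complex"
  assumes "homotopic_loops (ball 0 s - {0}) k l" "continuous_on T g" "inj_on g T" "ball b s \<subseteq> T"
  shows "homotopic_loops (-{0}) (\<lambda>t. g (b + k t) - g b) (\<lambda>t. g (b + l t) - g b)"
proof -
  have "s > 0"
    using homotopic_loops_imp_subset [OF assms(1)] pathstart_in_path_image [of k]
    by (metis Diff_iff ball_empty empty_iff linorder_not_le subsetD)
  moreover have "b + z \<in> T" if "norm z < s" for z
    using assms(4) that by (auto intro!: subsetD [OF assms(4)] simp: dist_norm)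
  moreover from this [of 0] have "b \<in> T" using \<open>s > 0\<close> by simp
  ultimately have "homotopic_loops (-{0}) ((\<lambda>z. g (b + z) - g b) \<circ> k) ((\<lambda>z. g (b + z) - g b) \<circ> l)"
    by (intro homotopic_loops_continuous_image [OF assms(1)] continuous_intros
        continuous_on_compose2 [OF assms(2)]) (use assms(3) in \<open>auto simp: inj_on_eq_iff\<close>)
  then show ?thesis by (simp add: o_def)
qed

text \<open>Near \<open>f a\<close> the image of a small circle is homotopic to a round circle.
  Applying \<open>g\<close> to that homotopy leaves only the winding of \<open>g\<close> on a round
  circle to be known.\<close>

lemma orient_pres_at_compose:
  assumes f: "continuous_on S f" "inj_on f S" "open S" "a \<in> S" "orient_pres_at S f a"
    and g: "continuous_on T g" "inj_on g T" "open T" "orient_pres_at T g (f a)"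
    and fS: "f ` S \<subseteq> T"
  shows "orient_pres_at S (g \<circ> f) a"
proof -
  have "f a \<in> T" using f fS by auto
  then obtain s where s: "s > 0" "ball (f a) s \<subseteq> T" using g(3) open_contains_ball by meson
  obtain r where r: "r > 0" "cball a r \<subseteq> S"
    and hom: "homotopic_loops (ball 0 s - {0})
       (\<lambda>t. f (a + of_real r * cis (2 * pi * t)) - f a) (\<lambda>t. of_real (s/2) * cis (2 * pi * t))"
    using small_circle [OF f s(1)] s(1) half_gt_zero_iff by (metis field_sum_of_halves less_add_same_cancel1)
  have 1: "homotopic_loops (-{0}) (\<lambda>t. g (f (a + of_real r * cis (2 * pi * t))) - g (f a))
        (\<lambda>t. g (f a + of_real (s/2) * cis (2 * pi * t)) - g (f a))"
    using homotopic_loops_image_punctured [OF hom g(1,2) s(2)] by simp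
  have "cball (f a) (s/2) \<subseteq> T" using s by (auto intro!: subsetD [OF s(2)])
  then have "homotopic_loops (-{0}) (\<lambda>t. g (f a + of_real (s/2) * cis (2 * pi * t)) - g (f a)) (\<lambda>t. cis (2 * pi * t))"
    by (intro orient_pres_at_radius [OF g(1,2)]) (use s g in auto)
  with 1 have "homotopic_loops (-{0}) (\<lambda>t. g (f (a + of_real r * cis (2 * pi * t))) - g (f a)) (\<lambda>t. cis (2 * pi * t))"
    using homotopic_loops_trans by blast
  then show ?thesis unfolding orient_pres_at_def using r by auto
qed

text \<open>The same homotopy as for composites: \<open>g\<close> sends the \<open>f\<close>-image
  of a circle back to the circle itself, so the \<open>g\<close>-image of a round circle is
  homotopic to a round circle.\<close>

lemma orient_pres_at_inverse:
  assumes f: "continuous_on S f" "inj_on f S" "open S" "a \<in> S" "orient_pres_at S f a"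
    and g: "continuous_on T g" "inj_on g T" "open T" "f a \<in> T"
    and gf: "\<And>z. z \<in> S \<Longrightarrow> g (f z) = z"
  shows "orient_pres_at T g (f a)"
proof -
  obtain s where s: "s > 0" "ball (f a) s \<subseteq> T" using g(3,4) open_contains_ball by meson
  obtain r where r: "r > 0" "cball a r \<subseteq> S"
    and hom: "homotopic_loops (ball 0 s - {0})
       (\<lambda>t. f (a + of_real r * cis (2 * pi * t)) - f a) (\<lambda>t. of_real (s/2) * cis (2 * pi * t))"
    using small_circle [OF f s(1)] s(1) half_gt_zero_iff by (metis field_sum_of_halves less_add_same_cancel1)
  have in_S: "a + of_real r * cis (2 * pi * t) \<in> S" for t
    using r by (auto intro!: subsetD [OF r(2)] simp: dist_norm norm_mult)
  have 1: "homotopic_loops (-{0}) (\<lambda>t. of_real r * cis (2 * pi * t))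
        (\<lambda>t. g (f a + of_real (s/2) * cis (2 * pi * t)) - g (f a))"
    using homotopic_loops_image_punctured [OF hom g(1,2) s(2)] in_S f(4) by (simp add: gf)
  have "homotopic_loops (-{0}) (\<lambda>t. g (f a + of_real (s/2) * cis (2 * pi * t)) - g (f a)) (\<lambda>t. cis (2 * pi * t))"
    using 1 homotopic_loops_scaled_circle [OF r(1)] homotopic_loops_trans homotopic_loops_sym by blast
  moreover have "cball (f a) (s/2) \<subseteq> T" using s by (auto intro!: subsetD [OF s(2)])
  ultimately show ?thesis unfolding orient_pres_at_def using s by (intro exI [of _ "s/2"]) auto
qed

section \<open>Local orientation on surfaces\<close>

text \<open>The name anticipates \<open>open_embedding_on_image\<close>: continuity and injectivity
  on an open set are recorded, and invariance of domain makes the image open.\<close>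

definition open_embedding_on :: "'a topology \<Rightarrow> 'a set \<Rightarrow> ('a \<Rightarrow> 'a) \<Rightarrow> bool" where
  "open_embedding_on X N h \<longleftrightarrow> openin X N \<and> continuous_map (subtopology X N) X h \<and> inj_on h N"

text \<open>Existential in the charts, so that one good pair establishes it;
  \<open>orient_pres_local_chart\<close> then yields every other pair, and
  \<open>orient_pres_iff_local\<close> recovers \<open>orient_pres\<close>.\<close>

definition orient_pres_local :: "'a topology \<Rightarrow> (('a \<Rightarrow> complex) \<times> 'a set) set \<Rightarrow> ('a \<Rightarrow> 'a) \<Rightarrow> 'a \<Rightarrow> bool" where
  "orient_pres_local X At h p \<longleftrightarrow> (\<exists>\<phi> U \<psi> V W. (\<phi>,U) \<in> At \<and> (\<psi>,V) \<in> At \<and> p \<in> W \<and> W \<subseteq> U \<and> h ` W \<subseteq> V \<and>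
     open_embedding_on X W h \<and> orient_pres_at (\<phi> ` W) (\<psi> \<circ> h \<circ> inv_into U \<phi>) (\<phi> p))"

lemma open_embedding_on_subset:
  "open_embedding_on X N h \<Longrightarrow> openin X M \<Longrightarrow> M \<subseteq> N \<Longrightarrow> open_embedding_on X M h"
  unfolding open_embedding_on_def
  by (meson continuous_map_from_subtopology_mono inj_on_subset)

lemma open_embedding_on_preimage:
  assumes "open_embedding_on X N h" "openin X V" "openin X U"
  shows "openin X {x \<in> U \<inter> N. h x \<in> V}"
proof -
  have N: "openin X N" "continuous_map (subtopology X N) X h"
    using assms by (auto simp: open_embedding_on_def)
  have "openin (subtopology X N) {x \<in> topspace (subtopology X N). h x \<in> V}"
    by (rule openin_continuous_map_preimage [OF N(2) assms(2)])
  moreover have "topspace (subtopology X N) = N"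
    using N openin_subset by (metis topspace_subtopology_subset)
  ultimately have "openin X {x \<in> N. h x \<in> V}"
    using N openin_trans_full by metis
  then have "openin X (U \<inter> {x \<in> N. h x \<in> V})" using assms by blast
  moreover have "U \<inter> {x \<in> N. h x \<in> V} = {x \<in> U \<inter> N. h x \<in> V}" by auto
  ultimately show ?thesis by simp
qed

lemma open_embedding_on_cong:
  "open_embedding_on X N h \<Longrightarrow> (\<And>x. x \<in> N \<Longrightarrow> h x = k x) \<Longrightarrow> open_embedding_on X N k"
  unfolding open_embedding_on_def
  by (metis (mono_tags, lifting) continuous_map_eq inf_le2 inj_on_cong subsetD topspace_subtopology)

lemma open_embedding_on_in: "open_embedding_on X N h \<Longrightarrow> x \<in> N \<Longrightarrow> h x \<in> topspace X"
  unfolding open_embedding_on_def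
  by (metis continuous_map_image_subset_topspace imageI openin_subset subsetD topspace_subtopology_subset)

lemma open_embedding_on_compose:
  assumes "open_embedding_on X N h" "open_embedding_on X M g" "h ` N \<subseteq> M"
  shows "open_embedding_on X N (g \<circ> h)"
proof -
  have "continuous_map (subtopology X N) (subtopology X M) h"
    using assms by (auto simp: open_embedding_on_def continuous_map_in_subtopology image_subset_iff)
  then show ?thesis
    using assms unfolding open_embedding_on_def
    by (meson comp_inj_on continuous_map_compose inj_on_subset)
qed

lemma chart_map_facts:
  assumes U: "openin X U" and hom: "homeomorphic_map (subtopology X U) (top_of_set (\<phi> ` U)) \<phi>"
  shows "inj_on \<phi> U" "continuous_map (subtopology X U) euclidean \<phi>"
    "continuous_map (top_of_set (\<phi> ` U)) (subtopology X U) (inv_into U \<phi>)"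
proof -
  have top: "topspace (subtopology X U) = U"
    using U openin_subset by (metis topspace_subtopology_subset)
  show "continuous_map (subtopology X U) euclidean \<phi>"
    using homeomorphic_imp_continuous_map [OF hom] continuous_map_into_fulltopology by blast
  show inj: "inj_on \<phi> U"
    using homeomorphic_imp_injective_map [OF hom] top by simp
  obtain g where g: "homeomorphic_maps (subtopology X U) (top_of_set (\<phi> ` U)) \<phi> g"
    using hom homeomorphic_map_maps by blast
  show "continuous_map (top_of_set (\<phi> ` U)) (subtopology X U) (inv_into U \<phi>)"
  proof (rule continuous_map_eq)
    show "continuous_map (top_of_set (\<phi> ` U)) (subtopology X U) g"
      using g homeomorphic_maps_def by blast
    fix x assume "x \<in> topspace (top_of_set (\<phi> ` U))"
    then show "g x = inv_into U \<phi> x"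
      using g inj top by (auto simp: homeomorphic_maps_def)
  qed
qed

lemma plane_chart_facts:
  assumes "plane_chart X \<phi> U"
  shows "openin X U" "inj_on \<phi> U" "continuous_map (subtopology X U) euclidean \<phi>"
    "continuous_map (top_of_set (\<phi> ` U)) (subtopology X U) (inv_into U \<phi>)"
  using assms chart_map_facts [of X U \<phi>] by (auto simp: plane_chart_def)

lemma plane_chart_open_image:
  assumes "plane_chart X \<phi> U" "openin X V" "V \<subseteq> U"
  shows "open (\<phi> ` V)"
proof -
  have "open_map (subtopology X U) (top_of_set (\<phi> ` U)) \<phi>"
    using assms(1) homeomorphic_imp_open_map by (auto simp: plane_chart_def)
  then have "openin (top_of_set (\<phi> ` U)) (\<phi> ` V)"
    using assms by (simp add: open_map_def openin_subset_topspace_eq openin_subtopology_Int2 Int_absorb1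
        openin_subtopology plane_chart_facts(1)) (metis Int_absorb1 inf_commute)
  then show ?thesis
    using assms(1) by (auto simp: plane_chart_def openin_open_eq)
qed

lemma plane_chart_inv_continuous:
  assumes "plane_chart X \<phi> U" "V \<subseteq> U"
  shows "continuous_map (top_of_set (\<phi> ` V)) (subtopology X V) (inv_into U \<phi>)"
proof -
  have "continuous_map (top_of_set (\<phi> ` V)) (subtopology X U) (inv_into U \<phi>)"
    using plane_chart_facts(4) [OF assms(1)] assms(2) continuous_map_from_subtopology_mono by blast
  moreover have "inv_into U \<phi> ` \<phi> ` V \<subseteq> V"
    using plane_chart_facts(2) [OF assms(1)] assms(2) by (auto simp: image_subset_iff subset_iff)
  ultimately show ?thesis
    using continuous_map_into_fulltopology by (fastforce simp: continuous_map_in_subtopology)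
qed

locale oriented_surface =
  fixes X :: "'a topology" and At :: "(('a \<Rightarrow> complex) \<times> 'a set) set"
  assumes surface: "surface X" and atlas: "oriented_atlas X At"
begin

lemma chart: "(\<phi>,U) \<in> At \<Longrightarrow> plane_chart X \<phi> U"
  using atlas by (auto simp: oriented_atlas_def)

lemma chart_at: assumes "p \<in> topspace X" obtains \<phi> U where "(\<phi>,U) \<in> At" "p \<in> U" "plane_chart X \<phi> U"
proof -
  have "\<exists>(\<phi>, U) \<in> At. p \<in> U" using atlas assms unfolding oriented_atlas_def by blast
  then show ?thesis using that chart by auto
qed

lemma Hausdorff: "Hausdorff_space X" and connected: "connected_space X"
  using surface by (auto simp: surface_def)

text \<open>Near each image point a chart turns \<open>f\<close> into an injective continuous map
  between planar sets, where invariance of domain applies.\<close>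

lemma openin_planar_image:
  fixes f :: "complex \<Rightarrow> 'a"
  assumes D: "open D" and f: "continuous_map (top_of_set D) X f" "inj_on f D"
  shows "openin X (f ` D)"
proof (subst openin_subopen, intro ballI)
  fix y assume "y \<in> f ` D"
  then obtain d where d: "d \<in> D" "y = f d" by blast
  then have "y \<in> topspace X"
    using f(1) continuous_map_image_subset_topspace by fastforce
  then obtain \<phi> U where U: "(\<phi>,U) \<in> At" "y \<in> U" "plane_chart X \<phi> U" by (rule chart_at)
  define D' where "D' = {z \<in> D. f z \<in> U}"
  have "openin (top_of_set D) {z \<in> topspace (top_of_set D). f z \<in> U}"
    by (rule openin_continuous_map_preimage [OF f(1)]) (use U plane_chart_facts in blast)
  then have D': "open D'"
    using D by (simp add: D'_def openin_open_eq)
  have "continuous_map (top_of_set D') (subtopology X U) f"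
    using f(1) by (auto simp: continuous_map_in_subtopology D'_def intro: continuous_map_from_subtopology_mono)
  then have "continuous_map (top_of_set D') euclidean (\<phi> \<circ> f)"
    by (rule continuous_map_compose [OF _ plane_chart_facts(3) [OF U(3)]])
  moreover have inj: "inj_on (\<phi> \<circ> f) D'"
    using f(2) plane_chart_facts(2) [OF U(3)] by (auto simp: D'_def inj_on_def)
  ultimately have E: "open ((\<phi> \<circ> f) ` D')"
    by (intro invariance_of_domain D') auto
  have "openin (subtopology X U) {x \<in> topspace (subtopology X U). \<phi> x \<in> (\<phi> \<circ> f) ` D'}"
    by (rule openin_continuous_map_preimage [OF plane_chart_facts(3) [OF U(3)]]) (use E in simp)
  moreover have "topspace (subtopology X U) = U"
    using plane_chart_facts(1) [OF U(3)] openin_subset by (metis topspace_subtopology_subset)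
  ultimately have "openin X {x \<in> U. \<phi> x \<in> (\<phi> \<circ> f) ` D'}"
    using plane_chart_facts(1) [OF U(3)] openin_trans_full by metis
  moreover have "{x \<in> U. \<phi> x \<in> (\<phi> \<circ> f) ` D'} = f ` D'"
    using plane_chart_facts(2) [OF U(3)] by (auto simp: D'_def inj_on_def)
  ultimately show "\<exists>T. openin X T \<and> y \<in> T \<and> T \<subseteq> f ` D"
    using d U by (intro exI [of _ "f ` D'"]) (auto simp: D'_def)
qed

lemma open_planar_image:
  fixes f :: "'a \<Rightarrow> complex"
  assumes N: "openin X N" and f: "continuous_map (subtopology X N) euclidean f" "inj_on f N"
  shows "open (f ` N)"
proof (subst open_subopen, intro ballI)
  fix y assume "y \<in> f ` N"
  then obtain p where p: "p \<in> N" "y = f p" by blast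
  then have "p \<in> topspace X" using N openin_subset by blast
  then obtain \<phi> U where U: "(\<phi>,U) \<in> At" "p \<in> U" "plane_chart X \<phi> U" by (rule chart_at)
  have UN: "openin X (U \<inter> N)" using U N plane_chart_facts(1) by blast
  have inj: "inj_on \<phi> U" using U plane_chart_facts by blast
  have op: "open (\<phi> ` (U \<inter> N))"
    by (rule plane_chart_open_image [OF U(3) UN]) auto
  have "continuous_map (top_of_set (\<phi> ` (U \<inter> N))) euclidean (f \<circ> inv_into U \<phi>)"
    by (rule continuous_map_compose [OF plane_chart_inv_continuous [OF U(3)]])
       (auto intro: continuous_map_from_subtopology_mono [OF f(1)])
  moreover have "inj_on (f \<circ> inv_into U \<phi>) (\<phi> ` (U \<inter> N))"
    using inj f(2) by (auto simp: inj_on_def)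
  ultimately have "open ((f \<circ> inv_into U \<phi>) ` \<phi> ` (U \<inter> N))"
    by (intro invariance_of_domain op) auto
  moreover have "(f \<circ> inv_into U \<phi>) ` \<phi> ` (U \<inter> N) = f ` (U \<inter> N)"
    using inj by (force simp: image_iff)
  ultimately show "\<exists>T. open T \<and> y \<in> T \<and> T \<subseteq> f ` N"
    using p U by (intro exI [of _ "f ` (U \<inter> N)"]) auto
qed

text \<open>Around each point the map is precomposed with the inverse of a chart, which reduces the
  claim to \<open>openin_planar_image\<close>.\<close>

lemma open_embedding_on_image:
  assumes "open_embedding_on X N h"
  shows "openin X (h ` N)"
proof (subst openin_subopen, intro ballI)
  have N: "openin X N" and h: "continuous_map (subtopology X N) X h" "inj_on h N"
    using assms by (auto simp: open_embedding_on_def)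
  fix y assume "y \<in> h ` N"
  then obtain p where p: "p \<in> N" "y = h p" by blast
  then have "p \<in> topspace X" using N openin_subset by blast
  then obtain \<phi> U where U: "(\<phi>,U) \<in> At" "p \<in> U" "plane_chart X \<phi> U" by (rule chart_at)
  have UN: "openin X (U \<inter> N)" using U N plane_chart_facts(1) by blast
  have inj: "inj_on \<phi> U" using U plane_chart_facts by blast
  have "openin X ((h \<circ> inv_into U \<phi>) ` \<phi> ` (U \<inter> N))"
  proof (rule openin_planar_image)
    show "open (\<phi> ` (U \<inter> N))"
      by (rule plane_chart_open_image [OF U(3) UN]) auto
    show "continuous_map (top_of_set (\<phi> ` (U \<inter> N))) X (h \<circ> inv_into U \<phi>)"
      by (rule continuous_map_compose [OF plane_chart_inv_continuous [OF U(3)]])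
         (auto intro: continuous_map_from_subtopology_mono [OF h(1)])
    show "inj_on (h \<circ> inv_into U \<phi>) (\<phi> ` (U \<inter> N))"
      using inj h(2) by (auto simp: inj_on_def)
  qed
  moreover have "(h \<circ> inv_into U \<phi>) ` \<phi> ` (U \<inter> N) = h ` (U \<inter> N)"
    using inj by (force simp: image_iff)
  ultimately show "\<exists>T. openin X T \<and> y \<in> T \<and> T \<subseteq> h ` N"
    using p U by (intro exI [of _ "h ` (U \<inter> N)"]) auto
qed

text \<open>A preimage under \<open>g\<close> is an image under \<open>h\<close>, and images of open
  sets under \<open>h\<close> are open.\<close>

lemma open_embedding_on_inverse:
  assumes "open_embedding_on X N h" "\<And>x. x \<in> N \<Longrightarrow> g (h x) = x"
  shows "open_embedding_on X (h ` N) g"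
  unfolding open_embedding_on_def
proof (intro conjI)
  show op: "openin X (h ` N)" using assms open_embedding_on_image by blast
  then have top: "topspace (subtopology X (h ` N)) = h ` N"
    using openin_subset by (metis topspace_subtopology_subset)
  have N: "openin X N" using assms by (auto simp: open_embedding_on_def)
  show "continuous_map (subtopology X (h ` N)) X g"
    unfolding continuous_map_def top
  proof (intro conjI allI impI)
    show "g \<in> h ` N \<rightarrow> topspace X" using assms(2) N openin_subset by fastforce
    fix O' assume O': "openin X O'"
    have "{x \<in> h ` N. g x \<in> O'} = h ` (N \<inter> O')" using assms(2) by auto
    moreover have "openin X (h ` (N \<inter> O'))"
      using assms(1) N O' by (blast intro: open_embedding_on_image open_embedding_on_subset)
    ultimately show "openin (subtopology X (h ` N)) {x \<in> h ` N. g x \<in> O'}"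
      using op by (simp add: openin_open_subtopology) blast
  qed
  show "inj_on g (h ` N)" using assms(2) by (auto simp: inj_on_def)
qed

text \<open>A priori \<open>h\<close> respects the topology of the subspace \<open>S\<close> only.
  Invariance of domain makes the image of the interior open in \<open>X\<close>, hence again part of
  the interior, which is where \<open>orient_pres\<close> looks.\<close>

lemma homeomorphic_map_open_embedding:
  assumes "homeomorphic_map (subtopology X S) (subtopology X S) h" "S \<subseteq> topspace X"
  shows "open_embedding_on X (X interior_of S) h" "h ` (X interior_of S) \<subseteq> X interior_of S"
proof -
  have top: "topspace (subtopology X S) = S" using assms by auto
  have sub: "X interior_of S \<subseteq> S" by (rule interior_of_subset)
  have cont: "continuous_map (subtopology X S) (subtopology X S) h" and "inj_on h S"
    and "h ` S = S"
    using assms(1) homeomorphic_imp_continuous_map homeomorphic_imp_injective_map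
      homeomorphic_imp_surjective_map top by fastforce+
  then show *: "open_embedding_on X (X interior_of S) h"
    unfolding open_embedding_on_def
    using sub by (meson continuous_map_from_subtopology_mono continuous_map_into_fulltopology inj_on_subset openin_interior_of)
  show "h ` (X interior_of S) \<subseteq> X interior_of S"
    by (rule interior_of_maximal) (use * open_embedding_on_image sub \<open>h ` S = S\<close> in blast)+
qed

lemma chart_rep:
  assumes "(\<phi>,U) \<in> At" "(\<psi>,V) \<in> At" "open_embedding_on X W h" "W \<subseteq> U" "h ` W \<subseteq> V"
  shows "open (\<phi> ` W)" "continuous_on (\<phi> ` W) (\<psi> \<circ> h \<circ> inv_into U \<phi>)" "inj_on (\<psi> \<circ> h \<circ> inv_into U \<phi>) (\<phi> ` W)"
proof -
  note c = chart [OF assms(1)] chart [OF assms(2)]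
  show "open (\<phi> ` W)"
    using assms(3) plane_chart_open_image [OF c(1) _ assms(4)] by (auto simp: open_embedding_on_def)
  have "continuous_map (subtopology X W) (subtopology X V) h"
    using assms by (auto simp: open_embedding_on_def continuous_map_in_subtopology image_subset_iff)
  then have "continuous_map (top_of_set (\<phi> ` W)) euclidean (\<psi> \<circ> (h \<circ> inv_into U \<phi>))"
    by (intro continuous_map_compose [OF continuous_map_compose [OF plane_chart_inv_continuous [OF c(1) assms(4)]]
          plane_chart_facts(3) [OF c(2)]])
  then show "continuous_on (\<phi> ` W) (\<psi> \<circ> h \<circ> inv_into U \<phi>)" by (simp add: o_assoc)
  show "inj_on (\<psi> \<circ> h \<circ> inv_into U \<phi>) (\<phi> ` W)"
  proof -
    have "h x \<in> V" "x \<in> U" if "x \<in> W" for x using assms(4,5) that by auto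
    then show ?thesis
      using plane_chart_facts(2) [OF c(1)] plane_chart_facts(2) [OF c(2)] assms(3)
      by (auto simp: inj_on_def open_embedding_on_def) metis
  qed
qed

lemma open_embedding_on_id: "openin X W \<Longrightarrow> open_embedding_on X W (\<lambda>x. x)"
  by (simp add: open_embedding_on_def continuous_map_from_subtopology)

lemma transition_rep:
  assumes "(\<phi>,U) \<in> At" "(\<psi>,V) \<in> At" "openin X W" "W \<subseteq> U \<inter> V" "p \<in> W"
  shows "open (\<phi> ` W)" "continuous_on (\<phi> ` W) (\<psi> \<circ> inv_into U \<phi>)" "inj_on (\<psi> \<circ> inv_into U \<phi>) (\<phi> ` W)"
    "orient_pres_at (\<phi> ` W) (\<psi> \<circ> inv_into U \<phi>) (\<phi> p)"
proof -
  have UV: "openin X (U \<inter> V)" using assms chart plane_chart_facts(1) by blast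
  have *: "\<psi> \<circ> (\<lambda>x. x) \<circ> inv_into U \<phi> = \<psi> \<circ> inv_into U \<phi>" by auto
  note r = chart_rep [OF assms(1,2) open_embedding_on_id, unfolded *]
  show "open (\<phi> ` W)" "continuous_on (\<phi> ` W) (\<psi> \<circ> inv_into U \<phi>)" "inj_on (\<psi> \<circ> inv_into U \<phi>) (\<phi> ` W)"
    using r [OF assms(3)] assms(4) by auto
  have "p \<in> U \<inter> V" using assms by auto
  then have "orient_pres_at (\<phi> ` (U \<inter> V)) (\<psi> \<circ> inv_into U \<phi>) (\<phi> p)"
    using atlas assms(1,2) unfolding oriented_atlas_def by fastforce
  then show "orient_pres_at (\<phi> ` W) (\<psi> \<circ> inv_into U \<phi>) (\<phi> p)"
    by (rule orient_pres_at_subset [rotated 2]) (use r [OF UV] \<open>open (\<phi> ` W)\<close> assms in auto)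
qed

text \<open>In another pair of charts the representative is the known one with a transition map of
  the oriented atlas on either side, and all three factors preserve orientation.\<close>

lemma orient_pres_local_chart:
  assumes h: "open_embedding_on X W h" and p: "p \<in> W" and op: "orient_pres_local X At h p"
    and U: "(\<phi>,U) \<in> At" "W \<subseteq> U" and V: "(\<psi>,V) \<in> At" "h ` W \<subseteq> V"
  shows "orient_pres_at (\<phi> ` W) (\<psi> \<circ> h \<circ> inv_into U \<phi>) (\<phi> p)"
proof -
  obtain \<phi>0 U0 \<psi>0 V0 W0 where 0: "(\<phi>0,U0) \<in> At" "(\<psi>0,V0) \<in> At" "p \<in> W0" "W0 \<subseteq> U0" "h ` W0 \<subseteq> V0"
    and h0: "open_embedding_on X W0 h" and op0: "orient_pres_at (\<phi>0 ` W0) (\<psi>0 \<circ> h \<circ> inv_into U0 \<phi>0) (\<phi>0 p)"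
    using op unfolding orient_pres_local_def by blast
  \<comment> \<open>Both chart pairs make sense on this intersection. The result is transferred back
    to \<open>W\<close> at the end, since enlarging the domain does not affect the witness
    circle.\<close>
  define W1 where "W1 = W \<inter> W0"
  have W1: "openin X W1" "p \<in> W1" "W1 \<subseteq> U \<inter> U0"
    using h h0 p U V 0 by (auto simp: W1_def open_embedding_on_def)
  have h1: "open_embedding_on X W1 h"
    using h W1(1) open_embedding_on_subset W1_def by blast
  note t1 = transition_rep [OF U(1) 0(1) W1(1,3,2)]
  note r1 = chart_rep [OF 0(1,2) h0 0(4,5)]
  have r2: "open (\<phi>0 ` W1)" "continuous_on (\<phi>0 ` W1) (\<psi>0 \<circ> h \<circ> inv_into U0 \<phi>0)"
    "inj_on (\<psi>0 \<circ> h \<circ> inv_into U0 \<phi>0) (\<phi>0 ` W1)"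
    using chart_rep [OF 0(1,2) h1] W1 0 by (auto simp: W1_def)
  have op2: "orient_pres_at (\<phi>0 ` W1) (\<psi>0 \<circ> h \<circ> inv_into U0 \<phi>0) (\<phi>0 p)"
    by (rule orient_pres_at_subset [OF r1(2,3) op0 r2(1)]) (use W1 in \<open>auto simp: W1_def\<close>)
  have W3: "openin X (h ` W1)" "h p \<in> h ` W1" "h ` W1 \<subseteq> V0 \<inter> V"
    using h1 open_embedding_on_image W1 0 V by (auto simp: W1_def)
  note t3 = transition_rep [OF 0(2) V(1) W3(1,3,2)]
  have inj: "inj_on \<phi> U" "inj_on \<phi>0 U0" "inj_on \<psi>0 V0"
    using U 0 chart plane_chart_facts(2) by blast+
  have e1: "(\<phi>0 \<circ> inv_into U \<phi>) (\<phi> x) = \<phi>0 x" if "x \<in> W1" for x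
    using that W1 inj by auto
  have e2: "(\<psi>0 \<circ> h \<circ> inv_into U0 \<phi>0) (\<phi>0 x) = \<psi>0 (h x)" if "x \<in> W1" for x
    using that W1 inj by auto
  have e3: "(\<psi> \<circ> inv_into V0 \<psi>0) (\<psi>0 (h x)) = \<psi> (h x)" if "x \<in> W1" for x
    using that W3 inj by (auto simp: image_subset_iff)
  have im1: "(\<phi>0 \<circ> inv_into U \<phi>) ` \<phi> ` W1 = \<phi>0 ` W1"
    unfolding image_image using e1 by (rule image_cong [OF refl])
  have op12: "orient_pres_at (\<phi> ` W1) ((\<psi>0 \<circ> h \<circ> inv_into U0 \<phi>0) \<circ> (\<phi>0 \<circ> inv_into U \<phi>)) (\<phi> p)"
    by (rule orient_pres_at_compose [OF t1(2,3,1) _ t1(4) r2(2,3,1)])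
       (use op2 e1 W1(2) in auto)
  have c12: "continuous_on (\<phi> ` W1) ((\<psi>0 \<circ> h \<circ> inv_into U0 \<phi>0) \<circ> (\<phi>0 \<circ> inv_into U \<phi>))"
    by (rule continuous_on_compose [OF t1(2)]) (simp only: im1 r2(2))
  have i12: "inj_on ((\<psi>0 \<circ> h \<circ> inv_into U0 \<phi>0) \<circ> (\<phi>0 \<circ> inv_into U \<phi>)) (\<phi> ` W1)"
    by (rule comp_inj_on [OF t1(3)]) (simp only: im1 r2(3))
  have "orient_pres_at (\<phi> ` W1) ((\<psi> \<circ> inv_into V0 \<psi>0) \<circ> ((\<psi>0 \<circ> h \<circ> inv_into U0 \<phi>0) \<circ> (\<phi>0 \<circ> inv_into U \<phi>))) (\<phi> p)"
    by (rule orient_pres_at_compose [OF c12 i12 t1(1) _ op12 t3(2,3,1)])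
       (use t3(4) e1 e2 W1(2) in auto)
  moreover have "((\<psi> \<circ> inv_into V0 \<psi>0) \<circ> ((\<psi>0 \<circ> h \<circ> inv_into U0 \<phi>0) \<circ> (\<phi>0 \<circ> inv_into U \<phi>))) z
     = (\<psi> \<circ> h \<circ> inv_into U \<phi>) z" if "z \<in> \<phi> ` W1" for z
    using that e1 e2 e3 inj(1) W1(3) by auto
  ultimately have "orient_pres_at (\<phi> ` W1) (\<psi> \<circ> h \<circ> inv_into U \<phi>) (\<phi> p)"
    using orient_pres_at_cong [of "\<phi> ` W1"] by blast
  then show ?thesis
    by (rule orient_pres_at_superset) (auto simp: W1_def)
qed

lemma local_charts:
  assumes "open_embedding_on X N h" "p \<in> N" "openin X M" "h p \<in> M"
  obtains \<phi> U \<psi> V W where "(\<phi>,U) \<in> At" "(\<psi>,V) \<in> At" "p \<in> W" "W \<subseteq> U" "W \<subseteq> N" "h ` W \<subseteq> V" "h ` W \<subseteq> M"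
    "open_embedding_on X W h"
proof -
  have "p \<in> topspace X" "h p \<in> topspace X"
    using assms openin_subset by (auto simp: open_embedding_on_def)
  then obtain \<phi> U \<psi> V where *: "(\<phi>,U) \<in> At" "p \<in> U" "(\<psi>,V) \<in> At" "h p \<in> V"
    using chart_at by metis
  then have UV: "openin X U" "openin X (V \<inter> M)" using chart plane_chart_facts(1) assms(3) by blast+
  let ?W = "{x \<in> U \<inter> N. h x \<in> V \<inter> M}"
  have "openin X ?W" by (rule open_embedding_on_preimage [OF assms(1) UV(2,1)])
  then have "open_embedding_on X ?W h" using assms(1) open_embedding_on_subset by blast
  then show ?thesis using that [of \<phi> U \<psi> V ?W] * assms by auto
qed

lemma orient_pres_iff_local:
  assumes "open_embedding_on X (X interior_of S) h"
  shows "orient_pres X At S h \<longleftrightarrow> (\<forall>p \<in> X interior_of S. orient_pres_local X At h p)"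
proof
  assume op: "orient_pres X At S h"
  show "\<forall>p \<in> X interior_of S. orient_pres_local X At h p"
  proof
    fix p assume p: "p \<in> X interior_of S"
    have "h p \<in> topspace X" by (rule open_embedding_on_in [OF assms p])
    moreover have "p \<in> topspace X" using p interior_of_subset_topspace by fast
    ultimately obtain \<phi> U \<psi> V where *: "(\<phi>,U) \<in> At" "p \<in> U" "(\<psi>,V) \<in> At" "h p \<in> V"
      using chart_at by metis
    let ?W = "{x \<in> U \<inter> X interior_of S. h x \<in> V}"
    have "openin X ?W" by (rule open_embedding_on_preimage [OF assms]) (use * chart plane_chart_facts(1) in blast)+
    then have "open_embedding_on X ?W h" using assms open_embedding_on_subset by blast
    moreover have "orient_pres_at (\<phi> ` ?W) (\<psi> \<circ> h \<circ> inv_into U \<phi>) (\<phi> p)"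
      using op * p unfolding orient_pres_def Let_def by fastforce
    ultimately show "orient_pres_local X At h p"
      unfolding orient_pres_local_def using * p by (intro exI [of _ \<phi>] exI [of _ U] exI [of _ \<psi>] exI [of _ V] exI [of _ ?W]) auto
  qed
next
  assume loc: "\<forall>p \<in> X interior_of S. orient_pres_local X At h p"
  show "orient_pres X At S h"
    unfolding orient_pres_def Let_def
  proof clarify
    fix \<phi> U \<psi> V p assume *: "(\<phi>,U) \<in> At" "(\<psi>,V) \<in> At" "p \<in> U" "p \<in> X interior_of S" "h p \<in> V"
    let ?W = "{x \<in> U \<inter> X interior_of S. h x \<in> V}"
    have "openin X ?W" by (rule open_embedding_on_preimage [OF assms]) (use * chart plane_chart_facts(1) in blast)+
    then have "open_embedding_on X ?W h" using assms open_embedding_on_subset by blast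
    then show "orient_pres_at (\<phi> ` ?W) (\<psi> \<circ> h \<circ> inv_into U \<phi>) (\<phi> p)"
      by (rule orient_pres_local_chart) (use * loc in auto)
  qed
qed

text \<open>The middle chart has to serve as target for \<open>h\<close> and as source for
  \<open>g\<close>, so the neighbourhood for \<open>g\<close> is chosen first and the one for
  \<open>h\<close> is then shrunk into its preimage.\<close>

lemma orient_pres_local_compose:
  assumes "open_embedding_on X N h" "p \<in> N" "open_embedding_on X M g" "h p \<in> M"
    and "orient_pres_local X At h p" "orient_pres_local X At g (h p)"
  shows "orient_pres_local X At (g \<circ> h) p"
proof -
  have gt: "openin X M" "g (h p) \<in> topspace X"
    using assms(3) open_embedding_on_in [OF assms(3,4)] by (auto simp: open_embedding_on_def)
  obtain \<psi> V \<eta> Y M' where 2: "(\<psi>,V) \<in> At" "(\<eta>,Y) \<in> At" "h p \<in> M'" "M' \<subseteq> V" "M' \<subseteq> M" "g ` M' \<subseteq> Y"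
    and g: "open_embedding_on X M' g"
    by (rule local_charts [OF assms(3,4) openin_topspace gt(2)]) blast
  have "openin X M'" using g by (auto simp: open_embedding_on_def)
  then obtain \<phi> U \<psi>' V' W where 1: "(\<phi>,U) \<in> At" "p \<in> W" "W \<subseteq> U" "h ` W \<subseteq> M'" and h: "open_embedding_on X W h"
    using local_charts [OF assms(1,2) _ 2(3)] by metis
  note r1 = chart_rep [OF 1(1) 2(1) h 1(3)] and r2 = chart_rep [OF 2(1,2) g 2(4,6)]
  have hW: "h ` W \<subseteq> V" using 1 2 by auto
  have inj: "inj_on \<phi> U" "inj_on \<psi> V" using 1 2 chart plane_chart_facts(2) by blast+
  have e1: "(\<psi> \<circ> h \<circ> inv_into U \<phi>) (\<phi> x) = \<psi> (h x)" if "x \<in> W" for x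
    using that 1 inj by auto
  have "orient_pres_at (\<phi> ` W) ((\<eta> \<circ> g \<circ> inv_into V \<psi>) \<circ> (\<psi> \<circ> h \<circ> inv_into U \<phi>)) (\<phi> p)"
  proof (rule orient_pres_at_compose [OF r1(2) r1(3) r1(1) _ _ r2(2,3,1)])
    show "orient_pres_at (\<phi> ` W) (\<psi> \<circ> h \<circ> inv_into U \<phi>) (\<phi> p)"
      by (rule orient_pres_local_chart [OF h 1(2) assms(5) 1(1) 1(3) 2(1) hW])
    have "orient_pres_at (\<psi> ` M') (\<eta> \<circ> g \<circ> inv_into V \<psi>) (\<psi> (h p))"
      by (rule orient_pres_local_chart [OF g 2(3) assms(6) 2(1) 2(4) 2(2) 2(6)])
    then show "orient_pres_at (\<psi> ` M') (\<eta> \<circ> g \<circ> inv_into V \<psi>) ((\<psi> \<circ> h \<circ> inv_into U \<phi>) (\<phi> p))"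
      using e1 1 by simp
  qed (use hW 1 e1 in auto)
  moreover have "((\<eta> \<circ> g \<circ> inv_into V \<psi>) \<circ> (\<psi> \<circ> h \<circ> inv_into U \<phi>)) z = (\<eta> \<circ> (g \<circ> h) \<circ> inv_into U \<phi>) z"
    if "z \<in> \<phi> ` W" for z
    using that inj 1 hW by (auto simp: subset_iff image_subset_iff)
  ultimately have "orient_pres_at (\<phi> ` W) (\<eta> \<circ> (g \<circ> h) \<circ> inv_into U \<phi>) (\<phi> p)"
    using orient_pres_at_cong [of "\<phi> ` W"] by blast
  moreover have "open_embedding_on X W (g \<circ> h)"
    using h g 1 open_embedding_on_compose by blast
  moreover have "(g \<circ> h) ` W \<subseteq> Y" using 1 2 by (auto simp: image_subset_iff)
  ultimately show ?thesis unfolding orient_pres_local_def using 1 2 by blast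
qed

lemma orient_pres_local_inverse:
  assumes "open_embedding_on X N h" "p \<in> N" "\<And>x. x \<in> N \<Longrightarrow> g (h x) = x" "orient_pres_local X At h p"
  shows "orient_pres_local X At g (h p)"
proof -
  have "h p \<in> topspace X" by (rule open_embedding_on_in [OF assms(1,2)])
  then obtain \<phi> U \<psi> V W where *: "(\<phi>,U) \<in> At" "(\<psi>,V) \<in> At" "p \<in> W" "W \<subseteq> U" "W \<subseteq> N" "h ` W \<subseteq> V"
    and h: "open_embedding_on X W h"
    using local_charts [OF assms(1,2) openin_topspace] by metis
  have g: "open_embedding_on X (h ` W) g"
    using open_embedding_on_inverse [OF h] assms(3) * by blast
  have gh: "g ` h ` W \<subseteq> U" using assms(3) * by (auto simp: subset_iff)
  note r1 = chart_rep [OF *(1,2) h *(4,6)] and r2 = chart_rep [OF *(2,1) g *(6) gh]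
  have inj: "inj_on \<phi> U" "inj_on \<psi> V" using * chart plane_chart_facts(2) by blast+
  have e1: "(\<psi> \<circ> h \<circ> inv_into U \<phi>) (\<phi> x) = \<psi> (h x)" if "x \<in> W" for x
    using that * inj by auto
  have e2: "(\<phi> \<circ> g \<circ> inv_into V \<psi>) (\<psi> (h x)) = \<phi> x" if "x \<in> W" for x
    using that * inj assms(3) by (auto simp: image_subset_iff subset_iff)
  have "orient_pres_at (\<psi> ` h ` W) (\<phi> \<circ> g \<circ> inv_into V \<psi>) ((\<psi> \<circ> h \<circ> inv_into U \<phi>) (\<phi> p))"
  proof (rule orient_pres_at_inverse [OF r1(2,3,1) _ _ r2(2,3,1)])
    show "orient_pres_at (\<phi> ` W) (\<psi> \<circ> h \<circ> inv_into U \<phi>) (\<phi> p)"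
      by (rule orient_pres_local_chart [OF h *(3) assms(4) *(1,4,2,6)])
  qed (use * e1 e2 in auto)
  then show ?thesis
    unfolding orient_pres_local_def using * g gh e1 by (metis imageI)
qed

lemma orient_pres_local_cong:
  assumes "orient_pres_local X At h p" "openin X N" "p \<in> N" "\<And>x. x \<in> N \<Longrightarrow> h x = k x"
  shows "orient_pres_local X At k p"
proof -
  obtain \<phi> U \<psi> V W where *: "(\<phi>,U) \<in> At" "(\<psi>,V) \<in> At" "p \<in> W" "W \<subseteq> U" "h ` W \<subseteq> V"
    and h: "open_embedding_on X W h"
    using assms unfolding orient_pres_local_def by blast
  have "openin X (W \<inter> N)" using h assms(2) by (auto simp: open_embedding_on_def)
  then have h': "open_embedding_on X (W \<inter> N) h" using h open_embedding_on_subset by blast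
  have "orient_pres_at (\<phi> ` (W \<inter> N)) (\<psi> \<circ> h \<circ> inv_into U \<phi>) (\<phi> p)"
    by (rule orient_pres_local_chart [OF h' _ assms(1) *(1) _ *(2)]) (use * assms in auto)
  moreover have "(\<psi> \<circ> h \<circ> inv_into U \<phi>) z = (\<psi> \<circ> k \<circ> inv_into U \<phi>) z" if "z \<in> \<phi> ` (W \<inter> N)" for z
    using that assms(4) * plane_chart_facts(2) [OF chart [OF *(1)]] by (auto simp: subset_iff)
  ultimately have "orient_pres_at (\<phi> ` (W \<inter> N)) (\<psi> \<circ> k \<circ> inv_into U \<phi>) (\<phi> p)"
    using orient_pres_at_cong [of "\<phi> ` (W \<inter> N)"] by blast
  moreover have "open_embedding_on X (W \<inter> N) k"
    by (rule open_embedding_on_cong [OF h']) (use assms in auto)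
  moreover have "k ` (W \<inter> N) \<subseteq> V"
    using * assms(4) by (force simp: image_subset_iff)
  ultimately show ?thesis
    unfolding orient_pres_local_def using * assms(3) by (metis IntI le_infI1)
qed

lemma orient_pres_local_id:
  assumes "p \<in> topspace X" shows "orient_pres_local X At (\<lambda>x. x) p"
proof -
  obtain \<phi> U where U: "(\<phi>,U) \<in> At" "p \<in> U" "plane_chart X \<phi> U" using assms chart_at by blast
  then have "openin X U" using plane_chart_facts by blast
  moreover have "orient_pres_at (\<phi> ` U) (\<phi> \<circ> inv_into U \<phi>) (\<phi> p)"
    by (rule transition_rep [OF U(1) U(1)]) (use U calculation in auto)
  moreover have "\<phi> \<circ> (\<lambda>x. x) \<circ> inv_into U \<phi> = \<phi> \<circ> inv_into U \<phi>" by auto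
  ultimately show ?thesis
    unfolding orient_pres_local_def using U open_embedding_on_id by (metis image_ident subset_refl)
qed

text \<open>In a chart a ball about the point is a convex domain of injectivity, on which the centre
  of the test circle can be moved freely. This handles points on the gluing circles, where only
  nearby interior points are controlled.\<close>

lemma orient_pres_local_near:
  assumes "open_embedding_on X N h" "p \<in> N"
  obtains M where "openin X M" "p \<in> M" "M \<subseteq> N"
    "\<And>q. q \<in> M \<Longrightarrow> orient_pres_local X At h q \<longleftrightarrow> orient_pres_local X At h p"
proof -
  have "h p \<in> topspace X" by (rule open_embedding_on_in [OF assms(1,2)])
  then obtain \<phi> U \<psi> V W where *: "(\<phi>,U) \<in> At" "(\<psi>,V) \<in> At" "p \<in> W" "W \<subseteq> U" "W \<subseteq> N" "h ` W \<subseteq> V"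
    and h: "open_embedding_on X W h"
    using local_charts [OF assms(1,2) openin_topspace] by metis
  note r = chart_rep [OF *(1,2) h *(4,6)]
  let ?f = "\<psi> \<circ> h \<circ> inv_into U \<phi>"
  obtain e where e: "e > 0" "ball (\<phi> p) e \<subseteq> \<phi> ` W"
    using r(1) * open_contains_ball by blast
  have move: "orient_pres_at (\<phi> ` W) ?f b" if ab: "orient_pres_at (\<phi> ` W) ?f a" "a \<in> ball (\<phi> p) e" "b \<in> ball (\<phi> p) e" for a b
  proof -
    have B: "continuous_on (ball (\<phi> p) e) ?f" "inj_on ?f (ball (\<phi> p) e)"
      using r e continuous_on_subset inj_on_subset by blast+
    have a: "orient_pres_at (ball (\<phi> p) e) ?f a"
      by (rule orient_pres_at_subset [OF r(2,3) ab(1)]) (use ab e in auto)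
    obtain s where s: "s > 0" "cball b s \<subseteq> ball (\<phi> p) e"
      using ab(3) open_contains_cball by (metis open_ball)
    have "homotopic_loops (-{0}) (\<lambda>t. ?f (b + of_real s * cis (2 * pi * t)) - ?f b) (\<lambda>t. cis (2 * pi * t))"
      by (rule orient_pres_at_nearby [OF B convex_ball s(2,1) a]) auto
    then show ?thesis
      unfolding orient_pres_at_def using s e by blast
  qed
  have loc: "orient_pres_local X At h q \<longleftrightarrow> orient_pres_at (\<phi> ` W) ?f (\<phi> q)" if "q \<in> W" for q
    using orient_pres_local_chart [OF h that _ *(1,4,2,6)] that *  h
    unfolding orient_pres_local_def by blast
  let ?M = "{x \<in> U. \<phi> x \<in> ball (\<phi> p) e} \<inter> W"
  have "openin (subtopology X U) {x \<in> topspace (subtopology X U). \<phi> x \<in> ball (\<phi> p) e}"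
    by (rule openin_continuous_map_preimage [OF plane_chart_facts(3) [OF chart [OF *(1)]]]) simp
  moreover have "openin X U" using chart [OF *(1)] plane_chart_facts by blast
  moreover have "topspace (subtopology X U) = U"
    using \<open>openin X U\<close> openin_subset by (metis topspace_subtopology_subset)
  ultimately have "openin X {x \<in> U. \<phi> x \<in> ball (\<phi> p) e}"
    using openin_trans_full by metis
  then have "openin X ?M" using h by (auto simp: open_embedding_on_def)
  moreover have "orient_pres_local X At h q \<longleftrightarrow> orient_pres_local X At h p" if "q \<in> ?M" for q
  proof -
    have q: "q \<in> W" "\<phi> q \<in> ball (\<phi> p) e" using that by auto
    have p: "\<phi> p \<in> ball (\<phi> p) e" using e(1) by simp
    show ?thesis
      unfolding loc [OF q(1)] loc [OF *(3)] using move [OF _ q(2) p] move [OF _ p q(2)] by blast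
  qed
  moreover have "p \<in> ?M" using * e(1) by auto
  moreover have "?M \<subseteq> N" using * by auto
  ultimately show ?thesis using that by (metis (no_types, lifting))
qed

text \<open>For nearby times the same charts and the same circle apply, and injectivity of every
  level keeps the varying image loop off its centre. Connectedness of the time interval does the
  rest.\<close>

lemma orient_pres_local_isotopy:
  assumes H: "continuous_map (prod_topology (top_of_set {0..1::real}) X) X H"
    and inj: "\<And>t. t \<in> {0..1} \<Longrightarrow> inj_on (\<lambda>x. H (t,x)) (topspace X)" and p: "p \<in> topspace X"
    and 0: "orient_pres_local X At (\<lambda>x. H (0,x)) p"
  shows "orient_pres_local X At (\<lambda>x. H (1,x)) p"
proof -
  have emb: "open_embedding_on X (topspace X) (\<lambda>x. H (t,x))" if "t \<in> {0..1}" for t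
    using continuous_map_o_Pair [OF H, of t] inj that by (simp add: open_embedding_on_def o_def)
  have loc: "\<exists>T. openin (top_of_set {0..1}) T \<and> t \<in> T \<and>
      (\<forall>s\<in>T. orient_pres_local X At (\<lambda>x. H (t,x)) p \<longleftrightarrow> orient_pres_local X At (\<lambda>x. H (s,x)) p)"
    if t: "t \<in> {0..1}" for t
  proof -
    have Htp: "H (t,p) \<in> topspace X" using open_embedding_on_in [OF emb [OF t] p] .
    obtain \<psi> V where V: "(\<psi>,V) \<in> At" "H (t,p) \<in> V" "plane_chart X \<psi> V" using Htp chart_at by blast
    obtain \<phi> U where U: "(\<phi>,U) \<in> At" "p \<in> U" "plane_chart X \<phi> U" using p chart_at by blast
    let ?P = "prod_topology (top_of_set {0..1::real}) X"
    have "openin ?P {z \<in> topspace ?P. H z \<in> V}"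
      by (rule openin_continuous_map_preimage [OF H]) (use V plane_chart_facts in blast)
    moreover have "(t,p) \<in> {z \<in> topspace ?P. H z \<in> V}" using t p V by auto
    ultimately obtain T0 W0 where TW: "openin (top_of_set {0..1}) T0" "openin X W0" "t \<in> T0" "p \<in> W0"
      "T0 \<times> W0 \<subseteq> {z \<in> topspace ?P. H z \<in> V}"
      unfolding openin_prod_topology_alt by meson
    obtain d where d: "d > 0" "\<And>s. s \<in> {0..1} \<Longrightarrow> dist s t < d \<Longrightarrow> s \<in> T0"
      using TW(1,3) unfolding openin_euclidean_subtopology_iff by metis
    \<comment> \<open>A convex set of times, so that the affine path between two of them stays
      inside and can serve as homotopy parameter.\<close>
    define T where "T = {0..1} \<inter> ball t d"
    have T: "openin (top_of_set {0..1}) T" "t \<in> T" "T \<subseteq> T0" "convex T" "T \<subseteq> {0..1}"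
      using d t by (auto simp: T_def dist_commute intro: convex_Int)
    define W where "W = U \<inter> W0"
    have W: "openin X W" "p \<in> W" "W \<subseteq> U" "W \<subseteq> topspace X"
      using U TW plane_chart_facts(1) [OF U(3)] openin_subset by (auto simp: W_def)
    have embW: "open_embedding_on X W (\<lambda>x. H (s,x))" if "s \<in> {0..1}" for s
      using emb [OF that] W(1,4) open_embedding_on_subset by blast
    have HV: "(\<lambda>x. H (s,x)) ` W \<subseteq> V" if "s \<in> T" for s
      using that T TW by (auto simp: W_def)
    have injphi: "inj_on \<phi> U" "inj_on \<psi> V" using U V plane_chart_facts by blast+
    have opW: "open (\<phi> ` W)"
      using plane_chart_open_image [OF U(3) W(1,3)] .
    \<comment> \<open>The radius is fixed before time varies: one circle about
      \<open>\<phi> p\<close> tests orientation at all times in \<open>T\<close>.\<close>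
    then obtain r where r: "r > 0" "cball (\<phi> p) r \<subseteq> \<phi> ` W"
      using W open_contains_cball by blast
    define f where "f = (\<lambda>s. \<psi> \<circ> (\<lambda>x. H (s,x)) \<circ> inv_into U \<phi>)"
    have chartdef: "orient_pres_local X At (\<lambda>x. H (s,x)) p \<longleftrightarrow>
        homotopic_loops (-{0}) (\<lambda>\<tau>. f s (\<phi> p + of_real r * cis (2 * pi * \<tau>)) - f s (\<phi> p)) (\<lambda>t. cis (2 * pi * t))"
      (is "?L s = ?R s") if s: "s \<in> T" for s
    proof -
      have s1: "s \<in> {0..1}" using s T by auto
      note rr = chart_rep [OF U(1) V(1) embW [OF s1] W(3) HV [OF s]]
      show ?thesis
      proof
        assume L: "?L s"
        have "orient_pres_at (\<phi> ` W) (f s) (\<phi> p)"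
          unfolding f_def
          by (rule orient_pres_local_chart [OF embW [OF s1] W(2) L U(1) W(3) V(1) HV [OF s]])
        then show "?R s"
          by (rule orient_pres_at_radius [rotated 4]) (use rr r in \<open>auto simp: f_def\<close>)
      next
        assume R: "?R s"
        then have "orient_pres_at (\<phi> ` W) (f s) (\<phi> p)"
          unfolding orient_pres_at_def using r by blast
        then show "?L s" unfolding orient_pres_local_def f_def
          using U V W embW [OF s1] HV [OF s] by blast
      qed
    qed
    have Fcont: "continuous_on (T \<times> \<phi> ` W) (\<lambda>z. f (fst z) (snd z))"
    proof -
      let ?Q = "prod_topology (top_of_set T) (top_of_set (\<phi> ` W))"
      have "continuous_map ?Q (subtopology X W) (\<lambda>z. inv_into U \<phi> (snd z))"
        using continuous_map_compose [OF continuous_map_snd plane_chart_inv_continuous [OF U(3) W(3)], of "top_of_set T"]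
        unfolding o_def .
      then have 1: "continuous_map ?Q X (\<lambda>z. inv_into U \<phi> (snd z))" and im: "\<And>z. z \<in> topspace ?Q \<Longrightarrow> inv_into U \<phi> (snd z) \<in> W"
        by (auto simp: continuous_map_in_subtopology)
      have 2: "continuous_map ?Q (top_of_set {0..1}) fst"
        using continuous_map_fst [of "top_of_set T" "top_of_set (\<phi> ` W)"] T(5)
        by (auto simp: continuous_map_in_subtopology)
      have "continuous_map ?Q (prod_topology (top_of_set {0..1}) X) (\<lambda>z. (fst z, inv_into U \<phi> (snd z)))"
        using 1 2 by (simp add: continuous_map_pairedI)
      then have "continuous_map ?Q X (H \<circ> (\<lambda>z. (fst z, inv_into U \<phi> (snd z))))"
        by (rule continuous_map_compose [OF _ H])
      moreover have "(H \<circ> (\<lambda>z. (fst z, inv_into U \<phi> (snd z)))) z \<in> V" if "z \<in> topspace ?Q" for z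
        using im [OF that] HV [of "fst z"] that by (auto simp: image_subset_iff)
      ultimately have "continuous_map ?Q (subtopology X V) (H \<circ> (\<lambda>z. (fst z, inv_into U \<phi> (snd z))))"
        by (auto simp: continuous_map_in_subtopology)
      then have "continuous_map ?Q euclidean (\<psi> \<circ> (H \<circ> (\<lambda>z. (fst z, inv_into U \<phi> (snd z)))))"
        by (rule continuous_map_compose [OF _ plane_chart_facts(3) [OF V(3)]])
      moreover have "\<psi> \<circ> (H \<circ> (\<lambda>z. (fst z, inv_into U \<phi> (snd z)))) = (\<lambda>z. f (fst z) (snd z))"
        by (auto simp: f_def)
      ultimately show ?thesis by simp
    qed
    have finj: "inj_on (f s) (\<phi> ` W)" if "s \<in> T" for s
      using chart_rep(3) [OF U(1) V(1) embW W(3) HV] that T(5) unfolding f_def by blast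
    have circ: "\<phi> p + of_real r * cis (2 * pi * \<tau>) \<in> \<phi> ` W" for \<tau>
    proof -
      have "\<phi> p + of_real r * cis (2 * pi * \<tau>) \<in> cball (\<phi> p) r"
        using r(1) by (auto simp: dist_norm norm_mult)
      then show ?thesis using r by blast
    qed
    have hom: "homotopic_loops (-{0}) (\<lambda>\<tau>. f t (\<phi> p + of_real r * cis (2 * pi * \<tau>)) - f t (\<phi> p))
       (\<lambda>\<tau>. f s (\<phi> p + of_real r * cis (2 * pi * \<tau>)) - f s (\<phi> p))" if s: "s \<in> T" for s
      unfolding homotopic_loops
    proof (intro exI conjI ballI)
      let ?l = "\<lambda>u. (1 - u) * t + u * s"
      let ?h = "\<lambda>(u,\<tau>). f (?l u) (\<phi> p + of_real r * cis (2 * pi * \<tau>)) - f (?l u) (\<phi> p)"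
      have lT: "?l u \<in> T" if "u \<in> {0..1}" for u
        using T(2,4) s that by (auto simp: convex_alt)
      have "continuous_on ({0..1} \<times> {0..1}) (\<lambda>z. (\<lambda>z. f (fst z) (snd z)) (?l (fst z), \<phi> p + of_real r * cis (2 * pi * snd z))
           - (\<lambda>z. f (fst z) (snd z)) (?l (fst z), \<phi> p))"
        by (intro continuous_intros continuous_on_compose2 [OF Fcont]) (use lT circ W in auto)
      then show "continuous_on ({0..1} \<times> {0..1}) ?h" by (simp add: case_prod_unfold)
      show "?h \<in> {0..1} \<times> {0..1} \<rightarrow> -{0}"
      proof clarsimp
        fix u \<tau> :: real assume u: "0 \<le> u" "u \<le> 1" "0 \<le> \<tau>" "\<tau> \<le> 1"
          and eq: "f (?l u) (\<phi> p + of_real r * cis (2 * pi * \<tau>)) = f (?l u) (\<phi> p)"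
        have "\<phi> p + of_real r * cis (2 * pi * \<tau>) = \<phi> p"
          using inj_onD [OF finj [OF lT [of u]] eq circ] u W by auto
        then show False using r(1) by (simp add: cis_neq_zero)
      qed
    qed (auto simp: pathfinish_def pathstart_def)
    have "orient_pres_local X At (\<lambda>x. H (t,x)) p \<longleftrightarrow> orient_pres_local X At (\<lambda>x. H (s,x)) p" if "s \<in> T" for s
      unfolding chartdef [OF that] chartdef [OF T(2)]
      using hom [OF that] homotopic_loops_trans homotopic_loops_sym by blast
    then show ?thesis using T by blast
  qed
  have "orient_pres_local X At (\<lambda>x. H (0,x)) p \<longleftrightarrow> orient_pres_local X At (\<lambda>x. H (1,x)) p"
    by (rule connected_equivalence_relation [of "{0..1::real}" 0 1
         "\<lambda>s t. orient_pres_local X At (\<lambda>x. H (s,x)) p \<longleftrightarrow> orient_pres_local X At (\<lambda>x. H (t,x)) p"])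
       (use loc in auto)
  with 0 show ?thesis by simp
qed

end

section \<open>Isotopies and mapping class groups\<close>

lemma isotopic_refl:
  assumes "homeomorphic_map (subtopology X S) (subtopology X S) h" "\<And>x. x \<in> B \<Longrightarrow> h x = x"
  shows "isotopic X S B h h"
  unfolding isotopic_def
proof (intro exI conjI ballI)
  show "continuous_map (prod_topology (top_of_set {0..1::real}) (subtopology X S)) (subtopology X S) (h \<circ> snd)"
    by (rule continuous_map_compose [OF continuous_map_snd])
       (use assms homeomorphic_imp_continuous_map in blast)
qed (use assms in auto)

lemma isotopic_sym:
  assumes "isotopic X S B f g" shows "isotopic X S B g f"
proof -
  let ?I = "top_of_set {0..1::real}"
  obtain H where H: "continuous_map (prod_topology ?I (subtopology X S)) (subtopology X S) H"
    "\<And>t. t \<in> {0..1} \<Longrightarrow> homeomorphic_map (subtopology X S) (subtopology X S) (\<lambda>x. H (t, x))"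
    "\<And>x. x \<in> S \<Longrightarrow> H (0, x) = f x \<and> H (1, x) = g x"
    "\<And>t x. t \<in> {0..1} \<Longrightarrow> x \<in> B \<Longrightarrow> H (t, x) = x"
    using assms unfolding isotopic_def by blast
  show ?thesis unfolding isotopic_def
  proof (intro exI conjI ballI)
    have "continuous_map ?I ?I (\<lambda>t. 1 - t)"
      by (auto simp: continuous_map_in_subtopology intro!: continuous_intros)
    then have 1: "continuous_map (prod_topology ?I (subtopology X S)) ?I (\<lambda>p. 1 - fst p)"
      by (rule continuous_map_compose [OF continuous_map_fst, unfolded o_def])
    show "continuous_map (prod_topology ?I (subtopology X S)) (subtopology X S) (H \<circ> (\<lambda>p. (1 - fst p, snd p)))"
      by (intro continuous_map_compose [OF _ H(1)] continuous_map_pairedI 1 continuous_map_snd)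
    fix t :: real assume "t \<in> {0..1}"
    then show "homeomorphic_map (subtopology X S) (subtopology X S) (\<lambda>x. (H \<circ> (\<lambda>p. (1 - fst p, snd p))) (t, x))"
      using H(2) [of "1 - t"] by auto
  qed (use H in auto)
qed

lemma isotopic_compose:
  assumes fg: "isotopic X S B f f'" and k: "isotopic X S B k k'" and S: "S \<subseteq> topspace X"
  shows "isotopic X S B (f \<circ> k) (f' \<circ> k')"
proof -
  let ?I = "top_of_set {0..1::real}"
  obtain H where H: "continuous_map (prod_topology ?I (subtopology X S)) (subtopology X S) H"
    "\<And>t. t \<in> {0..1} \<Longrightarrow> homeomorphic_map (subtopology X S) (subtopology X S) (\<lambda>x. H (t, x))"
    "\<And>x. x \<in> S \<Longrightarrow> H (0, x) = f x \<and> H (1, x) = f' x"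
    "\<And>t x. t \<in> {0..1} \<Longrightarrow> x \<in> B \<Longrightarrow> H (t, x) = x"
    using fg unfolding isotopic_def by blast
  obtain G where G: "continuous_map (prod_topology ?I (subtopology X S)) (subtopology X S) G"
    "\<And>t. t \<in> {0..1} \<Longrightarrow> homeomorphic_map (subtopology X S) (subtopology X S) (\<lambda>x. G (t, x))"
    "\<And>x. x \<in> S \<Longrightarrow> G (0, x) = k x \<and> G (1, x) = k' x"
    "\<And>t x. t \<in> {0..1} \<Longrightarrow> x \<in> B \<Longrightarrow> G (t, x) = x"
    using k unfolding isotopic_def by blast
  let ?F = "H \<circ> (\<lambda>p. (fst p, G p))"
  show ?thesis unfolding isotopic_def
  proof (intro exI conjI ballI)
    show "continuous_map (prod_topology ?I (subtopology X S)) (subtopology X S) ?F"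
      by (intro continuous_map_compose [OF _ H(1)] continuous_map_pairedI continuous_map_fst G(1))
    fix t :: real assume t: "t \<in> {0..1}"
    have "homeomorphic_map (subtopology X S) (subtopology X S) ((\<lambda>x. H (t, x)) \<circ> (\<lambda>x. G (t, x)))"
      by (rule homeomorphic_map_compose [OF G(2) [OF t] H(2) [OF t]])
    then show "homeomorphic_map (subtopology X S) (subtopology X S) (\<lambda>x. ?F (t, x))"
      by (simp add: o_def)
    show "?F (t, x) = x" if "x \<in> B" for x
      using H(4) [OF t that] G(4) [OF t that] by simp
  next
    fix x assume x: "x \<in> S"
    have "G (0, x) \<in> S" "G (1, x) \<in> S"
      using homeomorphic_imp_surjective_map [OF G(2), of 0] homeomorphic_imp_surjective_map [OF G(2), of 1] S x
      by (auto simp: Int_absorb1)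
    then show "?F (0, x) = (f \<circ> k) x" "?F (1, x) = (f' \<circ> k') x"
      using H(3) G(3) x by auto
  qed
qed

lemma isotopic_cong:
  assumes "isotopic X S B f g" "\<And>x. x \<in> S \<Longrightarrow> f x = f' x" "\<And>x. x \<in> S \<Longrightarrow> g x = g' x"
  shows "isotopic X S B f' g'"
proof -
  obtain H where "continuous_map (prod_topology (top_of_set {0..1::real}) (subtopology X S)) (subtopology X S) H"
    "\<forall>t \<in> {0..1}. homeomorphic_map (subtopology X S) (subtopology X S) (\<lambda>x. H (t, x))"
    "\<forall>x \<in> S. H (0, x) = f x \<and> H (1, x) = g x" "\<forall>t \<in> {0..1}. \<forall>x \<in> B. H (t, x) = x"
    using assms(1) unfolding isotopic_def by blast
  then show ?thesis
    unfolding isotopic_def using assms(2,3) by (intro exI [of _ H]) auto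
qed

lemma homeomorphic_map_inverse:
  assumes "homeomorphic_map (subtopology X S) (subtopology X S) h" "S \<subseteq> topspace X"
  obtains g where "homeomorphic_map (subtopology X S) (subtopology X S) g"
    "\<And>x. x \<in> S \<Longrightarrow> g (h x) = x \<and> h (g x) = x \<and> g x \<in> S \<and> h x \<in> S"
proof -
  obtain g where g: "homeomorphic_maps (subtopology X S) (subtopology X S) h g"
    using assms(1) homeomorphic_map_maps by blast
  have top: "topspace (subtopology X S) = S" using assms by auto
  have g1: "homeomorphic_map (subtopology X S) (subtopology X S) g"
    using g homeomorphic_maps_map by blast
  from homeomorphic_imp_surjective_map [OF this] homeomorphic_imp_surjective_map [OF assms(1)]
  have "g ` S = S" "h ` S = S" by (simp_all only: top)
  then have "g (h x) = x \<and> h (g x) = x \<and> g x \<in> S \<and> h x \<in> S" if "x \<in> S" for x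
    using g that unfolding homeomorphic_maps_def top by auto
  with g1 show ?thesis by (rule that)
qed

text \<open>Composing the isotopy from f to g with the one from g to k through the inverse of g avoids
  concatenating them in time.\<close>
lemma isotopic_trans:
  assumes "isotopic X S B f g" "isotopic X S B g k" "S \<subseteq> topspace X" "B \<subseteq> S"
    and g: "homeomorphic_map (subtopology X S) (subtopology X S) g" "\<And>x. x \<in> B \<Longrightarrow> g x = x"
  shows "isotopic X S B f k"
proof -
  obtain g' where g': "homeomorphic_map (subtopology X S) (subtopology X S) g'"
    "\<And>x. x \<in> S \<Longrightarrow> g' (g x) = x \<and> g (g' x) = x \<and> g' x \<in> S \<and> g x \<in> S"
    using homeomorphic_map_inverse [OF g(1) assms(3)] by blast
  have "g' x = x" if "x \<in> B" for x using g'(2) g(2) that assms(4) by (metis subsetD)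
  then have "isotopic X S B g' g'" by (intro isotopic_refl g')
  then have "isotopic X S B (f \<circ> (g' \<circ> g)) (g \<circ> (g' \<circ> k))"
    by (intro isotopic_compose assms)
  then show ?thesis
  proof (rule isotopic_cong)
    have k: "k x \<in> S" if "x \<in> S" for x
    proof -
      obtain H where H: "homeomorphic_map (subtopology X S) (subtopology X S) (\<lambda>x. H (1::real, x))"
        "\<And>x. x \<in> S \<Longrightarrow> H (1, x) = k x"
        using assms(2) unfolding isotopic_def by fastforce
      then show ?thesis
        using homeomorphic_imp_surjective_map [OF H(1)] that assms(3) by (auto simp: Int_absorb1)
    qed
    show "(g \<circ> (g' \<circ> k)) x = k x" if "x \<in> S" for x using g' k [OF that] by simp
  qed (use g' in simp)
qed

section \<open>The group of isotopy classes\<close>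

context oriented_surface
begin

lemma homeos_iff:
  assumes "S \<subseteq> topspace X"
  shows "h \<in> homeos X At S B \<longleftrightarrow> homeomorphic_map (subtopology X S) (subtopology X S) h \<and>
    (\<forall>x\<in>B. h x = x) \<and> (\<forall>p \<in> X interior_of S. orient_pres_local X At h p)"
proof (cases "homeomorphic_map (subtopology X S) (subtopology X S) h")
  case True
  then show ?thesis
    using orient_pres_iff_local [OF homeomorphic_map_open_embedding(1) [OF True assms]]
    by (simp add: homeos_def)
qed (simp add: homeos_def)

lemma homeosD:
  assumes "h \<in> homeos X At S B"
  shows "homeomorphic_map (subtopology X S) (subtopology X S) h" "\<And>x. x \<in> B \<Longrightarrow> h x = x"
  using assms by (auto simp: homeos_def)

lemma homeos_image:
  assumes "h \<in> homeos X At S B" "S \<subseteq> topspace X"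
  shows "h ` S = S"
  using homeomorphic_imp_surjective_map [OF homeosD(1) [OF assms(1)]] assms(2) by (simp add: Int_absorb1)

lemma homeos_inj:
  assumes "h \<in> homeos X At S B" "S \<subseteq> topspace X"
  shows "inj_on h S"
  using homeomorphic_imp_injective_map [OF homeosD(1) [OF assms(1)]] assms(2) by (simp add: Int_absorb1)

lemma homeos_compose:
  assumes f: "f \<in> homeos X At S B" and g: "g \<in> homeos X At S B" and S: "S \<subseteq> topspace X"
  shows "g \<circ> f \<in> homeos X At S B"
  unfolding homeos_iff [OF S]
proof (intro conjI ballI)
  show "homeomorphic_map (subtopology X S) (subtopology X S) (g \<circ> f)"
    by (rule homeomorphic_map_compose [OF homeosD(1) [OF f] homeosD(1) [OF g]])
  show "(g \<circ> f) x = x" if "x \<in> B" for x using homeosD(2) [OF f that] homeosD(2) [OF g that] by simp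
  fix p assume p: "p \<in> X interior_of S"
  note ef = homeomorphic_map_open_embedding [OF homeosD(1) [OF f] S]
  note eg = homeomorphic_map_open_embedding [OF homeosD(1) [OF g] S]
  have fp: "f p \<in> X interior_of S" using ef(2) p by blast
  show "orient_pres_local X At (g \<circ> f) p"
    by (rule orient_pres_local_compose [OF ef(1) p eg(1) fp])
       (use f g p fp homeos_iff [OF S] in auto)
qed

lemma homeos_id: "S \<subseteq> topspace X \<Longrightarrow> id \<in> homeos X At S B"
  using orient_pres_local_id interior_of_subset_topspace [of X S] homeomorphic_map_id [of "subtopology X S"]
  by (auto simp: homeos_iff id_def subset_iff)

lemma homeos_inverse:
  assumes f: "f \<in> homeos X At S B" and S: "S \<subseteq> topspace X" and B: "B \<subseteq> S"
  obtains g where "g \<in> homeos X At S B" "\<And>x. x \<in> S \<Longrightarrow> g (f x) = x \<and> f (g x) = x \<and> g x \<in> S \<and> f x \<in> S"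
proof -
  obtain g where g: "homeomorphic_map (subtopology X S) (subtopology X S) g"
    "\<And>x. x \<in> S \<Longrightarrow> g (f x) = x \<and> f (g x) = x \<and> g x \<in> S \<and> f x \<in> S"
    using homeomorphic_map_inverse [OF homeosD(1) [OF f] S] by blast
  note ef = homeomorphic_map_open_embedding [OF homeosD(1) [OF f] S]
  note eg = homeomorphic_map_open_embedding [OF g(1) S]
  have "g \<in> homeos X At S B"
    unfolding homeos_iff [OF S]
  proof (intro conjI ballI g(1))
    show "g x = x" if "x \<in> B" for x using g(2) homeosD(2) [OF f that] that B by (metis subsetD)
    fix p assume p: "p \<in> X interior_of S"
    have gp: "g p \<in> X interior_of S" using eg(2) p by blast
    have pS: "p \<in> S" using p interior_of_subset by fast
    have "orient_pres_local X At g (f (g p))"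
    proof (rule orient_pres_local_inverse [OF ef(1) gp])
      show "g (f x) = x" if "x \<in> X interior_of S" for x
        using g(2) that interior_of_subset by fast
      show "orient_pres_local X At f (g p)" using f gp homeos_iff [OF S] by blast
    qed
    then show "orient_pres_local X At g p" using g(2) [OF pS] by simp
  qed
  with g(2) show ?thesis using that by blast
qed

text \<open>Supplies the orientation condition for pushed and twisted maps: they are isotopic to the
  identity and inherit it along the isotopy.\<close>

lemma homeos_isotopic:
  assumes "isotopic X (topspace X) {} f g" "f \<in> homeos X At (topspace X) {}"
  shows "g \<in> homeos X At (topspace X) {}"
proof -
  obtain H where H: "continuous_map (prod_topology (top_of_set {0..1::real}) X) X H"
    "\<And>t. t \<in> {0..1} \<Longrightarrow> homeomorphic_map X X (\<lambda>x. H (t, x))"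
    "\<And>x. x \<in> topspace X \<Longrightarrow> H (0, x) = f x \<and> H (1, x) = g x"
    using assms unfolding isotopic_def by auto
  have hom: "homeomorphic_map X X g"
    using H(2) [of 1] H(3) homeomorphic_map_eq by fastforce
  have "orient_pres_local X At g p" if p: "p \<in> topspace X" for p
  proof -
    have "orient_pres_local X At f p"
      using assms(2) p by (simp add: homeos_iff interior_of_topspace)
    then have 0: "orient_pres_local X At (\<lambda>x. H (0, x)) p"
      by (rule orient_pres_local_cong [OF _ openin_topspace p]) (use H in auto)
    have "orient_pres_local X At (\<lambda>x. H (1, x)) p"
      by (rule orient_pres_local_isotopy [OF H(1) homeomorphic_imp_injective_map [OF H(2)] p 0])
    then show ?thesis
      by (rule orient_pres_local_cong [OF _ openin_topspace p]) (use H in auto)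
  qed
  then show ?thesis using hom by (simp add: homeos_iff interior_of_topspace)
qed

lemma iso_class_eq_iff:
  assumes f: "f \<in> homeos X At S B" and g: "g \<in> homeos X At S B" and S: "S \<subseteq> topspace X" "B \<subseteq> S"
  shows "iso_class X At S B f = iso_class X At S B g \<longleftrightarrow> isotopic X S B f g"
proof
  assume "iso_class X At S B f = iso_class X At S B g"
  moreover have "f \<in> iso_class X At S B f"
    using f isotopic_refl [OF homeosD [OF f]] by (simp add: iso_class_def)
  ultimately show "isotopic X S B f g" by (simp add: iso_class_def)
next
  assume fg: "isotopic X S B f g"
  have "isotopic X S B h f \<longleftrightarrow> isotopic X S B h g" for h
    using isotopic_trans [OF _ fg S] isotopic_trans [OF _ isotopic_sym [OF fg] S] homeosD [OF f] homeosD [OF g]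
    by blast
  then show "iso_class X At S B f = iso_class X At S B g"
    by (simp add: iso_class_def)
qed

lemma iso_class_self: "f \<in> homeos X At S B \<Longrightarrow> f \<in> iso_class X At S B f"
  using isotopic_refl [OF homeosD] by (simp add: iso_class_def)

lemma iso_class_member:
  assumes "A \<in> carrier (MCG X At S B)" "f \<in> A" "S \<subseteq> topspace X" "B \<subseteq> S"
  shows "f \<in> homeos X At S B" "A = iso_class X At S B f"
proof -
  obtain g where g: "g \<in> homeos X At S B" "A = iso_class X At S B g"
    using assms(1) by (auto simp: MCG_def)
  show "f \<in> homeos X At S B" using assms(2) g by (simp add: iso_class_def)
  then show "A = iso_class X At S B f"
    using iso_class_eq_iff [OF _ g(1) assms(3,4)] assms(2) g by (auto simp: iso_class_def)
qed

lemma iso_class_carrier: "f \<in> homeos X At S B \<Longrightarrow> iso_class X At S B f \<in> carrier (MCG X At S B)"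
  by (simp add: MCG_def)

text \<open>The product in \<open>MCG\<close> ranges over all pairs of representatives; since
  isotopies compose level by level, the resulting set is a single class.\<close>

lemma iso_class_mult:
  assumes f: "f \<in> homeos X At S B" and g: "g \<in> homeos X At S B" and S: "S \<subseteq> topspace X" "B \<subseteq> S"
  shows "iso_class X At S B f \<otimes>\<^bsub>MCG X At S B\<^esub> iso_class X At S B g = iso_class X At S B (f \<circ> g)"
proof -
  have fg: "f \<circ> g \<in> homeos X At S B" using homeos_compose f g S by blast
  have "isotopic X S B h (f \<circ> g)" if f': "f' \<in> homeos X At S B" "isotopic X S B f' f"
    and g': "g' \<in> homeos X At S B" "isotopic X S B g' g" and h: "isotopic X S B h (f' \<circ> g')" for f' g' h
    using isotopic_trans [OF h isotopic_compose [OF f'(2) g'(2) S(1)] S]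
      homeosD [OF homeos_compose [OF g'(1) f'(1) S(1)]] by blast
  moreover have "f \<in> iso_class X At S B f" "g \<in> iso_class X At S B g"
    using iso_class_self f g by blast+
  ultimately show ?thesis
    unfolding MCG_def iso_class_def by auto
qed

lemma MCG_group:
  assumes S: "S \<subseteq> topspace X" "B \<subseteq> S"
  shows "group (MCG X At S B)"
proof (rule groupI)
  let ?G = "MCG X At S B"
  have car: "\<exists>f. f \<in> homeos X At S B \<and> A = iso_class X At S B f" if "A \<in> carrier ?G" for A
    using that by (auto simp: MCG_def)
  have one: "\<one>\<^bsub>?G\<^esub> = iso_class X At S B id" by (simp add: MCG_def)
  show "A \<otimes>\<^bsub>?G\<^esub> C \<in> carrier ?G" if "A \<in> carrier ?G" "C \<in> carrier ?G" for A C
    using car [OF that(1)] car [OF that(2)] iso_class_mult [OF _ _ S] homeos_compose [OF _ _ S(1)] iso_class_carrier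
    by metis
  show "\<one>\<^bsub>?G\<^esub> \<in> carrier ?G" using one iso_class_carrier homeos_id S by metis
  show "A \<otimes>\<^bsub>?G\<^esub> C \<otimes>\<^bsub>?G\<^esub> D = A \<otimes>\<^bsub>?G\<^esub> (C \<otimes>\<^bsub>?G\<^esub> D)"
    if acd: "A \<in> carrier ?G" "C \<in> carrier ?G" "D \<in> carrier ?G" for A C D
  proof -
    obtain f g h where *: "f \<in> homeos X At S B" "A = iso_class X At S B f" "g \<in> homeos X At S B" "C = iso_class X At S B g"
      "h \<in> homeos X At S B" "D = iso_class X At S B h"
      using car acd by meson
    then show ?thesis
      by (simp add: iso_class_mult [OF _ _ S] homeos_compose [OF _ _ S(1)] o_assoc)
  qed
  fix A assume "A \<in> carrier ?G"
  then obtain f where f: "f \<in> homeos X At S B" "A = iso_class X At S B f" using car by blast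
  show "\<one>\<^bsub>?G\<^esub> \<otimes>\<^bsub>?G\<^esub> A = A"
    using iso_class_mult [OF homeos_id [OF S(1)] f(1) S] one f by simp
  obtain g where g: "g \<in> homeos X At S B" "\<And>x. x \<in> S \<Longrightarrow> g (f x) = x \<and> f (g x) = x \<and> g x \<in> S \<and> f x \<in> S"
    using homeos_inverse [OF f(1) S] by blast
  have gf: "g \<circ> f \<in> homeos X At S B" using homeos_compose f g S by blast
  have "isotopic X S B (g \<circ> f) id"
    by (rule isotopic_cong [OF isotopic_refl [OF homeosD [OF gf]]]) (use g in auto)
  then have "iso_class X At S B g \<otimes>\<^bsub>?G\<^esub> A = \<one>\<^bsub>?G\<^esub>"
    using iso_class_mult [OF g(1) f(1) S] f(2) one iso_class_eq_iff [OF gf homeos_id S] S by simp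
  then show "\<exists>C\<in>carrier ?G. C \<otimes>\<^bsub>?G\<^esub> A = \<one>\<^bsub>?G\<^esub>"
    using iso_class_carrier g(1) by blast
qed

end

section \<open>Invariance of domain and compactly supported isotopies\<close>

text \<open>The planar self-map \<open>g\<close> carried to the surface by the embedding
  \<open>b\<close>. If \<open>g\<close> is the identity off a compact part of \<open>D\<close>, the
  two branches match near the edge of the image; all planar models below are made with such a
  support.\<close>

definition transplant :: "complex set \<Rightarrow> (complex \<Rightarrow> 'a) \<Rightarrow> (complex \<Rightarrow> complex) \<Rightarrow> 'a \<Rightarrow> 'a" where
  "transplant D b g x = (if x \<in> b ` D then b (g (inv_into D b x)) else x)"

lemma transplant_image: "inj_on b D \<Longrightarrow> w \<in> D \<Longrightarrow> transplant D b g (b w) = b (g w)"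
  by (simp add: transplant_def)

lemma transplant_outside:
  assumes "inj_on b D" "\<And>w. w \<in> D - C \<Longrightarrow> g w = w" "x \<notin> b ` C"
  shows "transplant D b g x = x"
proof (cases "x \<in> b ` D")
  case True
  then obtain w where "w \<in> D" "x = b w" by blast
  then show ?thesis using assms transplant_image by fastforce
qed (simp add: transplant_def)

lemma half_chart_facts:
  assumes "half_chart X \<phi> U"
  shows "openin X U" "inj_on \<phi> U" "continuous_map (subtopology X U) euclidean \<phi>"
    "continuous_map (top_of_set (\<phi> ` U)) (subtopology X U) (inv_into U \<phi>)"
    "\<And>V. openin X V \<Longrightarrow> V \<subseteq> U \<Longrightarrow> openin (top_of_set upper_half_plane) (\<phi> ` V)"
proof -
  note a = assms[unfolded half_chart_def]
  show "openin X U" "inj_on \<phi> U" "continuous_map (subtopology X U) euclidean \<phi>"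
    "continuous_map (top_of_set (\<phi> ` U)) (subtopology X U) (inv_into U \<phi>)"
    using a chart_map_facts [of X U \<phi>] by auto
  fix V assume V: "openin X V" "V \<subseteq> U"
  have "open_map (subtopology X U) (top_of_set (\<phi> ` U)) \<phi>"
    using a homeomorphic_imp_open_map by blast
  moreover have "openin (subtopology X U) V"
    using V a by (simp add: openin_open_subtopology)
  ultimately have "openin (top_of_set (\<phi> ` U)) (\<phi> ` V)"
    by (simp add: open_map_def)
  moreover have "openin (top_of_set upper_half_plane) (\<phi> ` U)" using a by blast
  ultimately show "openin (top_of_set upper_half_plane) (\<phi> ` V)"
    by (rule openin_trans)
qed

section \<open>Moves with compact support, and manifold interior versus topological interior\<close>

context oriented_surface
begin

text \<open>Surjectivity is the issue. The image is open by invariance of domain, and closed as the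
  union of a compact image with a closed set that is fixed pointwise; in a connected surface it is
  everything.\<close>

lemma homeomorphic_map_compact_support:
  assumes cont: "continuous_map X X \<beta>" and inj: "inj_on \<beta> (topspace X)"
    and C: "compactin X C" and supp: "\<And>x. x \<in> topspace X - C \<Longrightarrow> \<beta> x = x"
  shows "homeomorphic_map X X \<beta>"
proof (cases "topspace X = {}")
  case True
  show ?thesis
    by (rule homeomorphic_map_eq [of X X id]) (use True in auto)
next
  case False
  have emb: "open_embedding_on X N \<beta>" if "openin X N" for N
    using that cont inj openin_subset [OF that] continuous_map_from_subtopology inj_on_subset
    unfolding open_embedding_on_def by blast
  let ?E = "\<beta> ` topspace X" and ?T = "X closure_of (topspace X - C)"
  have sub: "?E \<subseteq> topspace X" using cont continuous_map_image_subset_topspace by blast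
  \<comment> \<open>Being fixed passes from the complement of \<open>C\<close> to its closure,
    because the set where two continuous maps into a Hausdorff space agree is closed.\<close>
  have fixT: "\<beta> x = x" if "x \<in> ?T" for x
    using forall_in_closure_of_eq [OF that Hausdorff cont continuous_map_id] supp by auto
  have "?E = \<beta> ` C \<union> ?T"
  proof
    have "\<beta> ` C \<subseteq> ?E" using compactin_subset_topspace [OF C] by blast
    moreover have "?T \<subseteq> ?E"
    proof
      fix x assume x: "x \<in> ?T"
      then have "x \<in> topspace X" by (simp add: in_closure_of)
      then show "x \<in> ?E" using fixT [OF x] by (metis imageI)
    qed
    ultimately show "\<beta> ` C \<union> ?T \<subseteq> ?E" by blast
    show "?E \<subseteq> \<beta> ` C \<union> ?T"
    proof clarify
      fix x assume x: "x \<in> topspace X" "\<beta> x \<notin> ?T"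
      have "x \<in> C"
      proof (rule ccontr)
        assume "x \<notin> C"
        then have "x \<in> ?T" "\<beta> x = x"
          using supp x closure_of_subset [of "topspace X - C" X] by auto
        then show False using x by simp
      qed
      then show "\<beta> x \<in> \<beta> ` C" by blast
    qed
  qed
  moreover have "closedin X (\<beta> ` C)"
    using C cont Hausdorff image_compactin compactin_imp_closedin by blast
  ultimately have "closedin X ?E" by (simp add: closedin_Un)
  moreover have "openin X ?E" using emb open_embedding_on_image by blast
  ultimately have "?E = topspace X"
    using connected False by (auto simp: connected_space_clopen_in)
  moreover have "open_map X X \<beta>"
    unfolding open_map_def using emb open_embedding_on_image by blast
  ultimately show ?thesis
    using bijective_open_imp_homeomorphic_map cont inj by blast
qed

lemma embedding_inverse_continuous:
  fixes b :: "complex \<Rightarrow> 'a"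
  assumes D: "open D" and b: "continuous_map (top_of_set D) X b" "inj_on b D"
  shows "continuous_map (subtopology X (b ` D)) (top_of_set D) (inv_into D b)"
proof -
  have op: "openin X (b ` V)" if "open V" "V \<subseteq> D" for V
    using openin_planar_image [OF that(1)] that b by (meson continuous_map_from_subtopology_mono inj_on_subset)
  have top: "topspace (subtopology X (b ` D)) = b ` D"
    using op [OF D] openin_subset by (metis order_refl topspace_subtopology_subset)
  show ?thesis
    unfolding continuous_map_def top
  proof (intro conjI allI impI)
    show "inv_into D b \<in> b ` D \<rightarrow> topspace (top_of_set D)" by (auto simp: b(2))
    fix V assume "openin (top_of_set D) V"
    then have V: "open V" "V \<subseteq> D" using D by (auto simp: openin_open_eq)
    have "{x \<in> b ` D. inv_into D b x \<in> V} = b ` V" using b(2) V by auto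
    moreover have "openin (subtopology X (b ` D)) (b ` V)"
      using op [OF V] op [OF D] V by (simp add: openin_open_subtopology image_mono)
    ultimately show "openin (subtopology X (b ` D)) {x \<in> b ` D. inv_into D b x \<in> V}" by simp
  qed
qed

text \<open>Continuity in time and space is pasted over two open sets: the embedded domain, and the
  complement of the embedded support, which is closed because the surface is Hausdorff. Each level
  is then onto by \<open>homeomorphic_map_compact_support\<close>, so the planar models only have to
  be injective self-maps of \<open>D\<close>.\<close>

lemma transplant_isotopy:
  fixes \<gamma> :: "real \<Rightarrow> complex \<Rightarrow> complex" and b :: "complex \<Rightarrow> 'a"
  assumes D: "open D" and b: "continuous_map (top_of_set D) X b" "inj_on b D"
    and \<gamma>: "continuous_on ({0..1} \<times> D) (\<lambda>p. \<gamma> (fst p) (snd p))"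
    and \<gamma>D: "\<And>u w. u \<in> {0..1} \<Longrightarrow> w \<in> D \<Longrightarrow> \<gamma> u w \<in> D"
    and \<gamma>inj: "\<And>u. u \<in> {0..1} \<Longrightarrow> inj_on (\<gamma> u) D"
    and C: "compact C" "C \<subseteq> D" and supp: "\<And>u w. u \<in> {0..1} \<Longrightarrow> w \<in> D - C \<Longrightarrow> \<gamma> u w = w"
  shows "continuous_map (prod_topology (top_of_set {0..1}) X) X (\<lambda>p. transplant D b (\<gamma> (fst p)) (snd p))"
    and "\<And>u. u \<in> {0..1} \<Longrightarrow> homeomorphic_map X X (transplant D b (\<gamma> u))"
    and "isotopic X (topspace X) {} (transplant D b (\<gamma> 0)) (transplant D b (\<gamma> 1))"
proof -
  let ?I = "top_of_set {0..1::real}"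
  let ?H = "\<lambda>p. transplant D b (\<gamma> (fst p)) (snd p)"
  have bD: "openin X (b ` D)" using openin_planar_image D b by blast
  have bDs: "b ` D \<subseteq> topspace X" using bD openin_subset by blast
  have bC: "compactin X (b ` C)"
    using image_compactin [OF _ b(1)] C by (simp add: compactin_subtopology)
  then have clo: "closedin X (b ` C)" using Hausdorff compactin_imp_closedin by blast
  have out: "transplant D b (\<gamma> u) x = x" if "u \<in> {0..1}" "x \<notin> b ` C" for u x
    by (rule transplant_outside [OF b(2) supp]) (use that in auto)
  show cont: "continuous_map (prod_topology ?I X) X ?H"
  proof (rule pasting_lemma [where I = UNIV])
    let ?T = "\<lambda>i. {0..1} \<times> (if i then b ` D else topspace X - b ` C)"
    let ?f = "\<lambda>i p. if i then b (\<gamma> (fst p) (inv_into D b (snd p))) else snd p"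
    show "openin (prod_topology ?I X) (?T i)" for i
      using bD clo by (cases i) (auto simp: openin_prod_Times_iff)
    show "continuous_map (subtopology (prod_topology ?I X) (?T i)) X (?f i)" for i
    proof (cases i)
      case True
      let ?S = "prod_topology ?I (subtopology X (b ` D))"
      have S: "subtopology (prod_topology ?I X) (?T i) = ?S"
        using True by (simp add: subtopology_Times subtopology_subtopology)
      have 1: "continuous_map ?S (top_of_set D) (\<lambda>p. inv_into D b (snd p))"
        using continuous_map_compose [OF continuous_map_snd embedding_inverse_continuous [OF D b]]
        unfolding o_def .
      have "continuous_map ?S (prod_topology ?I (top_of_set D)) (\<lambda>p. (fst p, inv_into D b (snd p)))"
        by (intro continuous_map_pairedI continuous_map_fst 1)
      moreover have "continuous_map (prod_topology ?I (top_of_set D)) (top_of_set D) (\<lambda>p. \<gamma> (fst p) (snd p))"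
        using \<gamma> \<gamma>D by (auto simp: continuous_map_in_subtopology)
      ultimately have "continuous_map ?S (top_of_set D) ((\<lambda>p. \<gamma> (fst p) (snd p)) \<circ> (\<lambda>p. (fst p, inv_into D b (snd p))))"
        by (rule continuous_map_compose)
      from continuous_map_compose [OF this b(1)] show ?thesis
        unfolding S using True by (simp add: o_def)
    next
      case False
      then show ?thesis by (simp add: continuous_map_from_subtopology continuous_map_snd)
    qed
    fix i j :: bool and x
    assume x: "x \<in> topspace (prod_topology ?I X) \<inter> ?T i \<inter> ?T j"
    have "b (\<gamma> (fst x) (inv_into D b (snd x))) = snd x" if "snd x \<in> b ` D" "snd x \<notin> b ` C" "fst x \<in> {0..1}"
    proof -
      from that(1) obtain w where w: "w \<in> D" "snd x = b w" by blast
      then have "\<gamma> (fst x) w = w" using that by (intro supp) auto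
      then show ?thesis using w b(2) by simp
    qed
    then show "?f i x = ?f j x" using x by (cases i; cases j) auto
  next
    fix x assume x: "x \<in> topspace (prod_topology ?I X)"
    let ?T = "\<lambda>i. {0..1} \<times> (if i then b ` D else topspace X - b ` C)"
    let ?f = "\<lambda>i p. if i then b (\<gamma> (fst p) (inv_into D b (snd p))) else snd p"
    show "\<exists>j. j \<in> UNIV \<and> x \<in> ?T j \<and> ?H x = ?f j x"
    proof (cases "snd x \<in> b ` D")
      case True
      then show ?thesis using x by (intro exI [of _ True]) (auto simp: transplant_def)
    next
      case False
      then show ?thesis using x C by (intro exI [of _ False]) (auto simp: transplant_def)
    qed
  qed
  show hom: "homeomorphic_map X X (transplant D b (\<gamma> u))" if u: "u \<in> {0..1}" for u
  proof (rule homeomorphic_map_compact_support [OF _ _ bC])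
    show "continuous_map X X (transplant D b (\<gamma> u))"
      using continuous_map_o_Pair [OF cont, of u] u by (simp add: o_def)
    show "transplant D b (\<gamma> u) x = x" if "x \<in> topspace X - b ` C" for x using out u that by blast
    have in_b: "transplant D b (\<gamma> u) x \<in> b ` D \<longleftrightarrow> x \<in> b ` D" for x
      using \<gamma>D [OF u] by (auto simp: transplant_def b(2))
    show "inj_on (transplant D b (\<gamma> u)) (topspace X)"
    proof (rule inj_onI)
      fix x y assume eq: "transplant D b (\<gamma> u) x = transplant D b (\<gamma> u) y"
      show "x = y"
      proof (cases "x \<in> b ` D")
        case True
        then have "y \<in> b ` D" using eq in_b by metis
        with True obtain v w where vw: "v \<in> D" "w \<in> D" "x = b v" "y = b w" by blast
        then have "b (\<gamma> u v) = b (\<gamma> u w)" using eq by (simp add: transplant_image b(2))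
        then have "\<gamma> u v = \<gamma> u w" using \<gamma>D [OF u] vw b(2) by (auto dest: inj_onD)
        then show ?thesis using \<gamma>inj [OF u] vw by (auto dest: inj_onD)
      next
        case False
        then have "y \<notin> b ` D" using eq in_b by metis
        with False show ?thesis using eq by (simp add: transplant_def)
      qed
    qed
  qed
  show "isotopic X (topspace X) {} (transplant D b (\<gamma> 0)) (transplant D b (\<gamma> 1))"
    unfolding isotopic_def using cont hom by (intro exI [of _ ?H]) auto
qed

text \<open>By invariance of domain the domain of a plane chart of the subspace is already open in
  \<open>X\<close>. So the boundary defined by charts becomes a set difference with the topological
  interior.\<close>

lemma mint_subtopology:
  assumes S: "S \<subseteq> topspace X"
  shows "mint (subtopology X S) = X interior_of S"
proof
  show "mint (subtopology X S) \<subseteq> X interior_of S"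
  proof
    fix p assume "p \<in> mint (subtopology X S)"
    then obtain \<phi> U where p: "p \<in> U" and U: "plane_chart (subtopology X S) \<phi> U"
      by (auto simp: mint_def)
    have US: "U \<subseteq> S" using plane_chart_facts(1) [OF U] openin_subset by fastforce
    have "continuous_map (top_of_set (\<phi> ` U)) X (inv_into U \<phi>)"
      using plane_chart_facts(4) [OF U] continuous_map_into_fulltopology by blast
    moreover have "open (\<phi> ` U)" using U by (simp add: plane_chart_def)
    ultimately have "openin X (inv_into U \<phi> ` \<phi> ` U)"
      by (intro openin_planar_image) (auto simp: inj_on_inv_into)
    moreover have "inv_into U \<phi> ` \<phi> ` U = U"
      using plane_chart_facts(2) [OF U] by (simp add: inv_into_image_cancel)
    ultimately show "p \<in> X interior_of S"
      using p US by (auto simp: interior_of_def)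
  qed
  show "X interior_of S \<subseteq> mint (subtopology X S)"
  proof
    fix p assume p: "p \<in> X interior_of S"
    then have pX: "p \<in> topspace X" "p \<in> S" using interior_of_subset S by fast+
    then obtain \<phi> U where U: "(\<phi>,U) \<in> At" "p \<in> U" "plane_chart X \<phi> U" using chart_at by blast
    let ?W = "U \<inter> X interior_of S"
    have W: "openin X ?W" using plane_chart_facts(1) [OF U(3)] by (intro openin_Int) auto
    have WS: "?W \<subseteq> S" using interior_of_subset by fast
    have top: "topspace (subtopology X ?W) = ?W" using W openin_subset by (metis topspace_subtopology_subset)
    have inj: "inj_on \<phi> U" using plane_chart_facts(2) [OF U(3)] .
    have "homeomorphic_maps (subtopology X ?W) (top_of_set (\<phi> ` ?W)) \<phi> (inv_into U \<phi>)"
      unfolding homeomorphic_maps_def top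
      using plane_chart_inv_continuous [OF U(3), of ?W] inj
        continuous_map_from_subtopology_mono [OF plane_chart_facts(3) [OF U(3)], of ?W]
      by (auto simp: continuous_map_in_subtopology top)
    then have "homeomorphic_map (subtopology X ?W) (top_of_set (\<phi> ` ?W)) \<phi>"
      using homeomorphic_maps_map by blast
    moreover have "subtopology (subtopology X S) ?W = subtopology X ?W"
      using WS by (simp add: subtopology_subtopology Int_absorb1)
    moreover have "openin (subtopology X S) ?W"
      using W WS by (metis inf.absorb1 openin_subtopology_Int2 inf_commute openin_subtopology)
    moreover have "open (\<phi> ` ?W)" using plane_chart_open_image [OF U(3) W] by simp
    ultimately have "plane_chart (subtopology X S) \<phi> ?W"
      by (simp add: plane_chart_def)
    then show "p \<in> mint (subtopology X S)"
      using pX p U S unfolding mint_def by (auto intro!: exI [of _ \<phi>] exI [of _ ?W])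
  qed
qed

lemma mbdry_subtopology:
  "S \<subseteq> topspace X \<Longrightarrow> mbdry (subtopology X S) = S - X interior_of S"
  by (simp add: mbdry_def mint_subtopology Int_absorb1)

text \<open>Strictly above the real axis a half chart is inverse to a planar embedding, whose image
  is open in the whole surface.\<close>

lemma half_chart_upper:
  assumes S: "S \<subseteq> topspace X" and U: "half_chart (subtopology X S) \<phi> U" and x: "x \<in> U" "Im (\<phi> x) > 0"
  shows "x \<in> X interior_of S"
proof -
  let ?D = "\<phi> ` U \<inter> {z. Im z > 0}"
  note f = half_chart_facts [OF U]
  have US: "U \<subseteq> S" using f(1) openin_subset by fastforce
  obtain O' where O': "open O'" "\<phi> ` U = upper_half_plane \<inter> O'"
    using U by (auto simp: half_chart_def openin_open)
  then have "?D = O' \<inter> {z. Im z > 0}" by (auto simp: upper_half_plane_def)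
  then have D: "open ?D" using O' by (simp add: open_Int open_halfspace_Im_gt)
  have "continuous_map (top_of_set ?D) X (inv_into U \<phi>)"
    by (rule continuous_map_from_subtopology_mono [OF continuous_map_into_fulltopology [OF continuous_map_into_fulltopology [OF f(4)]]]) auto
  then have op: "openin X (inv_into U \<phi> ` ?D)"
    by (rule openin_planar_image [OF D]) (auto intro: inj_on_subset [OF inj_on_inv_into])
  have "inv_into U \<phi> ` ?D \<subseteq> S" using f(2) US by auto
  moreover have "x \<in> inv_into U \<phi> ` ?D" using x f(2) by (force simp: image_iff)
  ultimately show ?thesis using op by (auto simp: interior_of_def)
qed

text \<open>From any point one can rise vertically in a half chart by an arbitrarily small amount
  and so enter the open upper half plane.\<close>

lemma surface_wb_dense:
  assumes S: "S \<subseteq> topspace X" and wb: "surface_wb (subtopology X S)"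
  shows "S \<subseteq> X closure_of (X interior_of S)"
proof
  fix p assume p: "p \<in> S"
  then obtain \<phi> U where U: "p \<in> U" "half_chart (subtopology X S) \<phi> U"
    using wb S unfolding surface_wb_def by (metis IntI subsetD topspace_subtopology)
  note f = half_chart_facts [OF U(2)]
  have "\<exists>y \<in> X interior_of S. y \<in> T" if T: "openin X T" "p \<in> T" for T
  proof -
    have "openin (subtopology X S) (U \<inter> (S \<inter> T))"
    proof (rule openin_Int [OF f(1)])
      show "openin (subtopology X S) (S \<inter> T)"
        using T by (simp add: openin_subtopology_Int2)
    qed
    then have "openin (top_of_set upper_half_plane) (\<phi> ` (U \<inter> (S \<inter> T)))" by (rule f(5)) auto
    then obtain O' where O': "open O'" "\<phi> ` (U \<inter> (S \<inter> T)) = upper_half_plane \<inter> O'"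
      by (auto simp: openin_open)
    then have pO: "\<phi> p \<in> upper_half_plane" "\<phi> p \<in> O'" using p U T by auto
    then obtain e where e: "e > 0" "cball (\<phi> p) e \<subseteq> O'" using O' open_contains_cball by blast
    have "\<phi> p + \<i> * of_real e \<in> upper_half_plane \<inter> O'"
      using pO e by (auto simp: upper_half_plane_def intro!: subsetD [OF e(2)] simp: dist_norm norm_mult)
    then have "\<phi> p + \<i> * of_real e \<in> \<phi> ` (U \<inter> (S \<inter> T))" using O'(2) by simp
    then obtain x where x: "x \<in> U" "x \<in> T" "\<phi> p + \<i> * of_real e = \<phi> x" by blast
    then have "Im (\<phi> x) > 0" using pO(1) e(1) unfolding x(3) [symmetric] by (simp add: upper_half_plane_def)
    then show ?thesis using half_chart_upper [OF S U(2) x(1)] x by blast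
  qed
  then show "p \<in> X closure_of (X interior_of S)"
    using p S by (auto simp: in_closure_of)
qed

end

section \<open>Collars of the pipes\<close>

text \<open>Collars of the pipe boundaries are parametrised in polar coordinates: the unit circle is the
  boundary circle and the norm is the collar coordinate, growing into the pipe.\<close>

abbreviation outer :: "complex set" where "outer \<equiv> {w. 1 \<le> norm w}"
abbreviation annulus :: "complex set" where "annulus \<equiv> {w. 1/2 < norm w}"

lemma polar_sgn: "(w::complex) = of_real (norm w) * sgn w"
  by (cases "w = 0") (auto simp: sgn_div_norm scaleR_conv_of_real field_simps)

lemma norm_one_plus: "t \<ge> 0 \<Longrightarrow> norm (1 + complex_of_real t) = 1 + t"
  by (metis abs_of_nonneg add_nonneg_nonneg norm_of_real of_real_1 of_real_add zero_le_one)

lemma sgn_scale: "norm (z::complex) = 1 \<Longrightarrow> r > 0 \<Longrightarrow> sgn (of_real r * z) = z"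
  by (simp add: sgn_div_norm norm_mult scaleR_conv_of_real)

lemma continuous_on_sgn_complex: "continuous_on (-{0}) (sgn :: complex \<Rightarrow> complex)"
  unfolding sgn_div_norm by (intro continuous_intros) auto

lemma open_annulus: "open annulus"
  by (intro open_Collect_less continuous_intros)

lemma circle_ray_homeomorphic:
  "homeomorphic_map (top_of_set outer) (prod_topology circle_top (top_of_set {0::real..})) (\<lambda>w. (sgn w, norm w - 1))"
proof -
  have "homeomorphic_maps (top_of_set outer) (prod_topology circle_top (top_of_set {0::real..}))
      (\<lambda>w. (sgn w, norm w - 1)) (\<lambda>(z,t). of_real (1 + t) * z)"
    unfolding homeomorphic_maps_def
  proof (intro conjI ballI)
    show "continuous_map (top_of_set outer) (prod_topology circle_top (top_of_set {0::real..})) (\<lambda>w. (sgn w, norm w - 1))"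
    proof (rule continuous_map_pairedI)
      have "outer \<subseteq> -{0}" by auto
      then show "continuous_map (top_of_set outer) circle_top sgn"
        using continuous_on_subset [OF continuous_on_sgn_complex]
        by (auto simp: circle_top_def continuous_map_in_subtopology norm_sgn)
      show "continuous_map (top_of_set outer) (top_of_set {0..}) (\<lambda>w. norm w - 1)"
        by (auto simp: continuous_map_in_subtopology intro!: continuous_intros)
    qed
    show "continuous_map (prod_topology circle_top (top_of_set {0::real..})) (top_of_set outer) (\<lambda>(z,t). of_real (1 + t) * z)"
      by (auto simp: circle_top_def continuous_map_in_subtopology case_prod_unfold norm_mult norm_one_plus intro!: continuous_intros)
    fix w assume "w \<in> topspace (top_of_set outer)"
    then show "(case (sgn w, norm w - 1) of (z,t) \<Rightarrow> of_real (1 + t) * z) = w"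
      using polar_sgn [of w] by simp
  next
    fix y assume y: "y \<in> topspace (prod_topology circle_top (top_of_set {0::real..}))"
    obtain z t where zt: "y = (z,t)" "norm z = 1" "t \<ge> 0" using y by (auto simp: circle_top_def)
    then have "sgn (of_real (1 + t) * z) = z" by (intro sgn_scale) auto
    then show "(sgn (case y of (z,t) \<Rightarrow> of_real (1 + t) * z), norm (case y of (z,t) \<Rightarrow> of_real (1 + t) * z) - 1) = y"
      using zt by (simp add: norm_mult norm_one_plus)
  qed
  then show ?thesis using homeomorphic_maps_map by blast
qed

section \<open>The pieces of a Nyikos decomposition and their boundary circles\<close>

locale nyikos = oriented_surface +
  fixes K :: "'a set" and n :: nat and P :: "nat \<Rightarrow> 'a set"
  assumes nyikos: "nyikos_decomposition X K n P"
begin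

abbreviation "bd i \<equiv> mbdry (subtopology X (P i))"
abbreviation "bdK \<equiv> mbdry (subtopology X K)"

lemma K_subset: "K \<subseteq> topspace X" and P_subset: "i \<in> {1..n} \<Longrightarrow> P i \<subseteq> topspace X"
  and cover: "topspace X = K \<union> (\<Union>i\<in>{1..n}. P i)"
  and K_compact: "compact_space (subtopology X K)"
  and K_surface: "surface_wb (subtopology X K)"
  and P_pipe: "i \<in> {1..n} \<Longrightarrow> long_pipe (subtopology X (P i))"
  and P_disjoint: "i \<in> {1..n} \<Longrightarrow> j \<in> {1..n} \<Longrightarrow> i \<noteq> j \<Longrightarrow> P i \<inter> P j = {}"
  and P_Int_K: "i \<in> {1..n} \<Longrightarrow> P i \<inter> K = bd i"
  and bd_component: "i \<in> {1..n} \<Longrightarrow> bd i \<in> connected_components_of (subtopology X bdK)"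
  and card_components: "card (connected_components_of (subtopology X bdK)) = n"
  using nyikos unfolding nyikos_decomposition_def by blast+

lemma K_closed: "closedin X K"
  using K_compact K_subset Hausdorff compactin_imp_closedin compactin_subspace by blast

lemma bd_eq: "i \<in> {1..n} \<Longrightarrow> bd i = P i - X interior_of (P i)"
  using mbdry_subtopology P_subset by blast

lemma bdK_eq: "bdK = K - X interior_of K"
  using mbdry_subtopology K_subset by blast

lemma bd_subset_bdK: "i \<in> {1..n} \<Longrightarrow> bd i \<subseteq> bdK"
  using connected_components_of_subset [OF bd_component] by simp

lemma bd_subset: "i \<in> {1..n} \<Longrightarrow> bd i \<subseteq> P i" "i \<in> {1..n} \<Longrightarrow> bd i \<subseteq> K"
  using P_Int_K by blast+

lemma interior_K_disjoint: "i \<in> {1..n} \<Longrightarrow> X interior_of K \<inter> P i = {}"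
  using P_Int_K bd_subset_bdK bdK_eq interior_of_subset [of X K] by blast

lemma bd_circle: "i \<in> {1..n} \<Longrightarrow> subtopology X (bd i) homeomorphic_space circle_top"
proof -
  assume i: "i \<in> {1..n}"
  have "subtopology (subtopology X (P i)) (bd i) homeomorphic_space circle_top"
    using P_pipe [OF i] by (simp add: long_pipe_def)
  then show ?thesis using bd_subset [OF i] by (simp add: subtopology_subtopology Int_absorb1)
qed

lemma bd_compact: "i \<in> {1..n} \<Longrightarrow> compactin X (bd i)"
proof -
  assume i: "i \<in> {1..n}"
  have "compact_space circle_top"
    by (simp add: circle_top_def compact_space_subtopology)
  then have "compact_space (subtopology X (bd i))"
    using bd_circle [OF i] homeomorphic_compact_space by blast
  moreover have "bd i \<subseteq> topspace X" using bd_subset K_subset i by blast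
  ultimately show ?thesis by (simp add: compactin_subspace)
qed

lemma bd_closed: "i \<in> {1..n} \<Longrightarrow> closedin X (bd i)"
  using bd_compact Hausdorff compactin_imp_closedin by blast

lemma bd_nonempty: "i \<in> {1..n} \<Longrightarrow> bd i \<noteq> {}"
proof -
  assume i: "i \<in> {1..n}"
  obtain f where f: "homeomorphic_map (subtopology X (bd i)) circle_top f"
    using bd_circle [OF i] homeomorphic_space by blast
  have "f ` topspace (subtopology X (bd i)) = sphere 0 1"
    using homeomorphic_imp_surjective_map [OF f] by (simp add: circle_top_def)
  moreover have "(1::complex) \<in> sphere 0 1" by simp
  ultimately show "bd i \<noteq> {}" by (metis Int_empty_right empty_iff image_empty topspace_subtopology)
qed

text \<open>The circles \<open>bd i\<close> are \<open>n\<close> different members of a set with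
  \<open>n\<close> elements, hence all of them.\<close>

lemma bdK_Union: "bdK = (\<Union>i\<in>{1..n}. bd i)"
proof (cases "n = 0")
  \<comment> \<open>With \<open>n = 0\<close> the cardinality condition would also hold for
    infinitely many components, because \<open>card\<close> is 0 on infinite sets. Here
    \<open>K\<close> is the whole surface and has no boundary at all.\<close>
  case True
  then have "topspace X = K" using cover by simp
  then show ?thesis using True by (simp add: bdK_eq interior_of_topspace) (metis diff_shunt_var interior_of_topspace order_refl)
next
  case False
  let ?C = "connected_components_of (subtopology X bdK)"
  have "inj_on bd {1..n}"
  proof (rule inj_onI, rule ccontr)
    fix i j assume ij: "i \<in> {1..n}" "j \<in> {1..n}" "bd i = bd j" "i \<noteq> j"
    obtain x where "x \<in> bd i" using bd_nonempty [OF ij(1)] by blast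
    then show False
      using P_disjoint [OF ij(1,2,4)] bd_subset(1) [OF ij(1)] bd_subset(1) [OF ij(2)] ij(3) by blast
  qed
  then have "card (bd ` {1..n}) = n" by (simp add: card_image)
  moreover have "finite ?C" using card_components False by (metis card.infinite)
  ultimately have "bd ` {1..n} = ?C"
    using card_components bd_component by (intro card_subset_eq) auto
  then show ?thesis using Union_connected_components_of [of "subtopology X bdK"] bdK_eq K_subset
    by (auto simp: Int_absorb1)
qed

text \<open>A collar has infinite length in \<open>norm w\<close>, so that each member of the
  exhaustion of a pipe is itself the image of one.\<close>

definition collar :: "nat \<Rightarrow> (complex \<Rightarrow> 'a) \<Rightarrow> bool" where
  "collar i e \<longleftrightarrow> homeomorphic_map (top_of_set outer) (subtopology X (e ` outer)) e \<and> e ` outer \<subseteq> P i \<and>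
     openin (subtopology X (P i)) (e ` outer) \<and> bd i = e ` sphere 0 1"

lemma collar_facts:
  assumes "i \<in> {1..n}" "collar i e"
  shows "continuous_map (top_of_set outer) X e" "inj_on e outer"
    "continuous_map (subtopology X (e ` outer)) (top_of_set outer) (inv_into outer e)"
    "\<And>w. w \<in> outer \<Longrightarrow> e w \<in> P i"
    "\<And>w. w \<in> outer \<Longrightarrow> e w \<in> bd i \<longleftrightarrow> norm w = 1"
    "\<And>w. w \<in> outer \<Longrightarrow> e w \<in> K \<longleftrightarrow> norm w = 1"
proof -
  have hom: "homeomorphic_map (top_of_set outer) (subtopology X (e ` outer)) e"
    and sub: "e ` outer \<subseteq> P i" and bd: "bd i = e ` sphere 0 1"
    using assms(2) by (auto simp: collar_def)
  show "continuous_map (top_of_set outer) X e"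
    using homeomorphic_imp_continuous_map [OF hom] continuous_map_into_fulltopology by blast
  show inj: "inj_on e outer"
    using homeomorphic_imp_injective_map [OF hom] by simp
  obtain g where g: "homeomorphic_maps (top_of_set outer) (subtopology X (e ` outer)) e g"
    using hom homeomorphic_map_maps by blast
  have top: "topspace (subtopology X (e ` outer)) = e ` outer"
    using sub P_subset [OF assms(1)] by auto
  show "continuous_map (subtopology X (e ` outer)) (top_of_set outer) (inv_into outer e)"
    by (rule continuous_map_eq [of _ _ g]) (use g inj top in \<open>auto simp: homeomorphic_maps_def\<close>)
  show *: "e w \<in> P i" if "w \<in> outer" for w using sub that by blast
  show **: "e w \<in> bd i \<longleftrightarrow> norm w = 1" if "w \<in> outer" for w
  proof
    assume "e w \<in> bd i"
    then obtain z where "z \<in> sphere 0 1" "e w = e z" using bd by auto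
    then show "norm w = 1" using inj_onD [OF inj, of w z] that by auto
  qed (simp add: bd)
  show "e w \<in> K \<longleftrightarrow> norm w = 1" if "w \<in> outer" for w
    using P_Int_K [OF assms(1)] * [OF that] ** [OF that] by blast
qed

text \<open>The homeomorphism given for a member of the exhaustion says nothing about where the
  boundary goes. That it sends the end circle to \<open>bd i\<close> is invariance of domain: radii
  above 1 have planar neighbourhoods, while at radius 1 such a neighbourhood would spill over to
  radii below 1.\<close>

lemma collar_exists:
  assumes i: "i \<in> {1..n}" and U: "openin (subtopology X (P i)) U" "bd i \<subseteq> U"
    and hom: "subtopology (subtopology X (P i)) U homeomorphic_space prod_topology circle_top (top_of_set {0::real..})"
  obtains e where "collar i e" "e ` outer = U"
proof -
  have UP: "U \<subseteq> P i" using U(1) openin_subset by fastforce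
  then have US: "U \<subseteq> topspace X" using P_subset [OF i] by blast
  have sub: "subtopology (subtopology X (P i)) U = subtopology X U"
    using UP by (simp add: subtopology_subtopology Int_absorb1)
  have "top_of_set outer homeomorphic_space subtopology X U"
    using hom circle_ray_homeomorphic homeomorphic_map_imp_homeomorphic_space homeomorphic_space_sym
      homeomorphic_space_trans unfolding sub by meson
  then obtain e where e: "homeomorphic_map (top_of_set outer) (subtopology X U) e"
    using homeomorphic_space by metis
  have eU: "e ` outer = U"
    using homeomorphic_imp_surjective_map [OF e] US by (simp add: Int_absorb1)
  have inj: "inj_on e outer" using homeomorphic_imp_injective_map [OF e] by simp
  have cont: "continuous_map (top_of_set outer) X e"
    using homeomorphic_imp_continuous_map [OF e] continuous_map_into_fulltopology by blast
  have out: "e w \<in> X interior_of (P i)" if "norm w > 1" for w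
  proof -
    have "openin X (e ` {w. norm w > 1})"
    proof (rule openin_planar_image)
      show "open {w::complex. norm w > 1}" by (intro open_Collect_less continuous_intros)
    qed (auto intro: continuous_map_from_subtopology_mono [OF cont] inj_on_subset [OF inj])
    moreover have "e ` {w. norm w > 1} \<subseteq> P i" using eU UP by auto
    ultimately show ?thesis using that by (auto simp: interior_of_def)
  qed
  have inn: "e w \<notin> X interior_of (P i)" if "norm w = 1" for w
  proof
    assume wi: "e w \<in> X interior_of (P i)"
    let ?N = "U \<inter> X interior_of (P i)"
    obtain T where "openin X T" "U = T \<inter> P i" using U(1) by (auto simp: openin_subtopology)
    then have "?N = T \<inter> X interior_of (P i)" using interior_of_subset [of X "P i"] by blast
    then have N: "openin X ?N" using \<open>openin X T\<close> by auto
    obtain g where g: "homeomorphic_maps (top_of_set outer) (subtopology X U) e g"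
      using e homeomorphic_map_maps by blast
    then have gU: "continuous_map (subtopology X U) (top_of_set outer) g" and ge: "\<And>w. w \<in> outer \<Longrightarrow> g (e w) = w"
      by (auto simp: homeomorphic_maps_def)
    have "open (g ` ?N)"
    proof (rule open_planar_image [OF N])
      show "continuous_map (subtopology X ?N) euclidean g"
        by (rule continuous_map_from_subtopology_mono [OF continuous_map_into_fulltopology [OF gU]]) auto
      show "inj_on g ?N" using ge eU by (auto simp: inj_on_def)
    qed
    moreover have "w \<in> g ` ?N" using ge [of w] that wi eU by (force simp: image_iff)
    ultimately obtain r where r: "r > 0" "cball w r \<subseteq> g ` ?N" using open_contains_cball by blast
    \<comment> \<open>A factor so close to 1 that \<open>c * w\<close> lies in the ball of radius
      \<open>r\<close>, and at least 1/2 so that it stays positive. The point then has norm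
      \<open>c\<close>, too small for \<open>outer\<close>.\<close>
    define c where "c = 1 - min r (1/2)"
    have c: "1/2 \<le> c" "c < 1" "1 - c \<le> r" using r(1) by (auto simp: c_def min_def)
    let ?v = "of_real c * w"
    have "dist w ?v = 1 - c"
    proof -
      have "w - ?v = of_real (1 - c) * w" by (simp add: algebra_simps)
      then show ?thesis using c that by (simp add: dist_norm norm_mult del: of_real_diff)
    qed
    then have "?v \<in> cball w r" using c(3) by simp
    then have "?v \<in> g ` ?N" using r(2) by blast
    then obtain x where "x \<in> U" "?v = g x" by blast
    then have "?v \<in> outer" using eU ge by auto
    then show False using that c by (auto simp: norm_mult)
  qed
  have "bd i = e ` sphere 0 1"
  proof
    show "bd i \<subseteq> e ` sphere 0 1"
    proof
      fix x assume x: "x \<in> bd i"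
      then obtain w where w: "w \<in> outer" "x = e w" using U(2) eU by blast
      have "\<not> norm w > 1" using out x w bd_eq [OF i] by blast
      then show "x \<in> e ` sphere 0 1" using w by auto
    qed
    show "e ` sphere 0 1 \<subseteq> bd i"
      using inn eU UP unfolding bd_eq [OF i] by auto
  qed
  then have "collar i e" using e eU UP U(1) by (simp add: collar_def)
  then show ?thesis using eU that by blast
qed

lemma half_chart_bd:
  assumes i: "i \<in> {1..n}" and \<phi>: "half_chart (subtopology X K) \<phi> U" and x: "x \<in> U" "x \<in> bdK"
  shows "Im (\<phi> x) = 0"
proof -
  have "\<phi> x \<in> upper_half_plane"
    using \<phi> x(1) openin_subset unfolding half_chart_def by fastforce
  moreover have "\<not> Im (\<phi> x) > 0"
    using half_chart_upper [OF K_subset \<phi> x(1)] x(2) bdK_eq by blast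
  ultimately show ?thesis by (simp add: upper_half_plane_def)
qed

text \<open>Across a boundary circle, a half-disc chart of K and the collar fit together to a plane chart.\<close>
lemma bichart:
  assumes i: "i \<in> {1..n}" and e: "collar i e" and z0: "norm z0 = 1"
  obtains \<delta> b where "\<delta> > 0" "continuous_map (top_of_set {w \<in> annulus. dist (sgn w) z0 < \<delta>}) X b"
    "inj_on b {w \<in> annulus. dist (sgn w) z0 < \<delta>}"
    "\<And>w. w \<in> outer \<Longrightarrow> dist (sgn w) z0 < \<delta> \<Longrightarrow> b w = e w"
    "\<And>w. w \<in> annulus \<Longrightarrow> dist (sgn w) z0 < \<delta> \<Longrightarrow> norm w < 1 \<Longrightarrow> b w \<in> X interior_of K"
proof -
  note c = collar_facts [OF i e]
  have ez: "e z \<in> bd i" "e z \<in> bdK" "e z \<in> K" if "norm z = 1" for z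
    using c(5) [of z] bd_subset_bdK [OF i] bd_subset [OF i] that by auto
  obtain \<phi> N where \<phi>: "e z0 \<in> N" "half_chart (subtopology X K) \<phi> N"
    using K_surface ez(3) [OF z0] K_subset unfolding surface_wb_def by (metis IntI subsetD topspace_subtopology)
  note f = half_chart_facts [OF \<phi>(2)]
  have NK: "N \<subseteq> K" using f(1) openin_subset by fastforce
  have im: "Im (\<phi> (e z)) = 0" if "norm z = 1" "e z \<in> N" for z
    using half_chart_bd [OF i \<phi>(2)] ez that by blast
  obtain O' where O': "open O'" "\<phi> ` N = upper_half_plane \<inter> O'"
    using \<phi>(2) by (auto simp: half_chart_def openin_open)
  \<comment> \<open>The radius \<open>2 * \<epsilon>\<close> is spent in two halves: one for moving
    along the boundary, one for the height above it.\<close>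
  then obtain \<epsilon> where eps: "\<epsilon> > 0" "ball (\<phi> (e z0)) (2*\<epsilon>) \<subseteq> O'"
    using \<phi>(1) open_contains_ball by (metis (no_types, lifting) IntE image_eqI mult_2 field_sum_of_halves half_gt_zero)
  have ecirc: "continuous_map (top_of_set (sphere 0 1)) X e"
    by (rule continuous_map_from_subtopology_mono [OF c(1)]) auto
  obtain T where T: "openin X T" "N = T \<inter> K" using f(1) by (auto simp: openin_subtopology)
  let ?J0 = "{z \<in> sphere 0 1. e z \<in> T}"
  have J0: "openin (top_of_set (sphere 0 1)) ?J0"
    using openin_continuous_map_preimage [OF ecirc T(1)] by simp
  have J0N: "e z \<in> N" if "z \<in> ?J0" for z using that ez T by auto
  have "continuous_map (top_of_set ?J0) (subtopology X N) e"
    using ecirc J0N by (auto simp: continuous_map_in_subtopology intro: continuous_map_from_subtopology_mono)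
  moreover have "continuous_map (subtopology X N) euclidean \<phi>"
    using f(2,3) NK by (simp add: subtopology_subtopology Int_absorb1)
  ultimately have "continuous_map (top_of_set ?J0) euclidean (\<phi> \<circ> e)"
    by (rule continuous_map_compose)
  then have phie: "continuous_on ?J0 (\<phi> \<circ> e)" by simp
  have "openin (top_of_set ?J0) (?J0 \<inter> (\<phi> \<circ> e) -` ball (\<phi> (e z0)) \<epsilon>)"
    by (rule continuous_openin_preimage_gen [OF phie]) simp
  then have "openin (top_of_set (sphere 0 1)) (?J0 \<inter> (\<phi> \<circ> e) -` ball (\<phi> (e z0)) \<epsilon>)"
    using J0 openin_trans by blast
  moreover have "z0 \<in> ?J0 \<inter> (\<phi> \<circ> e) -` ball (\<phi> (e z0)) \<epsilon>"
    using z0 \<phi>(1) T(2) eps(1) by auto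
  ultimately have "\<exists>\<delta>>0. \<forall>z\<in>sphere 0 1. dist z z0 < \<delta> \<longrightarrow> z \<in> ?J0 \<inter> (\<phi> \<circ> e) -` ball (\<phi> (e z0)) \<epsilon>"
    unfolding openin_euclidean_subtopology_iff by blast
  then obtain \<delta> where \<delta>0: "\<delta> > 0"
    "\<forall>z\<in>sphere 0 1. dist z z0 < \<delta> \<longrightarrow> z \<in> ?J0 \<inter> (\<phi> \<circ> e) -` ball (\<phi> (e z0)) \<epsilon>"
    by blast
  have \<delta>: "\<delta> > 0"
    "\<And>z. norm z = 1 \<Longrightarrow> dist z z0 < \<delta> \<Longrightarrow> z \<in> ?J0 \<inter> (\<phi> \<circ> e) -` ball (\<phi> (e z0)) \<epsilon>"
    using \<delta>0 mem_sphere_0 by blast+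
  define D where "D = {w \<in> annulus. dist (sgn w) z0 < \<delta>}"
  have sgnD: "sgn w \<in> ?J0" "dist (\<phi> (e (sgn w))) (\<phi> (e z0)) < \<epsilon>" if "w \<in> D" for w
  proof -
    have "w \<noteq> 0" using that by (auto simp: D_def)
    then show "sgn w \<in> ?J0" "dist (\<phi> (e (sgn w))) (\<phi> (e z0)) < \<epsilon>"
      using \<delta>(2) [of "sgn w"] that by (auto simp: D_def norm_sgn dist_commute)
  qed
  \<comment> \<open>Along a radius the point rises vertically above the boundary point
    \<open>\<phi> (e (sgn w))\<close>. At norm 1 the height is 0, which makes the two branches of
    \<open>b\<close> agree there.\<close>
  define \<rho> where "\<rho> w = \<phi> (e (sgn w)) + \<i> * of_real (\<epsilon> * (1 - norm w))" for w
  define b where "b w = (if norm w \<ge> 1 then e w else inv_into N \<phi> (\<rho> w))" for w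
  have rho: "\<rho> w \<in> \<phi> ` N" "Im (\<rho> w) = \<epsilon> * (1 - norm w)" if "w \<in> D" "norm w \<le> 1" for w
  proof -
    have "norm (sgn w) = 1" using sgnD [OF that(1)] by simp
    then have "Im (\<phi> (e (sgn w))) = 0" using im J0N sgnD that by blast
    then show Im: "Im (\<rho> w) = \<epsilon> * (1 - norm w)" by (simp add: \<rho>_def)
    have "dist (\<rho> w) (\<phi> (e (sgn w))) = \<epsilon> * (1 - norm w)"
      using eps(1) that(2) by (simp add: \<rho>_def dist_norm norm_mult abs_mult del: of_real_mult of_real_diff)
    also have "\<dots> < \<epsilon>"
    proof -
      have "1 - norm w < 1" using that(1) by (auto simp: D_def)
      then have "\<epsilon> * (1 - norm w) < \<epsilon> * 1" by (rule mult_strict_left_mono [OF _ eps(1)])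
      then show ?thesis by simp
    qed
    finally have "dist (\<rho> w) (\<phi> (e z0)) < 2 * \<epsilon>"
      using sgnD(2) [OF that(1)] dist_triangle [of "\<rho> w" "\<phi> (e z0)" "\<phi> (e (sgn w))"] by linarith
    then have "\<rho> w \<in> O'" using eps(2) by (auto simp: dist_commute)
    moreover have "\<rho> w \<in> upper_half_plane" using Im eps(1) that(2) by (simp add: upper_half_plane_def)
    ultimately show "\<rho> w \<in> \<phi> ` N" using O' by blast
  qed
  have inner: "b w \<in> X interior_of K" "b w \<in> N" "\<phi> (b w) = \<rho> w" if "w \<in> D" "norm w < 1" for w
  proof -
    show 1: "b w \<in> N" using rho [OF that(1)] that by (simp add: b_def inv_into_into)
    show 2: "\<phi> (b w) = \<rho> w" using rho [OF that(1)] that by (simp add: b_def f_inv_into_f)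
    show "b w \<in> X interior_of K"
      by (rule half_chart_upper [OF K_subset \<phi>(2) 1]) (use 2 rho(2) [OF that(1)] that eps(1) in auto)
  qed
  have "inj_on b D"
  proof (rule inj_onI)
    fix v w assume vw: "v \<in> D" "w \<in> D" "b v = b w"
    \<comment> \<open>The interior of \<open>K\<close> misses the pipe, so membership in it tells
      the branches of \<open>b\<close> apart, and injectivity can be checked on each branch
      alone.\<close>
    have iff: "norm v < 1 \<longleftrightarrow> b v \<in> X interior_of K" if "v \<in> D" for v
      using inner(1) [OF that] c(4) [of v] interior_K_disjoint [OF i]
      by (auto simp: b_def not_less)
    show "v = w"
    proof (cases "norm v < 1")
      case True
      then have w1: "norm w < 1" using iff vw by metis
      have eq: "\<rho> v = \<rho> w" using inner(3) vw True w1 by metis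
      have "\<epsilon> * (1 - norm v) = \<epsilon> * (1 - norm w)"
        using rho(2) [OF vw(1) less_imp_le [OF True]] rho(2) [OF vw(2) less_imp_le [OF w1]] unfolding eq by argo
      then have nn: "norm v = norm w" using eps(1) by simp
      have "\<phi> (e (sgn v)) = \<phi> (e (sgn w))" using eq nn by (simp add: \<rho>_def)
      then have "e (sgn v) = e (sgn w)" using inj_onD [OF f(2)] J0N sgnD(1) vw by blast
      moreover have "sgn v \<in> outer" "sgn w \<in> outer" using sgnD(1) vw by auto
      ultimately have "sgn v = sgn w" using inj_onD [OF c(2)] by blast
      then show ?thesis using nn polar_sgn by metis
    next
      case False
      then have "\<not> norm w < 1" using iff vw by metis
      then show ?thesis using False vw(3) inj_onD [OF c(2), of v w] by (simp add: b_def)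
    qed
  qed
  moreover have "continuous_map (top_of_set D) X b"
  proof -
    have rhoc: "continuous_on D \<rho>"
    proof -
      have "continuous_on D sgn"
        by (rule continuous_on_subset [OF continuous_on_sgn_complex]) (auto simp: D_def)
      then have "continuous_on D (\<lambda>w. (\<phi> \<circ> e) (sgn w))"
        by (rule continuous_on_compose2 [OF phie]) (use sgnD in blast)
      then show ?thesis unfolding \<rho>_def o_def by (intro continuous_intros)
    qed
    have D1: "continuous_map (top_of_set {w \<in> D. norm w \<le> 1}) X (\<lambda>w. inv_into N \<phi> (\<rho> w))"
    proof -
      have "continuous_map (top_of_set {w \<in> D. norm w \<le> 1}) (top_of_set (\<phi> ` N)) \<rho>"
        using rho(1) continuous_on_subset [OF rhoc, of "{w \<in> D. norm w \<le> 1}"]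
        by (auto simp: continuous_map_in_subtopology)
      moreover have "continuous_map (top_of_set (\<phi> ` N)) X (inv_into N \<phi>)"
        using f(4) continuous_map_into_fulltopology by blast
      ultimately show ?thesis by (rule continuous_map_compose [unfolded o_def])
    qed
    have D2: "continuous_map (top_of_set {w \<in> D. 1 \<le> norm w}) X e"
      by (rule continuous_map_from_subtopology_mono [OF c(1)]) auto
    show ?thesis
    proof (rule pasting_lemma_closed [where I = UNIV])
      let ?T = "\<lambda>i. {w \<in> D. if i then norm w \<le> 1 else 1 \<le> norm w}"
      let ?f = "\<lambda>i w. if i then inv_into N \<phi> (\<rho> w) else e w"
      show "closedin (top_of_set D) (?T i)" for i
      proof -
        have "closed {w::complex. if i then norm w \<le> 1 else 1 \<le> norm w}"
          by (cases i) (auto intro!: closed_Collect_le continuous_intros)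
        then have "closedin (top_of_set D) (D \<inter> {w. if i then norm w \<le> 1 else 1 \<le> norm w})"
          by (rule closedin_closed_Int)
        moreover have "D \<inter> {w. if i then norm w \<le> 1 else 1 \<le> norm w} = ?T i" by auto
        ultimately show ?thesis by simp
      qed
      have sub: "subtopology (top_of_set D) (?T i) = top_of_set (?T i)" for i
        by (simp add: subtopology_subtopology Int_absorb1)
      show "continuous_map (subtopology (top_of_set D) (?T i)) X (?f i)" for i
        unfolding sub using D1 D2 by (cases i) auto
      have eq: "inv_into N \<phi> (\<rho> w) = e w" if "w \<in> D" "norm w = 1" for w
      proof -
        have "sgn w = w" using that by (simp add: sgn_div_norm)
        then show ?thesis using that sgnD(1) [OF that(1)] J0N f(2) by (simp add: \<rho>_def)
      qed
      fix i j x assume "x \<in> topspace (top_of_set D) \<inter> ?T i \<inter> ?T j"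
      then show "?f i x = ?f j x" using eq [of x] by (cases i; cases j) auto
    next
      let ?T = "\<lambda>i. {w \<in> D. if i then norm w \<le> 1 else 1 \<le> norm w}"
      let ?f = "\<lambda>i w. if i then inv_into N \<phi> (\<rho> w) else e w"
      fix x assume "x \<in> topspace (top_of_set D)"
      then show "\<exists>j. j \<in> UNIV \<and> x \<in> ?T j \<and> b x = ?f j x"
        by (intro exI [of _ "norm x < 1"]) (auto simp: b_def)
    qed auto
  qed
  ultimately show ?thesis
    using that [of \<delta> b] \<delta>(1) inner(1) by (auto simp: D_def b_def)
qed

lemma open_sector: "open {w \<in> annulus. dist (sgn w) z0 < \<delta>}"
proof -
  have "continuous_on annulus (\<lambda>w. dist (sgn w) z0)"
    by (intro continuous_intros continuous_on_subset [OF continuous_on_sgn_complex]) auto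
  then have "open (annulus \<inter> (\<lambda>w. dist (sgn w) z0) -` {..<\<delta>})"
    by (rule continuous_open_preimage [OF _ open_annulus open_lessThan])
  moreover have "annulus \<inter> (\<lambda>w. dist (sgn w) z0) -` {..<\<delta>} = {w \<in> annulus. dist (sgn w) z0 < \<delta>}" by auto
  ultimately show ?thesis by simp
qed

section \<open>Exhaustion of a pipe, and its closedness\<close>

lemma pipe_exhaustion:
  assumes i: "i \<in> {1..n}"
  obtains I and r and U :: "'a set \<Rightarrow> 'a set" where "well_order_on I r" "uncountable I" "(\<Union>\<alpha>\<in>I. U \<alpha>) = P i"
    "\<And>\<alpha>. \<alpha> \<in> I \<Longrightarrow> openin (subtopology X (P i)) (U \<alpha>)"
    "\<And>\<alpha>. \<alpha> \<in> I \<Longrightarrow> \<exists>e. collar i e \<and> e ` outer = U \<alpha>"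
    "\<And>\<alpha> \<beta>. \<alpha> \<in> I \<Longrightarrow> \<beta> \<in> I \<Longrightarrow> (\<alpha>,\<beta>) \<in> r \<Longrightarrow> U \<alpha> \<subseteq> U \<beta>"
proof -
  let ?Y = "subtopology X (P i)"
  have top: "topspace ?Y = P i" using P_subset [OF i] by auto
  obtain I r and U :: "'a set \<Rightarrow> 'a set" where
    1: "well_order_on I r" "uncountable I" "(\<Union>\<alpha>\<in>I. U \<alpha>) = topspace ?Y" and
    2: "\<forall>\<alpha>\<in>I. openin ?Y (U \<alpha>) \<and> bd i \<subseteq> U \<alpha> \<and>
           subtopology ?Y (U \<alpha>) homeomorphic_space prod_topology circle_top (top_of_set {0::real..})" and
    3: "\<forall>\<alpha>\<in>I. \<forall>\<beta>\<in>I. (\<alpha>, \<beta>) \<in> r \<and> \<alpha> \<noteq> \<beta> \<longrightarrow>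
           ?Y closure_of (U \<alpha>) \<subseteq> U \<beta> \<and>
           subtopology ?Y ((subtopology ?Y (U \<beta>)) frontier_of (U \<alpha>)) homeomorphic_space circle_top"
    using P_pipe [OF i] unfolding long_pipe_def by (elim conjE exE) (rule that; assumption)
  show ?thesis
  proof (rule that [OF 1(1,2)])
    show "(\<Union>\<alpha>\<in>I. U \<alpha>) = P i" using 1(3) top by simp
    fix \<alpha> assume a: "\<alpha> \<in> I"
    then have U: "openin ?Y (U \<alpha>)" "bd i \<subseteq> U \<alpha>"
       "subtopology ?Y (U \<alpha>) homeomorphic_space prod_topology circle_top (top_of_set {0::real..})"
      using 2 by blast+
    show "openin ?Y (U \<alpha>)" by fact
    show "\<exists>e. collar i e \<and> e ` outer = U \<alpha>"
      using collar_exists [OF i U] by metis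
    fix \<beta> assume "\<beta> \<in> I" "(\<alpha>,\<beta>) \<in> r"
    then show "U \<alpha> \<subseteq> U \<beta>"
      using 3 a closure_of_subset [OF openin_subset [OF U(1)]] by (cases "\<alpha> = \<beta>") blast+
  qed
qed

lemma some_collar:
  assumes i: "i \<in> {1..n}" obtains e where "collar i e"
proof -
  obtain I r and U :: "'a set \<Rightarrow> 'a set" where U: "uncountable I"
    "\<And>\<alpha>. \<alpha> \<in> I \<Longrightarrow> \<exists>e. collar i e \<and> e ` outer = U \<alpha>"
    by (rule pipe_exhaustion [OF i], rule that)
  have "I \<noteq> {}" using U(1) by auto
  then obtain \<alpha> where "\<alpha> \<in> I" by blast
  then show ?thesis using U(2) that by blast
qed

text \<open>A limit point outside \<open>P i\<close> can lie neither in the interior of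
  \<open>K\<close> nor in that of any pipe, so it lies on a circle \<open>bd j\<close> with another
  \<open>j\<close>. There the bichart gives a neighbourhood made of interior points of
  \<open>K\<close> and points of \<open>P j\<close>, which misses \<open>P i\<close>.\<close>

lemma P_closed:
  assumes i: "i \<in> {1..n}" shows "closedin X (P i)"
proof -
  have "X closure_of (P i) \<subseteq> P i"
  proof (rule ccontr)
    assume "\<not> X closure_of (P i) \<subseteq> P i"
    then obtain p where p: "p \<in> X closure_of (P i)" "p \<notin> P i" by blast
    have pX: "p \<in> topspace X" using p by (simp add: in_closure_of)
    have meet: "\<exists>y. y \<in> P i \<and> y \<in> T" if "openin X T" "p \<in> T" for T
      using p(1) that by (auto simp: in_closure_of)
    have notint: "p \<notin> X interior_of (P j)" if "j \<in> {1..n}" for j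
      using meet [of "X interior_of (P j)"] p(2) P_disjoint [OF i that] interior_of_subset [of X "P j"]
      by (cases "i = j") auto
    have "p \<notin> X interior_of K"
    proof
      assume "p \<in> X interior_of K"
      from meet [OF openin_interior_of this] show False
        using interior_K_disjoint [OF i] by blast
    qed
    moreover have "p \<in> K"
    proof -
      have "p \<in> bd j" if "j \<in> {1..n}" "p \<in> P j" for j using bd_eq notint that by blast
      then show ?thesis using pX cover bd_subset(2) by blast
    qed
    ultimately obtain j where j: "j \<in> {1..n}" "p \<in> bd j" using bdK_eq bdK_Union by blast
    then have ij: "i \<noteq> j" using p(2) bd_subset by blast
    obtain e where e: "collar j e" using some_collar [OF j(1)] .
    obtain z0 where z0: "norm z0 = 1" "p = e z0" using e j(2) by (auto simp: collar_def)
    obtain \<delta> b where \<delta>: "\<delta> > 0" and b: "continuous_map (top_of_set {w \<in> annulus. dist (sgn w) z0 < \<delta>}) X b"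
      "inj_on b {w \<in> annulus. dist (sgn w) z0 < \<delta>}"
      "\<And>w. w \<in> outer \<Longrightarrow> dist (sgn w) z0 < \<delta> \<Longrightarrow> b w = e w"
      "\<And>w. w \<in> annulus \<Longrightarrow> dist (sgn w) z0 < \<delta> \<Longrightarrow> norm w < 1 \<Longrightarrow> b w \<in> X interior_of K"
      by (rule bichart [OF j(1) e z0(1)], rule that)
    let ?N = "b ` {w \<in> annulus. dist (sgn w) z0 < \<delta>} - bd i"
    have "openin X ?N"
      using openin_planar_image [OF open_sector b(1,2)] bd_closed [OF i] by blast
    moreover have "p \<in> ?N"
    proof -
      have "sgn z0 = z0" using z0 by (simp add: sgn_div_norm)
      then have "b z0 = p" "z0 \<in> {w \<in> annulus. dist (sgn w) z0 < \<delta>}"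
        using b(3) [of z0] z0 \<delta> by auto
      then show ?thesis using p(2) bd_subset [OF i] by blast
    qed
    ultimately obtain y where y: "y \<in> P i" "y \<in> ?N" using meet by blast
    then obtain w where w: "w \<in> annulus" "dist (sgn w) z0 < \<delta>" "y = b w" by blast
    have "y \<in> X interior_of K \<or> y \<in> P j"
      using b(3,4) w collar_facts(4) [OF j(1) e] by (cases "norm w < 1") auto
    then show False
      using y(1) interior_K_disjoint [OF i] P_disjoint [OF i j(1) ij] by blast
  qed
  then show ?thesis using P_subset [OF i] closure_of_subset_eq by blast
qed

end

section \<open>Bicollars\<close>

lemma compact_sector:
  assumes "0 < r"
  shows "compact {w::complex. r \<le> norm w \<and> norm w \<le> R \<and> dist (sgn w) z0 \<le> \<delta>}"
proof -
  have "closed {w::complex. r \<le> norm w \<and> norm w \<le> R}"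
    by (intro closed_Collect_conj closed_Collect_le continuous_intros)
  moreover have "continuous_on {w::complex. r \<le> norm w \<and> norm w \<le> R} (\<lambda>w. dist (sgn w) z0)"
    using assms by (intro continuous_intros continuous_on_subset [OF continuous_on_sgn_complex]) auto
  ultimately have "closed ({w::complex. r \<le> norm w \<and> norm w \<le> R} \<inter> (\<lambda>w. dist (sgn w) z0) -` {..\<delta>})"
    by (intro continuous_closed_preimage) auto
  moreover have "{w::complex. r \<le> norm w \<and> norm w \<le> R} \<inter> (\<lambda>w. dist (sgn w) z0) -` {..\<delta>}
     = {w. r \<le> norm w \<and> norm w \<le> R \<and> dist (sgn w) z0 \<le> \<delta>}" by auto
  moreover have "bounded {w::complex. r \<le> norm w \<and> norm w \<le> R \<and> dist (sgn w) z0 \<le> \<delta>}"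
    by (rule boundedI [of _ R]) auto
  ultimately show ?thesis by (simp add: compact_eq_bounded_closed)
qed

lemma compact_annulus:
  assumes "0 < r"
  shows "compact {w::complex. r \<le> norm w \<and> norm w \<le> R}"
proof -
  have "closed {w::complex. r \<le> norm w \<and> norm w \<le> R}"
    by (intro closed_Collect_conj closed_Collect_le continuous_intros)
  moreover have "bounded {w::complex. r \<le> norm w \<and> norm w \<le> R}"
    by (rule boundedI [of _ R]) auto
  ultimately show ?thesis by (simp add: compact_eq_bounded_closed)
qed

context nyikos
begin

text \<open>Radii below 1 are the side of \<open>K\<close>. The inner radius 1/2 of
  \<open>annulus\<close> is a choice that leaves room for supports beginning at 3/4 or
  15/16.\<close>

definition bicollar :: "nat \<Rightarrow> (complex \<Rightarrow> 'a) \<Rightarrow> bool" where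
  "bicollar i e \<longleftrightarrow> continuous_map (top_of_set annulus) X e \<and> inj_on e annulus \<and> collar i e \<and>
     (\<forall>w\<in>annulus. norm w < 1 \<longrightarrow> e w \<in> X interior_of K)"

text \<open>The region outside \<open>K\<close> past the curve \<open>norm w = f (sgn w)\<close>;
  the other pipes and the part of the pipe off the collar count as past it. It measures how far the
  complement of \<open>K\<close> has been pushed away, which is all that the construction of a
  bicollar has to know.\<close>

definition beyond :: "nat \<Rightarrow> (complex \<Rightarrow> 'a) \<Rightarrow> (complex \<Rightarrow> real) \<Rightarrow> 'a set" where
  "beyond i e f = (topspace X - K - e ` outer) \<union> e ` {w \<in> outer. f (sgn w) \<le> norm w}"

text \<open>A radial stretch in the sector chart \<open>b\<close> lifts the level curve
  \<open>f\<close> to \<open>f + l\<close>. The chart straddles the boundary circle, so the stretch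
  can fade out on the side of \<open>K\<close> and is a homeomorphism of the whole surface.\<close>

lemma local_push:
  assumes i: "i \<in> {1..n}" and e: "collar i e"
    and D: "D = {w \<in> annulus. dist (sgn w) z0 < \<delta>}"
    and b: "continuous_map (top_of_set D) X b" "inj_on b D"
      "\<And>w. w \<in> outer \<Longrightarrow> w \<in> D \<Longrightarrow> b w = e w"
      "\<And>w. w \<in> D \<Longrightarrow> norm w < 1 \<Longrightarrow> b w \<in> X interior_of K"
    and f: "continuous_on (sphere 0 1) f" "\<And>z. norm z = 1 \<Longrightarrow> 1 \<le> f z"
    and l: "continuous_on (sphere 0 1) l" "\<And>z. norm z = 1 \<Longrightarrow> 0 \<le> l z" "\<And>z. norm z = 1 \<Longrightarrow> f z + l z \<le> 9/8"
      "\<And>z. norm z = 1 \<Longrightarrow> \<delta>' < dist z z0 \<Longrightarrow> l z = 0" "\<delta>' < \<delta>"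
  obtains \<beta> where "homeomorphic_map X X \<beta>"
    "\<And>z. norm z = 1 \<Longrightarrow> \<beta> (e (of_real (f z) * z)) = e (of_real (f z + l z) * z)"
    "\<beta> ` beyond i e f \<subseteq> beyond i e (\<lambda>z. f z + l z)"
proof -
  note c = collar_facts [OF i e]
  \<comment> \<open>A tent of height 1 and slope 4 around the level \<open>f\<close>. Since
    \<open>f \<ge> 1\<close> and \<open>f + l \<le> 9/8\<close>, the factor \<open>l\<close> is at
    most 1/8, so the tent contributes slope at most 1/2 and \<open>m\<close> stays strictly
    increasing in the norm.\<close>
  define m where "m w = norm w + l (sgn w) * max 0 (1 - 4 * \<bar>norm w - f (sgn w)\<bar>)" for w :: complex
  define \<gamma> where "\<gamma> w = of_real (m w) * sgn w" for w
  have nsgn: "norm (sgn w) = 1" if "w \<in> annulus" for w using that by (auto simp: norm_sgn)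
  have l8: "l z \<le> 1/8" if "norm z = 1" for z using f(2) [OF that] l(3) [OF that] by simp
  have m_ge: "norm w \<le> m w" if "w \<in> annulus" for w using l(2) [OF nsgn [OF that]] by (simp add: m_def)
  have m_mono: "m v < m w" if "v \<in> annulus" "w \<in> annulus" "sgn v = sgn w" "norm v < norm w" for v w
  proof -
    let ?z = "sgn w"
    have z: "norm ?z = 1" using nsgn that by blast
    have "max 0 (1 - 4 * \<bar>norm v - f ?z\<bar>) \<le> max 0 (1 - 4 * \<bar>norm w - f ?z\<bar>) + 4 * (norm w - norm v)"
      using that(4) by (auto simp: max_def abs_if)
    then have "l ?z * max 0 (1 - 4 * \<bar>norm v - f ?z\<bar>) \<le> l ?z * (max 0 (1 - 4 * \<bar>norm w - f ?z\<bar>) + 4 * (norm w - norm v))"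
      by (rule mult_left_mono [OF _ l(2) [OF z]])
    then have "l ?z * max 0 (1 - 4 * \<bar>norm v - f ?z\<bar>) \<le>
        l ?z * max 0 (1 - 4 * \<bar>norm w - f ?z\<bar>) + l ?z * (4 * (norm w - norm v))"
      by (simp only: distrib_left)
    moreover have "l ?z * (4 * (norm w - norm v)) \<le> 1/8 * (4 * (norm w - norm v))"
      by (rule mult_right_mono [OF l8 [OF z]]) (use that in simp)
    moreover have "x + A < y + B" if "A \<le> B + C" "C \<le> 1/8 * (4 * (y - x))" "x < y" for x y A B C :: real
      using that by argo
    ultimately show ?thesis unfolding m_def that(3) using that(4) by blast
  qed
  have g_norm: "norm (\<gamma> w) = m w" "sgn (\<gamma> w) = sgn w" if "w \<in> annulus" for w
  proof -
    have "m w > 0" using m_ge [OF that] that by simp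
    then show "norm (\<gamma> w) = m w" "sgn (\<gamma> w) = sgn w"
      using nsgn [OF that] sgn_scale [of "sgn w" "m w"] by (simp_all add: \<gamma>_def norm_mult)
  qed
  have g_inj: "inj_on \<gamma> annulus"
  proof (rule inj_onI)
    fix v w assume vw: "v \<in> annulus" "w \<in> annulus" "\<gamma> v = \<gamma> w"
    then have s: "sgn v = sgn w" "m v = m w" using g_norm by metis+
    then have "norm v = norm w"
      using m_mono [OF vw(1,2)] m_mono [OF vw(2,1)] by (metis linorder_neqE_linordered_idom order_less_irrefl)
    then show "v = w" using s polar_sgn by metis
  qed
  have g_ann: "\<gamma> w \<in> annulus" if "w \<in> annulus" for w
    using g_norm(1) [OF that] m_ge [OF that] that by simp
  \<comment> \<open>The level lies between 1 and 9/8 and the tent has half-width 1/4, whence the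
    radii 3/4 and 11/8.\<close>
  define C where "C = {w::complex. 3/4 \<le> norm w \<and> norm w \<le> 11/8 \<and> dist (sgn w) z0 \<le> \<delta>'}"
  have C: "compact C" "C \<subseteq> D"
    using compact_sector [of "3/4" "11/8"] l(5) by (auto simp: C_def D)
  have g_id: "\<gamma> w = w" if "w \<in> annulus" "w \<notin> C" for w
  proof -
    have z: "norm (sgn w) = 1" using nsgn that by blast
    have "l (sgn w) * max 0 (1 - 4 * \<bar>norm w - f (sgn w)\<bar>) = 0"
    proof (cases "dist (sgn w) z0 \<le> \<delta>'")
      case True
      then have "norm w < 3/4 \<or> norm w > 11/8" using that by (auto simp: C_def)
      moreover have "1 \<le> f (sgn w)" "f (sgn w) \<le> 9/8" using f(2) l(2,3) z by fastforce+
      ultimately have "1 - 4 * \<bar>norm w - f (sgn w)\<bar> \<le> 0" by (auto simp: abs_if)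
      then show ?thesis by simp
    qed (use l(4) z in auto)
    then have "\<gamma> w = of_real (norm w) * sgn w" unfolding \<gamma>_def m_def by (simp del: mult_eq_0_iff)
    then show ?thesis using polar_sgn by metis
  qed
  have sgn_c: "continuous_on annulus sgn"
    by (rule continuous_on_subset [OF continuous_on_sgn_complex]) auto
  have g_cont: "continuous_on annulus \<gamma>"
    unfolding \<gamma>_def m_def
    by (intro continuous_intros sgn_c continuous_on_compose2 [OF f(1) sgn_c] continuous_on_compose2 [OF l(1) sgn_c])
       (auto simp: norm_sgn)
  have Dann: "D \<subseteq> annulus" by (auto simp: D)
  have gD: "\<gamma> w \<in> D" if "w \<in> D" for w
    using that g_ann [of w] g_norm(2) [of w] by (auto simp: D)
  have openD: "open D" unfolding D by (rule open_sector)
  define \<beta> where "\<beta> = transplant D b \<gamma>"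
  have hom: "homeomorphic_map X X \<beta>"
    unfolding \<beta>_def
  \<comment> \<open>The planar isotopy is taken constant in time; only the homeomorphism is
    extracted.\<close>
  proof (rule transplant_isotopy(2) [OF openD b(1,2), of "\<lambda>_. \<gamma>" C 0])
    show "continuous_on ({0..1} \<times> D) (\<lambda>p. \<gamma> (snd p))"
      by (rule continuous_on_compose2 [OF g_cont]) (use Dann in \<open>auto intro: continuous_intros\<close>)
  qed (use gD g_inj Dann C g_id in \<open>auto intro: inj_on_subset\<close>)
  have be: "\<beta> (e w) = e (\<gamma> w)" if w: "w \<in> outer" for w
  proof (cases "w \<in> D")
    case True
    then have "\<beta> (b w) = b (\<gamma> w)" unfolding \<beta>_def by (rule transplant_image [OF b(2)])
    moreover have "\<gamma> w \<in> outer" using g_norm(1) [of w] m_ge [of w] w by auto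
    ultimately show ?thesis using b(3) gD True w by metis
  next
    case False
    have "e w \<notin> b ` C"
    proof
      assume "e w \<in> b ` C"
      then obtain v where v: "v \<in> D" "e w = b v" using C by blast
      show False
      proof (cases "norm v < 1")
        case True
        then show False using b(4) [OF v(1)] v(2) c(4) [OF w] interior_K_disjoint [OF i] by auto
      next
        case False
        then have "e w = e v" using b(3) [OF _ v(1)] v(2) by auto
        then have "w = v" using inj_onD [OF c(2)] w False by auto
        then show False using v \<open>w \<notin> D\<close> by simp
      qed
    qed
    then have "\<beta> (e w) = e w" unfolding \<beta>_def
      by (rule transplant_outside [OF b(2), rotated]) (use g_id Dann in blast)
    moreover have "\<gamma> w = w" using g_id [of w] w False C by auto
    ultimately show ?thesis by simp
  qed
  have bo: "\<beta> x = x" if "x \<notin> K \<union> e ` outer" for x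
  proof -
    have "x \<notin> b ` D"
    proof
      assume "x \<in> b ` D"
      then obtain v where v: "v \<in> D" "x = b v" by blast
      then have "x \<in> K \<or> x \<in> e ` outer"
        using b(3,4) [of v] interior_of_subset [of X K] by (cases "norm v < 1") force+
      then show False using that by blast
    qed
    then show ?thesis by (simp add: \<beta>_def transplant_def)
  qed
  show ?thesis
  proof (rule that [OF hom])
    fix z :: complex assume z: "norm z = 1"
    let ?w = "of_real (f z) * z"
    have w: "norm ?w = f z" "sgn ?w = z" using f(2) [OF z] z sgn_scale [OF z, of "f z"] by (auto simp: norm_mult)
    then have "m ?w = f z + l z" by (simp add: m_def)
    then show "\<beta> (e ?w) = e (of_real (f z + l z) * z)"
      using be [of ?w] w f(2) [OF z] by (simp add: \<gamma>_def)
  next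
    show "\<beta> ` beyond i e f \<subseteq> beyond i e (\<lambda>z. f z + l z)"
    proof clarify
      fix x assume "x \<in> beyond i e f"
      then consider "x \<in> topspace X - K - e ` outer" | w where "w \<in> outer" "f (sgn w) \<le> norm w" "x = e w"
        unfolding beyond_def by blast
      then show "\<beta> x \<in> beyond i e (\<lambda>z. f z + l z)"
      proof cases
        case 1
        then show ?thesis using bo [of x] by (simp add: beyond_def)
      next
        case 2
        have wa: "w \<in> annulus" using 2 by auto
        have z: "norm (sgn w) = 1" by (rule nsgn [OF wa])
        let ?v = "of_real (f (sgn w)) * sgn w"
        have v: "norm ?v = f (sgn w)" "sgn ?v = sgn w" using f(2) [OF z] z sgn_scale [OF z, of "f (sgn w)"]
          by (auto simp: norm_mult)
        then have va: "?v \<in> annulus" using f(2) [OF z] by auto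
        have mv: "m ?v = f (sgn w) + l (sgn w)" using v by (simp add: m_def)
        have "m ?v \<le> m w"
        proof (cases "norm w = f (sgn w)")
          case True
          then have "?v = w" using polar_sgn [of w] by simp
          then show ?thesis by simp
        next
          case False
          then show ?thesis using m_mono [OF va wa v(2)] v(1) 2(2) by simp
        qed
        then have "f (sgn (\<gamma> w)) + l (sgn (\<gamma> w)) \<le> norm (\<gamma> w)"
          using mv g_norm [OF wa] by simp
        moreover have "\<gamma> w \<in> outer" using g_norm(1) [OF wa] m_ge [OF wa] 2(1) by simp
        ultimately show ?thesis using be [OF 2(1)] 2(3) by (auto simp: beyond_def)
      qed
    qed
  qed
qed

text \<open>A partition of unity on the circle, scaled to total 1/8, splits the push into finitely
  many local ones, each supported in one bichart and starting from the level its predecessors have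
  reached.\<close>

lemma global_push:
  assumes i: "i \<in> {1..n}" and e: "collar i e"
  obtains g where "homeomorphic_map X X g"
    "\<And>z. norm z = 1 \<Longrightarrow> g (e z) = e (of_real (9/8) * z)"
    "g ` beyond i e (\<lambda>z. 1) \<subseteq> beyond i e (\<lambda>z. 9/8)"
proof -
  define ok where "ok z0 \<delta> b \<longleftrightarrow> \<delta> > 0 \<and> continuous_map (top_of_set {w \<in> annulus. dist (sgn w) z0 < \<delta>}) X b \<and>
    inj_on b {w \<in> annulus. dist (sgn w) z0 < \<delta>} \<and>
    (\<forall>w. w \<in> outer \<longrightarrow> dist (sgn w) z0 < \<delta> \<longrightarrow> b w = e w) \<and>
    (\<forall>w. w \<in> annulus \<longrightarrow> dist (sgn w) z0 < \<delta> \<longrightarrow> norm w < 1 \<longrightarrow> b w \<in> X interior_of K)" for z0 :: complex and \<delta> b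
  have "\<exists>\<delta> b. ok z0 \<delta> b" if "norm z0 = 1" for z0
    by (rule bichart [OF i e that]) (unfold ok_def, blast)
  then obtain \<delta> b where ok: "\<And>z0. norm z0 = 1 \<Longrightarrow> ok z0 (\<delta> z0) (b z0)" by metis
  have d0: "\<delta> z0 > 0" if "norm z0 = 1" for z0 using ok [OF that] by (simp add: ok_def)
  \<comment> \<open>Half radii: a bump function vanishing beyond \<open>\<delta> z / 2\<close> has
    its support in a compact part of the open sector of radius \<open>\<delta> z\<close>.\<close>
  have "sphere 0 1 \<subseteq> (\<Union>z\<in>sphere 0 1. ball z (\<delta> z / 2))" using d0 by auto
  then obtain Z where Z: "Z \<subseteq> sphere (0::complex) 1" "finite Z" "sphere 0 1 \<subseteq> (\<Union>z\<in>Z. ball z (\<delta> z / 2))"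
    using compactE_image [OF compact_sphere, of "sphere 0 1" "\<lambda>z. ball z (\<delta> z / 2)" 0 1] by (metis open_ball)
  define l0 where "l0 z0 z = max 0 (\<delta> z0 / 2 - dist z z0)" for z0 z :: complex
  define s where "s z = (\<Sum>z0\<in>Z. l0 z0 z)" for z
  have spos: "s z > 0" if "norm z = 1" for z
  proof -
    obtain z0 where "z0 \<in> Z" "z \<in> ball z0 (\<delta> z0 / 2)" using Z(3) \<open>norm z = 1\<close> mem_sphere_0 by blast
    then show ?thesis unfolding s_def
      by (intro sum_pos2 [OF Z(2), of z0]) (auto simp: l0_def dist_commute)
  qed
  \<comment> \<open>Dividing by \<open>8 * s z\<close> makes the bumps add up to 1/8 everywhere on
    the circle, so the final level is 9/8.\<close>
  define l where "l z0 z = l0 z0 z / (8 * s z)" for z0 z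
  have l0c: "continuous_on (sphere 0 1) (l0 z0)" for z0 unfolding l0_def by (intro continuous_intros)
  have sc: "continuous_on (sphere 0 1) s" unfolding s_def by (intro continuous_intros l0c)
  have lc: "continuous_on (sphere 0 1) (l z0)" for z0
    unfolding l_def by (intro continuous_intros l0c sc) (use spos in fastforce)
  have l_nonneg: "0 \<le> l z0 z" if "norm z = 1" for z0 z
    using spos [OF that] by (simp add: l_def l0_def)
  have suml: "(\<Sum>z0\<in>Z. l z0 z) = 1/8" if "norm z = 1" for z
    using spos [OF that] by (simp add: l_def s_def sum_divide_distrib [symmetric])
  have "\<exists>g. homeomorphic_map X X g \<and> (\<forall>z. norm z = 1 \<longrightarrow> g (e z) = e (of_real (1 + (\<Sum>z0\<in>A. l z0 z)) * z)) \<and>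
     g ` beyond i e (\<lambda>z. 1) \<subseteq> beyond i e (\<lambda>z. 1 + (\<Sum>z0\<in>A. l z0 z))" if "finite A" "A \<subseteq> Z" for A
    using that
  proof (induction A rule: finite_induct)
    case empty
    have "homeomorphic_map X X (\<lambda>x. x)" using homeomorphic_map_id [of X X] by (simp add: id_def)
    then show ?case by (intro exI [of _ "\<lambda>x. x"]) auto
  next
    case (insert a A)
    then obtain g where g: "homeomorphic_map X X g"
      "\<And>z. norm z = 1 \<Longrightarrow> g (e z) = e (of_real (1 + (\<Sum>z0\<in>A. l z0 z)) * z)"
      "g ` beyond i e (\<lambda>z. 1) \<subseteq> beyond i e (\<lambda>z. 1 + (\<Sum>z0\<in>A. l z0 z))" by auto
    define f where "f z = 1 + (\<Sum>z0\<in>A. l z0 z)" for z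
    have a: "norm a = 1" using insert Z by auto
    note oka = ok [OF a, unfolded ok_def]
    have fl: "f z + l a z = 1 + (\<Sum>z0\<in>insert a A. l z0 z)" for z
      using insert by (simp add: f_def)
    obtain \<beta> where \<beta>: "homeomorphic_map X X \<beta>"
      "\<And>z. norm z = 1 \<Longrightarrow> \<beta> (e (of_real (f z) * z)) = e (of_real (f z + l a z) * z)"
      "\<beta> ` beyond i e f \<subseteq> beyond i e (\<lambda>z. f z + l a z)"
    proof (rule local_push [OF i e refl, of a "\<delta> a" "b a" f "l a" "\<delta> a / 2"])
      show "continuous_on (sphere 0 1) f" unfolding f_def by (intro continuous_intros lc)
      show "1 \<le> f z" if "norm z = 1" for z using l_nonneg [OF that] by (simp add: f_def sum_nonneg)
      show "f z + l a z \<le> 9/8" if "norm z = 1" for z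
      proof -
        have "(\<Sum>z0\<in>insert a A. l z0 z) \<le> (\<Sum>z0\<in>Z. l z0 z)"
          by (rule sum_mono2) (use insert.prems Z(2) l_nonneg [OF that] in auto)
        then show ?thesis unfolding fl using suml [OF that] by simp
      qed
      show "l a z = 0" if "norm z = 1" "\<delta> a / 2 < dist z a" for z using that by (simp add: l_def l0_def)
      show "\<delta> a / 2 < \<delta> a" using d0 [OF a] by simp
    qed (use oka lc l_nonneg in blast)+
    show ?case
    proof (intro exI conjI allI impI)
      show "homeomorphic_map X X (\<beta> \<circ> g)" using g(1) \<beta>(1) homeomorphic_map_compose by blast
      show "(\<beta> \<circ> g) (e z) = e (of_real (1 + (\<Sum>z0\<in>insert a A. l z0 z)) * z)" if "norm z = 1" for z
        using g(2) [OF that] \<beta>(2) [OF that] unfolding fl by (simp add: f_def)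
      have "g ` beyond i e (\<lambda>z. 1) \<subseteq> beyond i e f" using g(3) by (simp add: f_def [abs_def])
      then have "(\<beta> \<circ> g) ` beyond i e (\<lambda>z. 1) \<subseteq> \<beta> ` beyond i e f" by auto
      also have "\<dots> \<subseteq> beyond i e (\<lambda>z. f z + l a z)" by (rule \<beta>(3))
      finally show "(\<beta> \<circ> g) ` beyond i e (\<lambda>z. 1) \<subseteq> beyond i e (\<lambda>z. 1 + (\<Sum>z0\<in>insert a A. l z0 z))"
        unfolding fl .
    qed
  qed
  from this [OF Z(2)] obtain g where g: "homeomorphic_map X X g"
    "\<And>z. norm z = 1 \<Longrightarrow> g (e z) = e (of_real (1 + (\<Sum>z0\<in>Z. l z0 z)) * z)"
    "g ` beyond i e (\<lambda>z. 1) \<subseteq> beyond i e (\<lambda>z. 1 + (\<Sum>z0\<in>Z. l z0 z))" by auto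
  show ?thesis
  proof (rule that [OF g(1)])
    show "g (e z) = e (of_real (9/8) * z)" if "norm z = 1" for z
      using g(2) [OF that] suml [OF that] by simp
    \<comment> \<open>The two level functions agree only on the unit circle, but
      \<open>beyond\<close> evaluates them at \<open>sgn w\<close> only.\<close>
    have "beyond i e (\<lambda>z. 1 + (\<Sum>z0\<in>Z. l z0 z)) = beyond i e (\<lambda>z. 9/8)"
    proof -
      have eq: "1 + (\<Sum>z0\<in>Z. l z0 (sgn w)) = 9/8" if "w \<in> outer" for w
      proof -
        have "norm (sgn w) = 1" using that by (auto simp: norm_sgn)
        then show ?thesis using suml by simp
      qed
      then have "{w \<in> outer. 1 + (\<Sum>z0\<in>Z. l z0 (sgn w)) \<le> norm w} = {w \<in> outer. 9/8 \<le> norm w}"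
        by (intro Collect_cong conj_cong refl) (simp only: eq)
      then show ?thesis by (simp add: beyond_def)
    qed
    then show "g ` beyond i e (\<lambda>z. 1) \<subseteq> beyond i e (\<lambda>z. 9/8)" using g(3) by simp
  qed
qed

text \<open>Pulling back the part of the collar below level 9/8 by the push gives a collar on the side of K.\<close>
lemma bicollar_exists:
  assumes i: "i \<in> {1..n}" and e: "collar i e"
  obtains e' where "bicollar i e'" "\<And>w. w \<in> outer \<Longrightarrow> e' w = e w"
proof -
  note c = collar_facts [OF i e]
  obtain g where g: "homeomorphic_map X X g"
    "\<And>z. norm z = 1 \<Longrightarrow> g (e z) = e (of_real (9/8) * z)"
    "g ` beyond i e (\<lambda>z. 1) \<subseteq> beyond i e (\<lambda>z. 9/8)"
    using global_push [OF i e] by metis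
  obtain g' where g': "homeomorphic_maps X X g g'" using g(1) homeomorphic_map_maps by blast
  then have g'c: "continuous_map X X g'" and g'g: "\<And>x. x \<in> topspace X \<Longrightarrow> g' (g x) = x"
    and gg': "\<And>x. x \<in> topspace X \<Longrightarrow> g (g' x) = x"
    by (auto simp: homeomorphic_maps_def)
  have eX: "e w \<in> topspace X" if "w \<in> outer" for w using c(4) [OF that] P_subset [OF i] by blast
  \<comment> \<open>Slope 1/4 maps the radii between 1/2 and 1 onto those between 1 and 9/8: exactly
    the band of the collar that the inverse \<open>g'\<close> of the push brings back to the side of
    \<open>K\<close>. Radius 1 goes to 9/8, so that \<open>g'\<close> returns it to the boundary
    circle.\<close>
  define \<kappa> where "\<kappa> w = of_real (9/8 + (norm w - 1)/4) * sgn w" for w :: complex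
  have \<kappa>: "norm (\<kappa> w) = 9/8 + (norm w - 1)/4" "sgn (\<kappa> w) = sgn w" "\<kappa> w \<in> outer" if "w \<in> annulus" for w
  proof -
    have "norm (sgn w) = 1" using that by (auto simp: norm_sgn)
    moreover have pos: "9/8 + (norm w - 1)/4 \<ge> 1"
    proof -
      have "1/2 < norm w" using that by blast
      then show ?thesis by argo
    qed
    ultimately show 1: "norm (\<kappa> w) = 9/8 + (norm w - 1)/4" "sgn (\<kappa> w) = sgn w"
      unfolding \<kappa>_def using sgn_scale [of "sgn w" "9/8 + (norm w - 1)/4"] by (simp_all add: norm_mult del: of_real_add of_real_divide of_real_diff)
    then show "\<kappa> w \<in> outer" using pos by simp
  qed
  define e' where "e' w = (if 1 \<le> norm w then e w else g' (e (\<kappa> w)))" for w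
  have at1: "g' (e (\<kappa> w)) = e w" if "norm w = 1" for w
  proof -
    have "\<kappa> w = of_real (9/8) * w" using that by (simp add: \<kappa>_def sgn_div_norm)
    then have "e (\<kappa> w) = g (e w)" using g(2) [OF that] by (simp only:)
    then show ?thesis using g'g [OF eX, of w] that by simp
  qed
  have inK: "e' w \<in> K" "e' w \<notin> e ` outer" if w: "w \<in> annulus" "norm w < 1" for w
  proof -
    let ?x = "e (\<kappa> w)"
    have xX: "?x \<in> topspace X" using eX \<kappa>(3) w by blast
    have yX: "g' ?x \<in> topspace X" using xX g'c by (simp add: continuous_map_def Pi_iff)
    \<comment> \<open>Otherwise \<open>g\<close> would carry the point past level 9/8, but
      \<open>\<kappa> w\<close> has norm below 9/8. What is not past level 1 lies in
      \<open>K\<close> and off the collar.\<close>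
    have "g' ?x \<notin> beyond i e (\<lambda>z. 1)"
    proof
      assume "g' ?x \<in> beyond i e (\<lambda>z. 1)"
      then have "?x \<in> beyond i e (\<lambda>z. 9/8)" using g(3) gg' [OF xX] by (metis image_subset_iff)
      then obtain v where v: "v \<in> outer" "9/8 \<le> norm v" "?x = e v"
        using \<kappa>(3) [OF w(1)] by (auto simp: beyond_def)
      then have "\<kappa> w = v" using inj_onD [OF c(2)] \<kappa>(3) [OF w(1)] by blast
      then show False using v(2) \<kappa>(1) [OF w(1)] w(2) by simp
    qed
    then have "g' ?x \<in> K" "g' ?x \<notin> e ` outer" using yX by (auto simp: beyond_def)
    then show "e' w \<in> K" "e' w \<notin> e ` outer" using w by (simp_all add: e'_def)
  qed
  have inj: "inj_on e' annulus"
  proof (rule inj_onI)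
    fix v w assume vw: "v \<in> annulus" "w \<in> annulus" "e' v = e' w"
    have iff: "norm v < 1 \<longleftrightarrow> e' v \<notin> e ` outer" if "v \<in> annulus" for v
      using inK(2) [OF that] by (auto simp: e'_def)
    show "v = w"
    proof (cases "norm v < 1")
      case True
      then have w1: "norm w < 1" using iff vw by metis
      then have "g' (e (\<kappa> v)) = g' (e (\<kappa> w))" using vw(3) True by (simp add: e'_def)
      then have "e (\<kappa> v) = e (\<kappa> w)" using gg' eX \<kappa>(3) vw by metis
      then have "\<kappa> v = \<kappa> w" using inj_onD [OF c(2)] \<kappa>(3) vw by blast
      then have "norm v = norm w" "sgn v = sgn w" using \<kappa>(1,2) [OF vw(1)] \<kappa>(1,2) [OF vw(2)] by auto
      then show ?thesis using polar_sgn by metis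
    next
      case False
      then have "\<not> norm w < 1" using iff vw by metis
      then show ?thesis using False vw(3) inj_onD [OF c(2), of v w] by (simp add: e'_def)
    qed
  qed
  have cont: "continuous_map (top_of_set annulus) X e'"
  proof (rule pasting_lemma_closed [where I = UNIV])
    let ?T = "\<lambda>i. {w \<in> annulus. if i then norm w \<le> 1 else 1 \<le> norm w}"
    let ?f = "\<lambda>i w. if i then g' (e (\<kappa> w)) else e w"
    show "closedin (top_of_set annulus) (?T i)" for i
    proof -
      have "closed {w::complex. if i then norm w \<le> 1 else 1 \<le> norm w}"
        by (cases i) (auto intro!: closed_Collect_le continuous_intros)
      then have "closedin (top_of_set annulus) (annulus \<inter> {w. if i then norm w \<le> 1 else 1 \<le> norm w})"
        by (rule closedin_closed_Int)
      moreover have "annulus \<inter> {w. if i then norm w \<le> 1 else 1 \<le> norm w} = ?T i" by auto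
      ultimately show ?thesis by simp
    qed
    have sub: "subtopology (top_of_set annulus) (?T i) = top_of_set (?T i)" for i
      unfolding subtopology_subtopology by (rule arg_cong [where f = top_of_set]) auto
    have "continuous_on annulus \<kappa>"
      unfolding \<kappa>_def
      by (intro continuous_intros continuous_on_subset [OF continuous_on_sgn_complex]) auto
    then have "continuous_map (top_of_set (?T True)) (top_of_set outer) \<kappa>"
      using \<kappa>(3) by (auto simp: continuous_map_in_subtopology intro: continuous_on_subset)
    from continuous_map_compose [OF continuous_map_compose [OF this c(1)] g'c]
    have D1: "continuous_map (top_of_set (?T True)) X (\<lambda>w. g' (e (\<kappa> w)))" by (simp add: o_def)
    have D2: "continuous_map (top_of_set (?T False)) X e"
      by (rule continuous_map_from_subtopology_mono [OF c(1)]) auto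
    show "continuous_map (subtopology (top_of_set annulus) (?T i)) X (?f i)" for i
      unfolding sub using D1 D2 by (cases i) auto
    fix i j x assume "x \<in> topspace (top_of_set annulus) \<inter> ?T i \<inter> ?T j"
    then show "?f i x = ?f j x" using at1 [of x] by (cases i; cases j) auto
  next
    let ?T = "\<lambda>i. {w \<in> annulus. if i then norm w \<le> 1 else 1 \<le> norm w}"
    let ?f = "\<lambda>i w. if i then g' (e (\<kappa> w)) else e w"
    fix x assume "x \<in> topspace (top_of_set annulus)"
    then show "\<exists>j. j \<in> UNIV \<and> x \<in> ?T j \<and> e' x = ?f j x"
      by (intro exI [of _ "norm x < 1"]) (auto simp: e'_def)
  qed auto
  have eq: "e' w = e w" if "w \<in> outer" for w using that by (simp add: e'_def)
  have img: "e' ` outer = e ` outer" "e' ` sphere 0 1 = e ` sphere 0 1"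
    by (auto simp: e'_def image_iff)
  have "collar i e'"
    using e unfolding collar_def img
    by (metis (no_types, lifting) eq homeomorphic_map_eq topspace_euclidean_subtopology)
  moreover have "e' w \<in> X interior_of K" if w: "w \<in> annulus" "norm w < 1" for w
  proof -
    let ?D = "annulus \<inter> {w. norm w < 1}"
    have "openin X (e' ` ?D)"
    proof (rule openin_planar_image)
      show "open ?D" by (intro open_Int open_annulus open_Collect_less continuous_intros)
    qed (auto intro: continuous_map_from_subtopology_mono [OF cont] inj_on_subset [OF inj])
    moreover have "e' ` ?D \<subseteq> K" using inK(1) by auto
    ultimately show ?thesis using w by (auto simp: interior_of_def)
  qed
  ultimately have "bicollar i e'" using cont inj by (simp add: bicollar_def)
  then show ?thesis using that eq by blast
qed

end

section \<open>Circle homeomorphisms\<close>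

lemma cis_eq_iff: "cis x = cis y \<longleftrightarrow> (\<exists>m::int. x = y + 2 * pi * m)"
  using sin_cos_eq_iff [of x y] by (auto simp: complex_eq_iff)

lemma continuous_inj_real_cases:
  fixes F :: "real \<Rightarrow> real"
  assumes "continuous_on UNIV F" "inj F"
  obtains "\<And>x y. x < y \<Longrightarrow> F x < F y" | "\<And>x y. x < y \<Longrightarrow> F y < F x"
proof -
  have mono: "F u < F v \<longleftrightarrow> F a < F b" if "a < u" "u < v" "v < b" for a u v b
  proof -
    have *: "F p < F q \<and> F q < F r \<or> F r < F q \<and> F q < F p" if "p < q" "q < r" for p q r
      using continuous_inj_imp_mono [OF that] assms by (metis continuous_on_subset inj_on_subset subset_UNIV)
    show ?thesis using *[of a u v] *[of u v b] that by linarith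
  qed
  have iff: "F x < F y \<longleftrightarrow> F 0 < F 1" if "x < y" for x y
    \<comment> \<open>Both pairs \<open>x < y\<close> and \<open>0 < 1\<close> sit strictly inside
      one interval, so each is compared with the same outer pair.\<close>
    using mono [of "min x 0 - 1" x y "max y 1 + 1"] mono [of "min x 0 - 1" 0 1 "max y 1 + 1"] that by auto
  have ne: "F x \<noteq> F y" if "x < y" for x y using that assms(2) by (auto dest: injD)
  show ?thesis
  proof (cases "F 0 < F 1")
    case True
    then show ?thesis using that(1) iff by blast
  next
    case False
    then have "F y < F x" if "x < y" for x y using iff [OF that] ne [OF that] by linarith
    then show ?thesis using that(2) by blast
  qed
qed

text \<open>The line is contractible, so the composite with \<open>cis\<close> has a continuous
  logarithm, whose imaginary part is the lift. Of the decreasing case only the fixed point is kept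
  besides the lift, since that is where the contradiction will be drawn.\<close>

lemma circle_lift:
  fixes k :: "complex \<Rightarrow> complex"
  assumes k: "continuous_on (sphere 0 1) k" "k ` sphere 0 1 \<subseteq> sphere 0 1" "inj_on k (sphere 0 1)"
  obtains F :: "real \<Rightarrow> real" where "continuous_on UNIV F" "\<And>x. k (cis x) = cis (F x)"
    "\<And>x y. x < y \<Longrightarrow> F x < F y" "\<And>x. F (x + 2 * pi) = F x + 2 * pi"
  | F :: "real \<Rightarrow> real" and x where "continuous_on UNIV F" "\<And>x. k (cis x) = cis (F x)"
    "\<And>x y. x < y \<Longrightarrow> F y < F x" "F x = x"
proof -
  have kc: "k (cis x) \<in> sphere 0 1" for x
  proof -
    have "cis x \<in> sphere 0 1" by simp
    then show ?thesis using k(2) by blast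
  qed
  have "continuous_on UNIV (\<lambda>x. k (cis x))"
    by (rule continuous_on_compose2 [OF k(1)]) (auto intro!: continuous_intros)
  then obtain g where g: "continuous_on UNIV g" "\<And>x::real. k (cis x) = exp (g x)"
    using continuous_logarithm_on_contractible [of UNIV "\<lambda>x::real. k (cis x)"] kc
    by (metis (no_types, lifting) UNIV_I contractible_UNIV mem_sphere_0 norm_zero zero_neq_one)
  define F where "F x = Im (g x)" for x
  have Fc: "continuous_on UNIV F" unfolding F_def by (intro continuous_intros g(1))
  have kF: "k (cis x) = cis (F x)" for x
  proof -
    have "exp (Re (g x)) = 1" using kc [of x] g(2) [of x] by simp
    then show ?thesis using g(2) [of x] by (simp add: F_def exp_eq_polar)
  qed
  have Feq: "\<exists>m::int. x = y + 2 * pi * m" if "cis (F x) = cis (F y)" for x y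
  proof -
    have "k (cis x) = k (cis y)" using that kF by simp
    then have "cis x = cis y" using inj_onD [OF k(3)] by simp
    then show ?thesis using cis_eq_iff by simp
  qed
  \<comment> \<open>This is the degree: continuous and integer valued, hence constant.\<close>
  define D where "D x = (F (x + 2 * pi) - F x) / (2 * pi)" for x
  have Dint: "\<exists>m::int. D x = m" for x
  proof -
    have "cis (F (x + 2 * pi)) = cis (F x)" using kF [of x] kF [of "x + 2 * pi"] by (simp add: cis_mult [symmetric])
    then obtain m :: int where "F (x + 2 * pi) = F x + 2 * pi * m" using cis_eq_iff by blast
    then show ?thesis by (auto simp: D_def)
  qed
  have "D constant_on UNIV"
  proof (rule continuous_discrete_range_constant [OF connected_UNIV])
    show "continuous_on UNIV D" unfolding D_def
      by (intro continuous_intros continuous_on_compose2 [OF Fc]) auto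
    show "\<exists>e>0. \<forall>y. y \<in> UNIV \<and> D y \<noteq> D x \<longrightarrow> e \<le> norm (D y - D x)" for x
    proof (intro exI [of _ 1] conjI allI impI)
      fix y assume "y \<in> UNIV \<and> D y \<noteq> D x"
      moreover obtain m l :: int where "D y = m" "D x = l" using Dint by metis
      ultimately show "1 \<le> norm (D y - D x)" by (simp flip: of_int_diff of_int_abs)
    qed auto
  qed
  then obtain c where c: "\<And>x. D x = c" by (auto simp: constant_on_def)
  moreover obtain d :: int where "D 0 = d" using Dint [of 0] by blast
  ultimately have "D x = d" for x by metis
  then have d: "F (x + 2 * pi) = F x + 2 * pi * d" for x
    by (simp add: D_def field_simps)
  have dn: "F (x + 2 * pi * real m) = F x + 2 * pi * d * m" for x and m :: nat
  proof (induction m)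
    case (Suc m)
    then show ?case using d [of "x + 2 * pi * real m"] by (simp add: algebra_simps)
  qed simp
  have dm: "F (x + 2 * pi * m) = F x + 2 * pi * d * m" for x and m :: int
  proof (cases "m \<ge> 0")
    case True
    then show ?thesis using dn [of x "nat m"] by simp
  next
    case False
    then show ?thesis using dn [of "x + 2 * pi * m" "nat (- m)"] by (simp add: algebra_simps)
  qed
  have d0: "d \<noteq> 0"
  proof
    assume "d = 0"
    then have per: "F (2 * pi) = F 0" using d [of 0] by simp
    have noteq: "F x \<noteq> F y" if "0 \<le> x" "x < y" "y < 2 * pi" for x y
    proof
      assume "F x = F y"
      then obtain m :: int where m: "y = x + 2 * pi * m" using Feq [of y x] by auto
      have "0 < 2 * pi * m" "2 * pi * m < 2 * pi * 1" using m that by linarith+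
      then have "(0::real) < m" "real_of_int m < 1" by (simp_all add: zero_less_mult_iff)
      then show False by auto
    qed
    \<comment> \<open>In degree 0 the lift goes from \<open>F 0\<close> to \<open>F pi\<close> and
      back within one period, so the midway value is taken on both halves, against injectivity on
      the circle.\<close>
    define v where "v = (F 0 + F pi) / 2"
    have cont: "continuous_on S F" for S using Fc continuous_on_subset by blast
    have ne0: "F 0 \<noteq> F pi" by (rule noteq) auto
    have "\<exists>x y. 0 \<le> x \<and> x \<le> pi \<and> F x = v \<and> pi \<le> y \<and> y \<le> 2 * pi \<and> F y = v"
    proof (cases "F 0 \<le> F pi")
      case True
      then have "F 0 \<le> v" "v \<le> F pi" "F (2 * pi) \<le> v" using per by (auto simp: v_def)
      then show ?thesis
        using IVT' [of F 0 v pi] IVT2' [of F "2 * pi" v pi] cont pi_ge_zero by (metis mult_2 le_add_same_cancel1)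
    next
      case False
      then have "v \<le> F 0" "F pi \<le> v" "v \<le> F (2 * pi)" using per by (auto simp: v_def)
      then show ?thesis
        using IVT2' [of F pi v 0] IVT' [of F pi v "2 * pi"] cont pi_ge_zero by (metis mult_2 le_add_same_cancel1)
    qed
    then obtain x y where xy: "0 \<le> x" "x \<le> pi" "F x = v" "pi \<le> y" "y \<le> 2 * pi" "F y = v" by blast
    have vne: "v \<noteq> F 0" "v \<noteq> F pi" using ne0 by (auto simp: v_def field_simps)
    then have "x < y" "y < 2 * pi" using xy per by (metis order_le_less le_less_trans, metis order_le_less)
    then show False using noteq xy by metis
  qed
  have inj: "inj F"
  proof (rule injI)
    fix x y assume eq: "F x = F y"
    then obtain m :: int where m: "x = y + 2 * pi * m" using Feq [of x y] by auto
    then have "2 * pi * d * m = 0" using dm [of y m] eq by simp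
    then have "m = 0" using d0 by simp
    then show "x = y" using m by simp
  qed
  show ?thesis
  proof (rule continuous_inj_real_cases [OF Fc inj])
    assume mono: "\<And>x y. x < y \<Longrightarrow> F x < F y"
    have "F 0 < F (0 + 2 * pi)" by (rule mono) simp
    then have "0 < d" unfolding d by (simp add: zero_less_mult_iff)
    \<comment> \<open>With larger degree the value \<open>F 0 + 2 * pi\<close> is already taken
      strictly inside the period, where injectivity of \<open>k\<close> forbids it.\<close>
    have "d = 1"
    proof (rule ccontr)
      assume "d \<noteq> 1"
      then have "d \<ge> 2" using \<open>0 < d\<close> by simp
      then have "2 * pi * 2 \<le> 2 * pi * real_of_int d" by (intro mult_left_mono) auto
      then have "F 0 + 2 * pi < F (2 * pi)" using d [of 0] pi_gt_zero by simp
      then obtain x where x: "0 \<le> x" "x \<le> 2 * pi" "F x = F 0 + 2 * pi"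
        using IVT' [of F 0 "F 0 + 2 * pi" "2 * pi"] Fc continuous_on_subset pi_ge_zero
        by (smt (verit, best) subset_UNIV)
      then have "cis (F x) = cis (F 0)" by (simp add: cis_mult [symmetric])
      then obtain m :: int where m: "x = 2 * pi * m" using Feq [of x 0] by auto
      then have "0 \<le> m" "2 * pi * m \<le> 2 * pi * 1" using x pi_gt_zero by (auto simp: zero_le_mult_iff)
      then have "m = 0 \<or> m = 1" by auto
      then show False
      proof
        assume "m = 0" then show False using m x by simp
      next
        assume "m = 1" then show False using m x \<open>F 0 + 2 * pi < F (2 * pi)\<close> by simp
      qed
    qed
    then show ?thesis using that(1) [OF Fc kF mono] d by simp
  next
    assume anti: "\<And>x y. x < y \<Longrightarrow> F y < F x"
    \<comment> \<open>A decreasing \<open>F\<close> sends 0 to \<open>y\<close> and \<open>y\<close>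
      to the other side of the diagonal, so \<open>F x - x\<close> changes sign between 0 and
      \<open>y\<close>.\<close>
    define y where "y = F 0"
    have cont: "continuous_on S (\<lambda>x. F x - x)" for S
      by (intro continuous_intros continuous_on_subset [OF Fc]) auto
    have "\<exists>x. F x - x = 0"
    proof (cases "0 \<le> y")
      case True
      then have "F y \<le> y" using anti [of 0 y] by (cases "y = 0") (auto simp: y_def)
      then show ?thesis
        using IVT2' [of "\<lambda>x. F x - x" y 0 0] cont True by (auto simp: y_def)
    next
      case False
      then have "y \<le> F y" using anti [of y 0] by (simp add: y_def)
      then show ?thesis
        using IVT2' [of "\<lambda>x. F x - x" 0 0 y] cont False by (auto simp: y_def)
    qed
    then show ?thesis using that(2) [OF Fc kF anti] by auto
  qed
qed

text \<open>The displacement is periodic and descends along \<open>cis\<close>, which is a quotient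
  map from one closed period onto the circle by compactness. As a function on the circle it can
  serve as rotation angle in \<open>twist\<close>.\<close>

lemma circle_displacement:
  fixes F :: "real \<Rightarrow> real"
  assumes F: "continuous_on UNIV F" "\<And>x. F (x + 2 * pi) = F x + 2 * pi"
  obtains G where "continuous_on (sphere 0 1) G" "\<And>x. G (cis x) = F x - x"
proof -
  have n: "F (x + 2 * pi * real m) = F x + 2 * pi * m" for x and m :: nat
  proof (induction m)
    case (Suc m)
    then show ?case using F(2) [of "x + 2 * pi * real m"] by (simp add: algebra_simps)
  qed simp
  have per: "F (x + 2 * pi * m) = F x + 2 * pi * m" for x and m :: int
  proof (cases "m \<ge> 0")
    case True
    then show ?thesis using n [of x "nat m"] by simp
  next
    case False
    then show ?thesis using n [of "x + 2 * pi * m" "nat (- m)"] by (simp add: algebra_simps)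
  qed
  define G where "G z = F (Arg2pi z) - Arg2pi z" for z
  have G: "G (cis x) = F x - x" for x
  proof -
    have "cis (Arg2pi (cis x)) = cis x" using Arg2pi_eq [of "cis x"] by (simp add: cis_conv_exp)
    then obtain m :: int where "Arg2pi (cis x) = x + 2 * pi * m" using cis_eq_iff by blast
    then show ?thesis using per [of x m] by (simp add: G_def)
  qed
  have "quotient_map (top_of_set {0..2*pi}) (top_of_set (sphere 0 1)) cis"
  proof (rule continuous_imp_quotient_map)
    show "continuous_map (top_of_set {0..2*pi}) (top_of_set (sphere 0 1)) cis"
      by (auto simp: continuous_map_in_subtopology intro!: continuous_intros)
    have "z \<in> cis ` {0..2*pi}" if "norm z = 1" for z
      using that Arg2pi_eq [of z] Arg2pi_ge_0 [of z] Arg2pi_lt_2pi [of z]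
      by (intro image_eqI [of _ _ "Arg2pi z"]) (auto simp: cis_conv_exp)
    then show "cis ` topspace (top_of_set {0..2*pi}) = topspace (top_of_set (sphere 0 1))" by auto
  qed (auto simp: compact_space_subtopology Hausdorff_space_subtopology)
  moreover have "continuous_map (top_of_set {0..2*pi}) euclideanreal (G \<circ> cis)"
  proof -
    have "continuous_on {0..2*pi} (\<lambda>x. F x - x)"
      by (intro continuous_intros continuous_on_subset [OF F(1)]) auto
    then show ?thesis using G by (simp add: o_def)
  qed
  ultimately have "continuous_map (top_of_set (sphere 0 1)) euclideanreal G"
    by (rule continuous_compose_quotient_map)
  then show ?thesis using G that by simp
qed

text \<open>In suitable coordinates the map is homotopic to complex conjugation, which negates winding numbers.\<close>
lemma not_orient_pres_at_reflection:
  fixes f a r :: "complex \<Rightarrow> complex"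
  assumes f: "continuous_on S f" "inj_on f S" "open S" "p \<in> S" "f p = p"
    and a: "continuous_on (ball 0 \<rho>) a" "inj_on a (ball 0 \<rho>)" "a 0 = p"
    and r: "0 < \<rho>'" "\<rho>' \<le> \<rho>" "continuous_on (ball 0 \<rho>') r" "\<And>\<zeta>. \<zeta> \<in> ball 0 \<rho>' \<Longrightarrow> r \<zeta> \<in> ball 0 \<rho>"
    and aS: "a ` ball 0 \<rho>' \<subseteq> S" and ar: "\<And>\<zeta>. \<zeta> \<in> ball 0 \<rho>' \<Longrightarrow> f (a \<zeta>) = a (r \<zeta>)"
    and seg: "\<And>\<zeta>. \<zeta> \<in> ball 0 \<rho>' - {0} \<Longrightarrow> 0 \<notin> closed_segment (r \<zeta>) (cnj \<zeta>)"
  shows "\<not> orient_pres_at S f p"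
proof
  assume op: "orient_pres_at S f p"
  have sub: "ball (0::complex) \<rho>' \<subseteq> ball 0 \<rho>" using r(2) by auto
  have opA: "open (a ` ball 0 \<rho>')"
    by (rule invariance_of_domain) (use a sub continuous_on_subset inj_on_subset in \<open>blast+\<close>)
  have opB: "open (a ` ball 0 \<rho>)"
    by (rule invariance_of_domain) (use a in auto)
  define a' where "a' = inv_into (ball 0 \<rho>) a"
  have a'a: "a' (a z) = z" if "z \<in> ball 0 \<rho>" for z using a(2) that by (simp add: a'_def)
  have a'c: "continuous_on (a ` ball 0 \<rho>) a'"
  proof -
    obtain g where g: "homeomorphism (ball 0 \<rho>) (a ` ball 0 \<rho>) a g"
      using invariance_of_domain_homeomorphism [OF open_ball a(1) _ a(2)] by auto
    show ?thesis
      by (rule continuous_on_eq [OF homeomorphism_cont2 [OF g]])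
         (use a'a homeomorphism_apply1 [OF g] in auto)
  qed
  have pA: "p \<in> a ` ball 0 \<rho>'" using a(3) r(1) by (intro image_eqI [of _ _ 0]) auto
  obtain s where s: "s > 0" "ball p s \<subseteq> a ` ball 0 \<rho>'" using opA pA open_contains_ball by blast
  then have s': "ball p s \<subseteq> a ` ball 0 \<rho>" using sub by blast
  have a'cs: "continuous_on (ball p s) a'" using a'c s' continuous_on_subset by blast
  have a'is: "inj_on a' (ball p s)"
  proof (rule inj_onI)
    fix x y assume "x \<in> ball p s" "y \<in> ball p s" and eq: "a' x = a' y"
    then obtain u v where "u \<in> ball 0 \<rho>" "v \<in> ball 0 \<rho>" "x = a u" "y = a v" using s' by blast
    then show "x = y" using eq a'a by metis
  qed
  have a'p: "a' p = 0" using a'a [of 0] a(3) r(1,2) by simp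
  define S' where "S' = S \<inter> ball p s"
  have S': "open S'" "p \<in> S'" using f s(1) by (auto simp: S'_def)
  have fS': "continuous_on S' f" "inj_on f S'"
    using f by (auto simp: S'_def intro: continuous_on_subset inj_on_subset)
  have op': "orient_pres_at S' f p"
    by (rule orient_pres_at_subset [OF f(1,2) op S']) (auto simp: S'_def)
  obtain t where t: "t > 0" "cball p t \<subseteq> S'"
    "\<And>c. 0 < c \<Longrightarrow> c < s \<Longrightarrow> homotopic_loops (ball 0 s - {0})
       (\<lambda>x. f (p + of_real t * cis (2 * pi * x)) - p) (\<lambda>x. of_real c * cis (2 * pi * x))"
    using small_circle [OF fS' S' op' s(1)] f(5) by metis
  have tb: "cball p t \<subseteq> ball p s" using t(2) by (auto simp: S'_def)
  define q where "q x = p + of_real t * cis (2 * pi * x)" for x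
  have q: "q x \<in> cball p t" for x using t(1) by (auto simp: q_def dist_norm norm_mult)
  have qne: "q x \<noteq> p" for x using t(1) by (simp add: q_def cis_neq_zero)
  define \<gamma> where "\<gamma> x = a' (q x)" for x
  have \<gamma>: "\<gamma> x \<in> ball 0 \<rho>'" "a (\<gamma> x) = q x" for x
  proof -
    have "q x \<in> a ` ball 0 \<rho>'" using q tb s(2) by blast
    then obtain z where z: "z \<in> ball 0 \<rho>'" "q x = a z" by blast
    then show "\<gamma> x \<in> ball 0 \<rho>'" "a (\<gamma> x) = q x" using a'a sub by (auto simp: \<gamma>_def subset_iff)
  qed
  have \<gamma>ne: "\<gamma> x \<noteq> 0" for x using \<gamma>(2) [of x] qne [of x] a(3) by auto
  have ts: "t < s" using tb t(1) by (simp add: cball_subset_ball_iff)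
  \<comment> \<open>If \<open>f\<close> preserved orientation, it would send the small circle
    \<open>q\<close> to a loop homotopic to \<open>q\<close> near \<open>p\<close>; this is that
    homotopy read in the coordinate \<open>a\<close>.\<close>
  have hom1: "homotopic_loops (-{0}) (\<lambda>x. a' (f (q x))) \<gamma>"
    using homotopic_loops_image_punctured [OF t(3) [OF t(1) ts] a'cs a'is order_refl] a'p
    by (simp add: q_def \<gamma>_def [abs_def])
  have rg: "a' (f (q x)) = r (\<gamma> x)" for x
    using ar [OF \<gamma>(1) [of x]] \<gamma>(2) [of x] a'a r(4) [OF \<gamma>(1)] by simp
  have path: "path \<gamma>" "pathfinish \<gamma> = pathstart \<gamma>"
    using homotopic_loops_imp_path [OF hom1] homotopic_loops_imp_loop [OF hom1] by auto
  have path2: "path (\<lambda>x. r (\<gamma> x))" "pathfinish (\<lambda>x. r (\<gamma> x)) = pathstart (\<lambda>x. r (\<gamma> x))"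
    using homotopic_loops_imp_path [OF hom1] homotopic_loops_imp_loop [OF hom1] by (simp_all add: rg)
  have path3: "path (cnj \<circ> \<gamma>)" by (intro path_continuous_image path continuous_intros)
  have hom2: "homotopic_loops (-{0}) (\<lambda>x. r (\<gamma> x)) (cnj \<circ> \<gamma>)"
  proof (rule homotopic_loops_linear [OF path2(1) path3 path2(2)])
    show "pathfinish (cnj \<circ> \<gamma>) = pathstart (cnj \<circ> \<gamma>)" using path(2) by (simp add: pathfinish_def pathstart_def)
    show "closed_segment (r (\<gamma> x)) ((cnj \<circ> \<gamma>) x) \<subseteq> -{0}" for x
      using seg [of "\<gamma> x"] \<gamma>(1) [of x] \<gamma>ne [of x] by auto
  qed
  have "homotopic_loops (-{0}) (cnj \<circ> \<gamma>) \<gamma>"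
    using hom1 hom2 unfolding rg using homotopic_loops_sym homotopic_loops_trans by blast
  \<comment> \<open>An integer that equals its own negative: the winding number of
    \<open>\<gamma>\<close> is 0.\<close>
  then have "winding_number (cnj \<circ> \<gamma>) 0 = winding_number \<gamma> 0" by (rule winding_number_homotopic_loops)
  moreover have n0: "0 \<notin> path_image \<gamma>" using \<gamma>ne by (auto simp: path_image_def)
  ultimately have "winding_number \<gamma> 0 = - cnj (winding_number \<gamma> 0)"
    using winding_number_cnj [OF path(1) n0] by simp
  moreover have "winding_number \<gamma> 0 \<in> \<int>" using integer_winding_number path n0 by blast
  ultimately have "winding_number \<gamma> 0 = 0" by (auto elim!: Ints_cases)
  \<comment> \<open>The loop \<open>\<gamma>\<close> is thus contractible. Mapped forward by
    \<open>a\<close> it is the round circle \<open>q\<close>, which would be contractible as well,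
    although it has winding number 1.\<close>
  then obtain c0 where c0: "homotopic_loops (-{0}) \<gamma> (\<lambda>x. c0)"
    using winding_number_homotopic_loops_null_eq [OF path(1) n0] by blast
  have c0ne: "c0 \<noteq> 0" using homotopic_loops_imp_subset [OF c0] by (auto simp: path_image_def)
  \<comment> \<open>The constant is scaled into the ball of radius \<open>\<rho>'\<close>, so that
    the contraction can be squeezed into the region where \<open>a\<close> is injective.\<close>
  define c1 where "c1 = of_real (\<rho>' / (\<rho>' + norm c0)) * c0"
  have c1: "c1 \<in> ball 0 \<rho>'"
  proof -
    have "norm c1 = \<rho>' / (\<rho>' + norm c0) * norm c0"
      using r(1) by (simp add: c1_def norm_mult add_nonneg_nonneg del: of_real_divide of_real_add)
    also have "\<dots> < \<rho>'"
      using r(1) c0ne by (simp add: field_simps add_pos_pos)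
    finally show ?thesis by simp
  qed
  have "homotopic_loops (-{0}) (\<lambda>x::real. c0) (\<lambda>x. c1)"
  proof (rule homotopic_loops_linear)
    show "closed_segment c0 c1 \<subseteq> -{0}"
    proof -
      have "(1 - u) *\<^sub>R c0 + u *\<^sub>R c1 \<noteq> 0" if "0 \<le> u" "u \<le> 1" for u
      proof -
        have pos: "0 < \<rho>' / (\<rho>' + norm c0)" using r(1) by (simp add: add_pos_nonneg)
        have "1 - u + u * (\<rho>' / (\<rho>' + norm c0)) > 0"
          using that pos by (cases "u = 1") (auto intro!: add_pos_nonneg mult_nonneg_nonneg simp del: times_divide_eq_right)
        moreover have "(1 - u) *\<^sub>R c0 + u *\<^sub>R c1 = (1 - u + u * (\<rho>' / (\<rho>' + norm c0))) *\<^sub>R c0"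
          by (simp add: c1_def scaleR_conv_of_real algebra_simps)
        ultimately show ?thesis using c0ne by simp
      qed
      then show ?thesis by (auto simp: closed_segment_def)
    qed
  qed (auto simp: path_def pathfinish_def pathstart_def)
  then have "homotopic_loops (-{0}) \<gamma> (\<lambda>x. c1)" using c0 homotopic_loops_trans by blast
  then have "homotopic_loops (ball 0 \<rho>' - {0}) \<gamma> (\<lambda>x. c1)"
    by (rule homotopic_loops_punctured_ball) (use \<gamma>(1) c1 in \<open>auto simp: path_image_def\<close>)
  then have "homotopic_loops (-{0}) (\<lambda>x. a (0 + \<gamma> x) - a 0) (\<lambda>x. a (0 + c1) - a 0)"
    by (rule homotopic_loops_image_punctured [OF _ a(1,2) sub])
  then have fin: "homotopic_loops (-{0}) (\<lambda>x. of_real t * cis (2 * pi * x)) (\<lambda>x. a c1 - p)"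
    using \<gamma>(2) a(3) by (simp add: q_def)
  have "circlepath 0 t = (\<lambda>x. of_real t * cis (2 * pi * x))"
    by (auto simp: circlepath cis_conv_exp algebra_simps)
  then have "winding_number (\<lambda>x. of_real t * cis (2 * pi * x)) 0 = 1"
    using winding_number_circlepath_centre [OF t(1), of 0] by simp
  moreover have "a c1 - p \<noteq> 0" using homotopic_loops_imp_subset [OF fin] by (auto simp: path_image_def)
  then have "winding_number (\<lambda>x::real. a c1 - p) 0 = 0" by (rule winding_number_zero_const)
  ultimately show False using winding_number_homotopic_loops [OF fin] by simp
qed

section \<open>Pushing and straightening\<close>

lemma transplant_id:
  assumes "inj_on b D" "\<And>w. w \<in> D \<Longrightarrow> g w = w"
  shows "transplant D b g x = x"
  by (rule transplant_outside [where C = "{}"]) (use assms in auto)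

context nyikos
begin

text \<open>Stated as an equivalence for points, which passes to composites and inverses at once;
  for homeomorphisms it is setwise invariance, see \<open>preserves_iff\<close>.\<close>

definition preserves :: "('a \<Rightarrow> 'a) \<Rightarrow> bool" where
  "preserves h \<longleftrightarrow> (\<forall>x\<in>topspace X. (h x \<in> K \<longleftrightarrow> x \<in> K) \<and> (\<forall>j\<in>{1..n}. h x \<in> P j \<longleftrightarrow> x \<in> P j))"

lemma bicollar_facts:
  assumes i: "i \<in> {1..n}" and e: "bicollar i e"
  shows "continuous_map (top_of_set annulus) X e" "inj_on e annulus"
    "\<And>w. w \<in> annulus \<Longrightarrow> e w \<in> topspace X"
    "\<And>w. w \<in> annulus \<Longrightarrow> e w \<in> K \<longleftrightarrow> norm w \<le> 1"
    "\<And>w j. w \<in> annulus \<Longrightarrow> j \<in> {1..n} \<Longrightarrow> e w \<in> P j \<longleftrightarrow> j = i \<and> 1 \<le> norm w"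
    "bd i = e ` sphere 0 1"
proof -
  show c: "continuous_map (top_of_set annulus) X e" "inj_on e annulus"
    using e by (auto simp: bicollar_def)
  have col: "collar i e" and inner: "\<And>w. w \<in> annulus \<Longrightarrow> norm w < 1 \<Longrightarrow> e w \<in> X interior_of K"
    using e by (auto simp: bicollar_def)
  show "e w \<in> topspace X" if "w \<in> annulus" for w
    using c(1) that by (auto simp: continuous_map_def Pi_iff)
  show "e w \<in> K \<longleftrightarrow> norm w \<le> 1" if "w \<in> annulus" for w
    using inner [OF that] collar_facts(6) [OF i col, of w] interior_of_subset [of X K]
    by (cases "norm w < 1") auto
  show "e w \<in> P j \<longleftrightarrow> j = i \<and> 1 \<le> norm w" if w: "w \<in> annulus" and j: "j \<in> {1..n}" for w j
  proof (cases "norm w < 1")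
    case True
    then show ?thesis using inner [OF w] interior_K_disjoint [OF j] by auto
  next
    case False
    then have "e w \<in> P i" using collar_facts(4) [OF i col] by auto
    then show ?thesis using False P_disjoint [OF i j] by auto
  qed
  show "bd i = e ` sphere 0 1" using col by (simp add: collar_def)
qed

text \<open>The pipe is closed, so it meets \<open>C\<close> in a compact set, and a finite subcover
  taken from a chain has a largest member.\<close>

lemma collar_containing:
  assumes i: "i \<in> {1..n}" and C: "compactin X C"
  obtains e where "collar i e" "C \<inter> P i \<subseteq> e ` outer"
proof -
  obtain I r and U :: "'a set \<Rightarrow> 'a set" where I: "well_order_on I r" "uncountable I" "(\<Union>\<alpha>\<in>I. U \<alpha>) = P i"
    and op: "\<And>\<alpha>. \<alpha> \<in> I \<Longrightarrow> openin (subtopology X (P i)) (U \<alpha>)"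
    and col: "\<And>\<alpha>. \<alpha> \<in> I \<Longrightarrow> \<exists>e. collar i e \<and> e ` outer = U \<alpha>"
    and mono: "\<And>\<alpha> \<beta>. \<alpha> \<in> I \<Longrightarrow> \<beta> \<in> I \<Longrightarrow> (\<alpha>,\<beta>) \<in> r \<Longrightarrow> U \<alpha> \<subseteq> U \<beta>"
    by (rule pipe_exhaustion [OF i], rule that)
  have tot: "U \<alpha> \<subseteq> U \<beta> \<or> U \<beta> \<subseteq> U \<alpha>" if "\<alpha> \<in> I" "\<beta> \<in> I" for \<alpha> \<beta>
    using I(1) mono that unfolding well_order_on_def linear_order_on_def total_on_def by (metis order_refl)
  have bound: "\<exists>\<alpha>\<in>I. (\<Union>\<beta>\<in>A. U \<beta>) \<subseteq> U \<alpha>" if "finite A" "A \<subseteq> I" for A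
    using that
  proof (induction A rule: finite_induct)
    case empty
    have "I \<noteq> {}" using I(2) by auto
    then show ?case by auto
  next
    case (insert a A)
    then obtain \<alpha> where "\<alpha> \<in> I" "(\<Union>\<beta>\<in>A. U \<beta>) \<subseteq> U \<alpha>" by auto
    then show ?case using tot [of a \<alpha>] insert.prems by auto
  qed
  have CP: "compactin (subtopology X (P i)) (C \<inter> P i)"
    using compact_Int_closedin [OF C P_closed [OF i]] by (simp add: compactin_subtopology)
  have "\<exists>\<F>. finite \<F> \<and> \<F> \<subseteq> U ` I \<and> C \<inter> P i \<subseteq> \<Union>\<F>"
    by (rule compactinD [OF CP]) (use op I(3) in auto)
  then obtain A where A: "finite A" "A \<subseteq> I" "C \<inter> P i \<subseteq> (\<Union>\<beta>\<in>A. U \<beta>)"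
    by (metis finite_subset_image)
  then obtain \<alpha> where "\<alpha> \<in> I" "C \<inter> P i \<subseteq> U \<alpha>" using bound [OF A(1,2)] by blast
  then show ?thesis using col that by metis
qed

text \<open>A radial stretch of a bicollar moves the boundary circle past everything of
  \<open>C\<close> in this pipe. The bicollar extends a collar containing that part of
  \<open>C\<close>, so pipe points off the collar avoid \<open>C\<close> without being
  moved.\<close>

lemma push_one:
  assumes i: "i \<in> {1..n}" and C: "compactin X C"
  obtains f where "homeomorphic_map X X f" "isotopic X (topspace X) {} f id"
    "\<And>j x. j \<in> {1..n} \<Longrightarrow> j \<noteq> i \<Longrightarrow> x \<in> P j \<Longrightarrow> f x = x" "f ` P i \<subseteq> P i - C"
proof -
  obtain e0 where e0: "collar i e0" "C \<inter> P i \<subseteq> e0 ` outer" using collar_containing [OF i C] .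
  obtain e where e: "bicollar i e" "\<And>w. w \<in> outer \<Longrightarrow> e w = e0 w" using bicollar_exists [OF i e0(1)] by blast
  have img: "e ` outer = e0 ` outer" using e(2) by auto
  have col: "collar i e" using e(1) by (simp add: bicollar_def)
  note c = bicollar_facts [OF i e(1)] and cc = collar_facts [OF i col]
  have "compactin (subtopology X (e ` outer)) (C \<inter> P i)"
    using compact_Int_closedin [OF C P_closed [OF i]] e0(2) img by (simp add: compactin_subtopology)
  then have "compactin (top_of_set outer) (inv_into outer e ` (C \<inter> P i))"
    using image_compactin cc(3) by blast
  then have "bounded (inv_into outer e ` (C \<inter> P i))"
    by (simp add: compactin_subtopology compact_imp_bounded)
  then obtain s0 where s0: "\<And>x. x \<in> C \<inter> P i \<Longrightarrow> norm (inv_into outer e x) \<le> s0"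
    by (auto simp: bounded_iff)
  \<comment> \<open>A radius exceeding those of all points of \<open>C\<close> in the collar; the
    bound 2 makes the slopes and the order of the breakpoints in \<open>\<rho>\<close> come out
    right.\<close>
  define s where "s = max 2 (s0 + 1)"
  have s: "s \<ge> 2" "\<And>w. w \<in> outer \<Longrightarrow> e w \<in> C \<Longrightarrow> norm w < s"
  proof -
    show "s \<ge> 2" by (simp add: s_def)
    fix w assume w: "w \<in> outer" "e w \<in> C"
    then have "norm w \<le> s0" using s0 [of "e w"] cc(2,4) by auto
    then show "norm w < s" by (simp add: s_def)
  qed
  \<comment> \<open>Piecewise linear and increasing: the identity up to 15/16, a steep line of slope
    \<open>16 * s\<close> from there, then the line of slope 1/2 through the point
    \<open>(1, s)\<close>, which meets the identity again at \<open>2 * s - 1\<close>. The boundary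
    radius 1 goes to \<open>s\<close>.\<close>
  define \<rho> where "\<rho> t = max t (min (16 * s * (t - 15/16) + 15/16) (s + (t - 1)/2))" for t :: real
  define rr where "rr u t = (1 - u) * t + u * \<rho> t" for u t :: real
  define \<gamma> where "\<gamma> u w = of_real (rr u (norm w)) * sgn w" for u and w :: complex
  have \<rho>_ge: "t \<le> \<rho> t" for t by (simp add: \<rho>_def)
  have \<rho>_mono: "\<rho> t < \<rho> t'" if "t < t'" for t t'
  proof -
    have "16 * s * (t - 15/16) < 16 * s * (t' - 15/16)" using that s(1) by (intro mult_strict_left_mono) auto
    moreover have "max t (min a b) < max t' (min a' b')" if "a < a'" "b < b'" for a b a' b' :: real
      using that \<open>t < t'\<close> by (auto simp: max_def min_def)
    ultimately show ?thesis using that unfolding \<rho>_def by simp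
  qed
  have rr_ge: "t \<le> rr u t" if "u \<in> {0..1}" for u t
  proof -
    have "u * t \<le> u * \<rho> t" using that \<rho>_ge by (intro mult_left_mono) auto
    then show ?thesis by (simp add: rr_def algebra_simps)
  qed
  have rr_mono: "rr u t < rr u t'" if "u \<in> {0..1}" "t < t'" for u t t'
  proof (cases "u = 0")
    case False
    then have "u * \<rho> t < u * \<rho> t'" using that \<rho>_mono by (intro mult_strict_left_mono) auto
    moreover have "(1 - u) * t \<le> (1 - u) * t'" using that by (intro mult_left_mono) auto
    ultimately show ?thesis by (simp add: rr_def)
  qed (use that in \<open>simp add: rr_def\<close>)
  have \<rho>_id: "\<rho> t = t" if "t < 15/16 \<or> 2 * s - 1 < t" for t
  proof (cases "t < 15/16")
    case True
    have "(16 * s - 1) * (t - 15/16) \<le> 0" using True s(1) by (intro mult_nonneg_nonpos) auto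
    moreover have "(16 * s - 1) * (t - 15/16) = 16 * s * (t - 15/16) + 15/16 - t" by (simp add: field_simps)
    ultimately have "16 * s * (t - 15/16) + 15/16 \<le> t" by linarith
    then show ?thesis by (simp add: \<rho>_def)
  next
    case False
    then have "s + (t - 1)/2 \<le> t" using that by (simp add: field_simps)
    then show ?thesis by (simp add: \<rho>_def)
  qed
  have rho1: "\<rho> 1 = s" using s(1) by (simp add: \<rho>_def max_def min_def)
  have g: "norm (\<gamma> u w) = rr u (norm w)" "sgn (\<gamma> u w) = sgn w" if "u \<in> {0..1}" "w \<in> annulus" for u w
  proof -
    have "0 < norm w" using that(2) by auto
    then have "rr u (norm w) > 0" using rr_ge [OF that(1), of "norm w"] by linarith
    moreover have "norm (sgn w) = 1" using \<open>0 < norm w\<close> by (auto simp: norm_sgn)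
    ultimately show "norm (\<gamma> u w) = rr u (norm w)" "sgn (\<gamma> u w) = sgn w"
      using sgn_scale [of "sgn w" "rr u (norm w)"] by (simp_all add: \<gamma>_def norm_mult)
  qed
  define C' where "C' = {w::complex. 15/16 \<le> norm w \<and> norm w \<le> 2 * s - 1}"
  have sgn_c: "continuous_on annulus sgn"
    by (rule continuous_on_subset [OF continuous_on_sgn_complex]) auto
  have pol: "\<gamma> u w = w" if "rr u (norm w) = norm w" for u w
    using that polar_sgn [of w] by (simp add: \<gamma>_def)
  have g0: "\<gamma> 0 w = w" for w by (rule pol) (simp add: rr_def)
  have cont: "continuous_on ({0..1} \<times> annulus) (\<lambda>p. \<gamma> (fst p) (snd p))"
    unfolding \<gamma>_def rr_def \<rho>_def
    by (intro continuous_intros continuous_on_compose2 [OF sgn_c]) auto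
  have gann: "\<gamma> u w \<in> annulus" if "u \<in> {0..1}" "w \<in> annulus" for u w
    using g(1) [OF that] rr_ge [OF that(1), of "norm w"] that(2) by auto
  have ginj: "inj_on (\<gamma> u) annulus" if u: "u \<in> {0..1}" for u
  proof (rule inj_onI)
    fix v w assume vw: "v \<in> annulus" "w \<in> annulus" "\<gamma> u v = \<gamma> u w"
    then have "rr u (norm v) = rr u (norm w)" "sgn v = sgn w" using g [OF u] by metis+
    then have "norm v = norm w" using rr_mono [OF u] by (metis linorder_neqE_linordered_idom order_less_irrefl)
    then show "v = w" using \<open>sgn v = sgn w\<close> polar_sgn by metis
  qed
  have C'c: "compact C'" unfolding C'_def by (rule compact_annulus) auto
  have C's: "C' \<subseteq> annulus" by (auto simp: C'_def)
  have gid: "\<gamma> u w = w" if "w \<in> annulus - C'" for u w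
  proof (rule pol)
    have "\<rho> (norm w) = norm w" by (rule \<rho>_id) (use that in \<open>auto simp: C'_def\<close>)
    then show "rr u (norm w) = norm w" by (simp add: rr_def algebra_simps)
  qed
  note tr = transplant_isotopy [OF open_annulus c(1,2) cont gann ginj C'c C's gid]
  define f where "f = transplant annulus e (\<gamma> 1)"
  show ?thesis
  proof (rule that)
    show "homeomorphic_map X X f" unfolding f_def by (rule tr(2)) auto
    have "isotopic X (topspace X) {} id f"
      unfolding f_def
      by (rule isotopic_cong [OF tr(3)]) (simp_all only: transplant_id [OF c(2) g0] id_apply)
    then show "isotopic X (topspace X) {} f id" by (rule isotopic_sym)
    show "f x = x" if "j \<in> {1..n}" "j \<noteq> i" "x \<in> P j" for j x
    proof -
      have "x \<notin> e ` annulus" using c(5) that by blast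
      then show ?thesis by (simp add: f_def transplant_def)
    qed
    show "f ` P i \<subseteq> P i - C"
    proof clarify
      fix x assume x: "x \<in> P i"
      show "f x \<in> P i - C"
      proof (cases "x \<in> e ` outer")
        case True
        then obtain w where w: "w \<in> outer" "x = e w" by blast
        then have wa: "w \<in> annulus" by auto
        have fx: "f x = e (\<gamma> 1 w)" using w wa c(2) by (simp add: f_def transplant_image)
        have "s \<le> rr 1 (norm w)"
        proof (cases "norm w = 1")
          case False
          then show ?thesis using w rr_mono [of 1 1 "norm w"] rho1 by (simp add: rr_def)
        qed (simp add: rr_def rho1)
        then have ns: "s \<le> norm (\<gamma> 1 w)" using g(1) [of 1 w] wa by simp
        then have "\<gamma> 1 w \<in> outer" using s(1) by simp
        then show ?thesis using fx cc(4) s(2) [of "\<gamma> 1 w"] ns by auto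
      next
        case False
        then have "x \<notin> e ` annulus" using c(5) [OF _ i] x by (auto simp: image_iff)
        then have "f x = x" by (simp add: f_def transplant_def)
        moreover have "x \<notin> C" using False e0(2) img x by auto
        ultimately show ?thesis using x by simp
      qed
    qed
  qed
qed

text \<open>The push of one pipe fixes all other pipes pointwise, so composing pushes does not undo
  earlier ones.\<close>

lemma push:
  assumes C: "compactin X C"
  obtains f where "homeomorphic_map X X f" "isotopic X (topspace X) {} f id" "\<And>i. i \<in> {1..n} \<Longrightarrow> f ` P i \<subseteq> P i - C"
proof -
  have "\<exists>f. homeomorphic_map X X f \<and> isotopic X (topspace X) {} f id \<and> (\<forall>i\<in>A. f ` P i \<subseteq> P i - C) \<and>
     (\<forall>j\<in>{1..n} - A. \<forall>x \<in> P j. f x = x)" if "finite A" "A \<subseteq> {1..n}" for A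
    using that
  proof (induction A rule: finite_induct)
    case empty
    have "homeomorphic_map X X id" by simp
    moreover from this have "isotopic X (topspace X) {} id id" by (intro isotopic_refl) auto
    ultimately show ?case unfolding id_def by (intro exI [of _ "\<lambda>x. x"]) auto
  next
    case (insert a A)
    have "A \<subseteq> {1..n}" using insert.prems by simp
    from insert.IH [OF this] obtain f where f: "homeomorphic_map X X f" "isotopic X (topspace X) {} f id"
      "\<forall>i\<in>A. f ` P i \<subseteq> P i - C" "\<forall>j\<in>{1..n} - A. \<forall>x \<in> P j. f x = x" by blast
    have a: "a \<in> {1..n}" using insert by auto
    obtain g where g: "homeomorphic_map X X g" "isotopic X (topspace X) {} g id"
      "\<And>j x. j \<in> {1..n} \<Longrightarrow> j \<noteq> a \<Longrightarrow> x \<in> P j \<Longrightarrow> g x = x" "g ` P a \<subseteq> P a - C"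
      using push_one [OF a C] by metis
    show ?case
    proof (intro exI conjI ballI)
      show "homeomorphic_map X X (f \<circ> g)" using f(1) g(1) homeomorphic_map_compose by blast
      show "isotopic X (topspace X) {} (f \<circ> g) id"
        using isotopic_compose [OF f(2) g(2)] by simp
      fix i assume i: "i \<in> insert a A"
      show "(f \<circ> g) ` P i \<subseteq> P i - C"
      proof (cases "i = a")
        case True
        have "f (g x) \<in> P a - C" if "x \<in> P a" for x
        proof -
          have gx: "g x \<in> P a - C" using g(4) that by blast
          then have "f (g x) = g x" using f(4) a insert.hyps by auto
          then show ?thesis using gx by simp
        qed
        then show ?thesis using True by auto
      next
        case False
        then have "i \<in> A" "i \<in> {1..n}" using i insert.prems by auto
        then have "f (g x) \<in> P i - C" if "x \<in> P i" for x
          using g(3) [of i x] f(3) False that by auto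
        then show ?thesis by auto
      qed
    next
      fix j x assume "j \<in> {1..n} - insert a A" "x \<in> P j"
      then show "(f \<circ> g) x = x" using g(3) [of j x] f(4) by auto
    qed
  qed
  from this [of "{1..n}"] show ?thesis using that by auto
qed

text \<open>Concentric circles are rotated by the angle \<open>G\<close>, damped by a tent with
  value 1 on the boundary circle and 0 off the radii between 3/4 and 5/4. Norms do not change, so
  both sides of the circle are preserved.\<close>

lemma twist:
  assumes i: "i \<in> {1..n}" and e: "bicollar i e" and G: "continuous_on (sphere 0 1) G"
    and mono: "\<And>x y. x < y \<Longrightarrow> x + G (cis x) < y + G (cis y)"
  obtains f where "homeomorphic_map X X f" "isotopic X (topspace X) {} f id" "preserves f"
    "\<And>z. norm z = 1 \<Longrightarrow> f (e z) = e (z * cis (G z))"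
    "\<And>j x. j \<in> {1..n} \<Longrightarrow> j \<noteq> i \<Longrightarrow> x \<in> P j \<Longrightarrow> f x = x"
proof -
  note c = bicollar_facts [OF i e]
  define l where "l t = max 0 (1 - 4 * \<bar>t - 1\<bar>)" for t :: real
  define \<gamma> where "\<gamma> u w = w * cis (u * l (norm w) * G (sgn w))" for u and w :: complex
  have l01: "0 \<le> l t" "l t \<le> 1" for t by (auto simp: l_def)
  have g0: "\<gamma> 0 w = w" for w by (simp add: \<gamma>_def)
  have gnorm: "norm (\<gamma> u w) = norm w" for u w by (simp add: \<gamma>_def norm_mult)
  have sgn_c: "continuous_on annulus sgn"
    by (rule continuous_on_subset [OF continuous_on_sgn_complex]) auto
  have Gs: "continuous_on annulus (\<lambda>w. G (sgn w))"
    by (rule continuous_on_compose2 [OF G sgn_c]) (auto simp: norm_sgn)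
  have cont: "continuous_on ({0..1} \<times> annulus) (\<lambda>p. \<gamma> (fst p) (snd p))"
    unfolding \<gamma>_def l_def
    by (intro continuous_intros continuous_on_compose2 [OF Gs]) auto
  have gann: "\<gamma> u w \<in> annulus" if "w \<in> annulus" for u w using that gnorm by simp
  have ginj: "inj_on (\<gamma> u) annulus" if u: "u \<in> {0..1}" for u
  proof (rule inj_onI)
    fix v w assume vw: "v \<in> annulus" "w \<in> annulus" and eq: "\<gamma> u v = \<gamma> u w"
    have nn: "norm v = norm w" using eq gnorm by metis
    define q where "q = u * l (norm w)"
    have q: "0 \<le> q" "q \<le> 1" using u l01 [of "norm w"] by (auto simp: q_def mult_le_one)
    have "norm (sgn v) = 1" "norm (sgn w) = 1" using vw by (auto simp: norm_sgn)
    then obtain x y where xy: "sgn v = cis x" "sgn w = cis y"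
      by (metis complex_norm_eq_1_exp cis_conv_exp)
    have pv: "v = of_real (norm w) * cis x" "w = of_real (norm w) * cis y"
      using polar_sgn [of v] polar_sgn [of w] nn xy by simp_all
    \<comment> \<open>A convex combination of the identity and the increasing map
      \<open>a + G (cis a)\<close> is increasing; this makes every damped stage of the rotation
      injective.\<close>
    have qmono: "a + q * G (cis a) < b + q * G (cis b)" if "a < b" for a b
    proof (cases "q = 0")
      case False
      then have "q * (a + G (cis a)) < q * (b + G (cis b))" using mono [OF that] q by (intro mult_strict_left_mono) auto
      moreover have "(1 - q) * a \<le> (1 - q) * b" using that q by (intro mult_left_mono) auto
      ultimately show ?thesis by (simp add: algebra_simps)
    qed (use that in simp)
    have "norm w \<noteq> 0" using vw by auto
    moreover have "v * cis (q * G (cis x)) = w * cis (q * G (cis y))"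
      using eq nn xy by (simp add: \<gamma>_def q_def)
    ultimately have "cis x * cis (q * G (cis x)) = cis y * cis (q * G (cis y))"
      by (subst (asm) pv(1), subst (asm) (2) pv(2)) (simp add: mult.assoc)
    then have "cis (x + q * G (cis x)) = cis (y + q * G (cis y))" by (simp add: cis_mult)
    then obtain m :: int where m: "x + q * G (cis x) = y + q * G (cis y) + 2 * pi * m"
      using cis_eq_iff by blast
    \<comment> \<open>The multiple of \<open>2 * pi\<close> is absorbed into the argument, since
      \<open>G\<close> depends on \<open>cis\<close> of it only.\<close>
    have ceq: "cis (y + 2 * pi * m) = cis y" using cis_eq_iff by blast
    then have "x + q * G (cis x) = (y + 2 * pi * m) + q * G (cis (y + 2 * pi * m))" using m by simp
    then have "x = y + 2 * pi * m" using qmono by (metis linorder_neqE_linordered_idom order_less_irrefl)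
    then have "cis x = cis y" using ceq by simp
    then show "v = w" using pv by simp
  qed
  define C' where "C' = {w::complex. 3/4 \<le> norm w \<and> norm w \<le> 5/4}"
  have C'c: "compact C'" unfolding C'_def by (rule compact_annulus) auto
  have C's: "C' \<subseteq> annulus" by (auto simp: C'_def)
  have gid: "\<gamma> u w = w" if "w \<in> annulus - C'" for u w
  proof -
    have "l (norm w) = 0" using that by (auto simp: C'_def l_def max_def abs_if)
    then show ?thesis by (simp add: \<gamma>_def)
  qed
  note tr = transplant_isotopy [OF open_annulus c(1,2) cont gann ginj C'c C's gid]
  define f where "f = transplant annulus e (\<gamma> 1)"
  have fe: "f (e w) = e (\<gamma> 1 w)" if "w \<in> annulus" for w
    using that c(2) by (simp add: f_def transplant_image)
  have fo: "f x = x" if "x \<notin> e ` annulus" for x using that by (simp add: f_def transplant_def)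
  show ?thesis
  proof (rule that)
    show "homeomorphic_map X X f" unfolding f_def by (rule tr(2)) auto
    have "isotopic X (topspace X) {} id f"
      unfolding f_def
      by (rule isotopic_cong [OF tr(3)]) (simp_all only: transplant_id [OF c(2) g0] id_apply)
    then show "isotopic X (topspace X) {} f id" by (rule isotopic_sym)
    show "preserves f"
      unfolding preserves_def
    proof
      fix x
      show "(f x \<in> K \<longleftrightarrow> x \<in> K) \<and> (\<forall>j\<in>{1..n}. f x \<in> P j \<longleftrightarrow> x \<in> P j)"
      proof (cases "x \<in> e ` annulus")
        case True
        then obtain w where w: "w \<in> annulus" "x = e w" by blast
        have gw: "\<gamma> 1 w \<in> annulus" using gann w by blast
        show ?thesis
          using c(4) [OF w(1)] c(4) [OF gw] c(5) [OF w(1)] c(5) [OF gw] gnorm fe [OF w(1)] w(2) by simp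
      qed (simp add: fo)
    qed
    show "f (e z) = e (z * cis (G z))" if "norm z = 1" for z
    proof -
      have "sgn z = z" using that by (simp add: sgn_div_norm)
      then show ?thesis using fe [of z] that by (simp add: \<gamma>_def l_def)
    qed
    show "f x = x" if "j \<in> {1..n}" "j \<noteq> i" "x \<in> P j" for j x
      by (rule fo) (use c(5) that in blast)
  qed
qed

text \<open>In logarithmic coordinates at the fixed point, the real part tells \<open>K\<close> from
  the pipe and keeps its sign because both are preserved, while the imaginary part along the circle
  is reversed. So \<open>h\<close> looks like complex conjugation up to a homotopy avoiding
  0.\<close>

lemma boundary_not_reversed:
  assumes i: "i \<in> {1..n}" and e: "bicollar i e" and h: "h \<in> homeos X At (topspace X) {}" and resp: "preserves h"
    and F: "continuous_on UNIV F" "\<And>x y. x < y \<Longrightarrow> F y < F x" "F x0 = x0"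
    and hF: "\<And>x. h (e (cis x)) = e (cis (F x))"
  shows False
proof -
  note c = bicollar_facts [OF i e]
  have hhom: "homeomorphic_map X X h" using homeosD(1) [OF h] by simp
  then have hc: "continuous_map X X h" and hinj: "inj_on h (topspace X)"
    using homeomorphic_imp_continuous_map homeomorphic_imp_injective_map by blast+
  define p where "p = e (cis x0)"
  have pX: "p \<in> topspace X" unfolding p_def by (rule c(3)) simp
  have hp: "h p = p" using hF [of x0] F(3) by (simp add: p_def)
  obtain \<phi> U where U: "(\<phi>,U) \<in> At" "p \<in> U" "plane_chart X \<phi> U" using chart_at [OF pX] by blast
  have opU: "openin X U" and injU: "inj_on \<phi> U" using plane_chart_facts [OF U(3)] by auto
  have emb: "open_embedding_on X (topspace X) h"
    using hc hinj by (simp add: open_embedding_on_def)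
  define W where "W = {x \<in> U \<inter> topspace X. h x \<in> U}"
  have W: "openin X W" unfolding W_def by (rule open_embedding_on_preimage [OF emb opU opU])
  have embW: "open_embedding_on X W h" by (rule open_embedding_on_subset [OF emb W]) (auto simp: W_def)
  have WU: "W \<subseteq> U" "h ` W \<subseteq> U" and pW: "p \<in> W" using U pX hp by (auto simp: W_def)
  define f where "f = \<phi> \<circ> h \<circ> inv_into U \<phi>"
  note rep = chart_rep [OF U(1) U(1) embW WU, folded f_def]
  have "orient_pres_local X At h p"
    using h pX by (simp add: homeos_iff interior_of_topspace)
  then have op: "orient_pres_at (\<phi> ` W) f (\<phi> p)"
    unfolding f_def by (rule orient_pres_local_chart [OF embW pW _ U(1) WU(1) U(1) WU(2)])
  define ex where "ex \<zeta> = exp (\<i> * of_real x0 + \<zeta>)" for \<zeta> :: complex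
  define \<epsilon> where "\<epsilon> \<zeta> = e (ex \<zeta>)" for \<zeta>
  have exn: "norm (ex \<zeta>) = exp (Re \<zeta>)" for \<zeta> by (simp add: ex_def)
  have exa: "ex \<zeta> \<in> annulus" if "\<zeta> \<in> ball 0 (1/4)" for \<zeta>
  proof -
    have "\<bar>Re \<zeta>\<bar> < 1/4" using that abs_Re_le_cmod [of \<zeta>] by simp
    then have "1 + Re \<zeta> > 1/2" by (simp add: abs_if split: if_splits)
    then have "1/2 < norm (ex \<zeta>)" unfolding exn using exp_ge_add_one_self [of "Re \<zeta>"] by linarith
    then show ?thesis by blast
  qed
  have ex0: "ex 0 = cis x0" by (simp add: ex_def cis_conv_exp)
  have exinj: "inj_on ex (ball 0 (1/4))"
  proof (rule inj_onI)
    fix \<zeta> \<xi> assume z: "\<zeta> \<in> ball 0 (1/4)" "\<xi> \<in> ball 0 (1/4)" "ex \<zeta> = ex \<xi>"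
    have "1/4 < pi" using pi_gt3 by simp
    then have "\<i> * of_real x0 + \<zeta> \<in> ball (\<i> * of_real x0) pi" "\<i> * of_real x0 + \<xi> \<in> ball (\<i> * of_real x0) pi"
      using z by (auto simp: dist_norm)
    then have "\<i> * of_real x0 + \<zeta> = \<i> * of_real x0 + \<xi>"
      using z(3) inj_onD [OF inj_on_exp_pi] unfolding ex_def by blast
    then show "\<zeta> = \<xi>" by simp
  qed
  have epc: "continuous_map (top_of_set (ball 0 (1/4))) X \<epsilon>"
  proof -
    have "continuous_map (top_of_set (ball 0 (1/4))) (top_of_set annulus) ex"
      using exa by (auto simp: continuous_map_in_subtopology ex_def intro!: continuous_intros)
    from continuous_map_compose [OF this c(1)] show ?thesis by (simp add: o_def \<epsilon>_def [abs_def])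
  qed
  have epinj: "inj_on \<epsilon> (ball 0 (1/4))"
    unfolding \<epsilon>_def using exinj exa c(2) by (auto simp: inj_on_def) 
  have ep0: "\<epsilon> 0 = p" by (simp add: \<epsilon>_def ex0 p_def)
  have "openin (top_of_set (ball 0 (1/4))) {\<zeta> \<in> ball 0 (1/4). \<epsilon> \<zeta> \<in> U}"
    using openin_continuous_map_preimage [OF epc opU] by simp
  then have "open {\<zeta> \<in> ball 0 (1/4). \<epsilon> \<zeta> \<in> U}" using openin_open_eq [OF open_ball] by blast
  moreover have "0 \<in> {\<zeta> \<in> ball 0 (1/4). \<epsilon> \<zeta> \<in> U}" using ep0 U by simp
  ultimately obtain \<rho> where \<rho>: "\<rho> > 0" "ball 0 \<rho> \<subseteq> {\<zeta> \<in> ball 0 (1/4). \<epsilon> \<zeta> \<in> U}"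
    using open_contains_ball by blast
  have epc': "continuous_map (top_of_set (ball 0 \<rho>)) X \<epsilon>" and epinj': "inj_on \<epsilon> (ball 0 \<rho>)"
  proof -
    have "ball (0::complex) \<rho> \<subseteq> ball 0 (1/4)" using \<rho>(2) by blast
    then show "continuous_map (top_of_set (ball 0 \<rho>)) X \<epsilon>" "inj_on \<epsilon> (ball 0 \<rho>)"
      using continuous_map_from_subtopology_mono [OF epc] inj_on_subset [OF epinj] by blast+
  qed
  have epU: "\<epsilon> \<zeta> \<in> U" if "\<zeta> \<in> ball 0 \<rho>" for \<zeta> using that \<rho>(2) by blast
  define Q where "Q = \<epsilon> ` ball 0 \<rho>"
  have Q: "openin X Q" unfolding Q_def by (rule openin_planar_image [OF open_ball epc' epinj'])
  have hepc: "continuous_map (top_of_set (ball 0 \<rho>)) X (h \<circ> \<epsilon>)"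
    by (rule continuous_map_compose [OF epc' hc])
  have "openin (top_of_set (ball 0 \<rho>)) {\<zeta> \<in> ball 0 \<rho>. (h \<circ> \<epsilon>) \<zeta> \<in> Q}"
    using openin_continuous_map_preimage [OF hepc Q] by simp
  then have "open {\<zeta> \<in> ball 0 \<rho>. (h \<circ> \<epsilon>) \<zeta> \<in> Q}" using openin_open_eq [OF open_ball] by blast
  moreover have "p \<in> Q" using ep0 \<rho>(1) unfolding Q_def by (intro image_eqI [of _ _ 0]) auto
  then have "0 \<in> {\<zeta> \<in> ball 0 \<rho>. (h \<circ> \<epsilon>) \<zeta> \<in> Q}" using ep0 hp \<rho>(1) by simp
  ultimately obtain \<rho>1 where \<rho>1: "\<rho>1 > 0" "ball 0 \<rho>1 \<subseteq> {\<zeta> \<in> ball 0 \<rho>. (h \<circ> \<epsilon>) \<zeta> \<in> Q}"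
    using open_contains_ball by blast
  have "isCont F x0" using F(1) by (simp add: continuous_on_eq_continuous_at)
  then obtain \<delta> where \<delta>: "\<delta> > 0" "\<And>x. \<bar>x - x0\<bar> < \<delta> \<Longrightarrow> \<bar>F x - x0\<bar> < 1"
    using F(3) unfolding continuous_at_eps_delta by (metis dist_real_def zero_less_one)
  \<comment> \<open>Small enough for \<open>h\<close> to stay in the coordinate patch
    \<open>Q\<close>, and for \<open>F\<close> to move the angle by less than 1 from
    \<open>x0\<close>.\<close>
  define \<rho>' where "\<rho>' = min \<rho> (min \<rho>1 \<delta>)"
  have \<rho>': "0 < \<rho>'" "\<rho>' \<le> \<rho>" "\<rho>' \<le> \<rho>1" "\<rho>' \<le> \<delta>" using \<rho> \<rho>1 \<delta> by (auto simp: \<rho>'_def)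
  define r where "r = inv_into (ball 0 \<rho>) \<epsilon> \<circ> (h \<circ> \<epsilon>)"
  have hQ: "h (\<epsilon> \<zeta>) \<in> Q" if "\<zeta> \<in> ball 0 \<rho>'" for \<zeta>
  proof -
    have "\<zeta> \<in> ball 0 \<rho>1" using that \<rho>'(3) by simp
    then have "\<zeta> \<in> {\<zeta> \<in> ball 0 \<rho>. (h \<circ> \<epsilon>) \<zeta> \<in> Q}" using \<rho>1(2) by blast
    then show ?thesis by simp
  qed
  have r: "r \<zeta> \<in> ball 0 \<rho>" "\<epsilon> (r \<zeta>) = h (\<epsilon> \<zeta>)" if "\<zeta> \<in> ball 0 \<rho>'" for \<zeta>
    using hQ [OF that] unfolding r_def Q_def o_def
    by (metis inv_into_into, metis f_inv_into_f)
  have rc: "continuous_on (ball 0 \<rho>') r"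
  proof -
    have "continuous_map (top_of_set (ball 0 \<rho>')) (subtopology X (\<epsilon> ` ball 0 \<rho>)) (h \<circ> \<epsilon>)"
      using hQ continuous_map_from_subtopology_mono [OF hepc subset_ball [OF \<rho>'(2)]]
      by (auto simp: continuous_map_in_subtopology Q_def)
    from continuous_map_compose [OF this embedding_inverse_continuous [OF open_ball epc' epinj']]
    show ?thesis by (simp add: r_def continuous_map_in_subtopology)
  qed
  have repc: "continuous_on (ball 0 \<rho>) (\<phi> \<circ> \<epsilon>)"
  proof -
    have "continuous_map (top_of_set (ball 0 \<rho>)) (subtopology X U) \<epsilon>"
      using epc' epU by (auto simp: continuous_map_in_subtopology)
    from continuous_map_compose [OF this plane_chart_facts(3) [OF U(3)]] show ?thesis by simp
  qed
  have repi: "inj_on (\<phi> \<circ> \<epsilon>) (ball 0 \<rho>)"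
    by (rule comp_inj_on [OF epinj' inj_on_subset [OF injU]]) (use epU in blast)
  \<comment> \<open>Off the circle the real parts of both ends have the same strict sign. On it they
    vanish, and the imaginary parts have the same strict sign, because \<open>F\<close> decreases
    through \<open>x0\<close> and conjugation also reverses the sign.\<close>
  have seg: "0 \<notin> closed_segment (r \<zeta>) (cnj \<zeta>)" if "\<zeta> \<in> ball 0 \<rho>' - {0}" for \<zeta>
  proof -
    have "\<zeta> \<in> ball 0 \<rho>" using that \<rho>'(2) by auto
    then have zb: "\<zeta> \<in> ball 0 \<rho>'" "\<zeta> \<in> ball 0 (1/4)" "\<zeta> \<noteq> 0" using that \<rho>(2) by blast+
    let ?x = "r \<zeta>"
    have xb: "?x \<in> ball 0 (1/4)" using r(1) [OF zb(1)] \<rho>(2) by blast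
    have eq: "e (ex ?x) = h (e (ex \<zeta>))" using r(2) [OF zb(1)] by (simp add: \<epsilon>_def)
    have memb: "e (ex ?x) \<in> K \<longleftrightarrow> e (ex \<zeta>) \<in> K" "e (ex ?x) \<in> P i \<longleftrightarrow> e (ex \<zeta>) \<in> P i"
      using resp c(3) [OF exa [OF zb(2)]] i unfolding eq preserves_def by blast+
    have k: "e (ex z) \<in> K \<longleftrightarrow> Re z \<le> 0" "e (ex z) \<in> P i \<longleftrightarrow> 0 \<le> Re z" if "z \<in> ball 0 (1/4)" for z
      using c(4,5) [OF exa [OF that]] i by (auto simp: exn)
    have sign: "Re ?x \<le> 0 \<longleftrightarrow> Re \<zeta> \<le> 0" "0 \<le> Re ?x \<longleftrightarrow> 0 \<le> Re \<zeta>"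
      using memb k [OF xb] k [OF zb(2)] by auto
    have conv: "(1 - u) * a + u * b \<noteq> 0" if "0 < a \<and> 0 < b \<or> a < 0 \<and> b < 0" "0 \<le> u" "u \<le> 1" for a b u :: real
    proof -
      have pos: "(1 - u) * a + u * b > 0" if "0 < a" "0 < b" for a b :: real
        using that \<open>0 \<le> u\<close> \<open>u \<le> 1\<close> by (cases "u = 1") (auto intro!: add_pos_nonneg)
      show ?thesis using that(1) pos [of a b] pos [of "- a" "- b"] by auto
    qed
    show ?thesis
    proof
      assume "0 \<in> closed_segment ?x (cnj \<zeta>)"
      then obtain u where u: "0 \<le> u" "u \<le> 1" "0 = (1 - u) *\<^sub>R ?x + u *\<^sub>R cnj \<zeta>"
        by (auto simp: closed_segment_def)
      have re: "(1 - u) * Re ?x + u * Re \<zeta> = 0" and im: "(1 - u) * Im ?x + u * (- Im \<zeta>) = 0"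
        using arg_cong [OF u(3), of Re] arg_cong [OF u(3), of Im] by simp_all
      show False
      proof (cases "Re \<zeta> = 0")
        case False
        then have "0 < Re ?x \<and> 0 < Re \<zeta> \<or> Re ?x < 0 \<and> Re \<zeta> < 0" using sign by linarith
        then show False using conv u(1,2) re by blast
      next
        case True
        then have R0: "Re ?x = 0" using sign by linarith
        have y0: "Im \<zeta> \<noteq> 0" using True zb(3) by (simp add: complex_eq_iff)
        have excis: "ex z = cis (x0 + Im z)" if "Re z = 0" for z
          using that by (simp add: ex_def exp_eq_polar)
        have "e (cis (x0 + Im ?x)) = e (cis (F (x0 + Im \<zeta>)))"
          using eq hF excis [OF R0] excis [OF True] by simp
        then have "cis (x0 + Im ?x) = cis (F (x0 + Im \<zeta>))"
          using inj_onD [OF c(2)] by simp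
        then obtain m :: int where m: "x0 + Im ?x = F (x0 + Im \<zeta>) + 2 * pi * m" using cis_eq_iff by blast
        have "\<bar>Im \<zeta>\<bar> < \<delta>" using zb(1) \<rho>'(4) abs_Im_le_cmod [of \<zeta>] by auto
        then have "\<bar>F (x0 + Im \<zeta>) - x0\<bar> < 1" using \<delta>(2) [of "x0 + Im \<zeta>"] by simp
        moreover have "\<bar>Im ?x\<bar> < 1" using xb abs_Im_le_cmod [of ?x] by auto
        ultimately have m2: "\<bar>2 * pi * m\<bar> < 2" using m by linarith
        \<comment> \<open>Angles are known modulo \<open>2 * pi\<close> only, but here both deviate
          from \<open>x0\<close> by less than 1, hence from each other by less than 2.\<close>
        have "m = 0"
        proof (rule ccontr)
          assume "m \<noteq> 0"
          then have "1 \<le> \<bar>real_of_int m\<bar>" by (simp flip: of_int_abs)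
          then have "2 * pi * 1 \<le> 2 * pi * \<bar>real_of_int m\<bar>" by (intro mult_left_mono) auto
          moreover have "\<bar>2 * pi * m\<bar> = 2 * pi * \<bar>real_of_int m\<bar>" by (simp add: abs_mult)
          ultimately show False using m2 pi_gt3 by linarith
        qed
        then have xi: "Im ?x = F (x0 + Im \<zeta>) - x0" using m by simp
        have "0 < Im ?x \<and> 0 < - Im \<zeta> \<or> Im ?x < 0 \<and> - Im \<zeta> < 0"
        proof (cases "Im \<zeta> > 0")
          case True
          then show ?thesis using F(2) [of x0 "x0 + Im \<zeta>"] F(3) xi by simp
        next
          case False
          then show ?thesis using F(2) [of "x0 + Im \<zeta>" x0] F(3) xi y0 by simp
        qed
        then show False using conv u(1,2) im by blast
      qed
    qed
  qed
  have "\<not> orient_pres_at (\<phi> ` W) f (\<phi> p)"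
  proof (rule not_orient_pres_at_reflection [OF rep(2,3,1) _ _ repc repi _ \<rho>'(1,2) rc r(1)])
    show "\<phi> p \<in> \<phi> ` W" using pW by blast
    show "f (\<phi> p) = \<phi> p" using injU U(2) hp by (simp add: f_def)
    show "(\<phi> \<circ> \<epsilon>) 0 = \<phi> p" by (simp add: ep0)
    have epW: "\<epsilon> \<zeta> \<in> W" if "\<zeta> \<in> ball 0 \<rho>'" for \<zeta>
    proof -
      have "\<zeta> \<in> ball 0 \<rho>" using that \<rho>'(2) by auto
      then have "\<epsilon> \<zeta> \<in> U" by (rule epU)
      moreover have "h (\<epsilon> \<zeta>) \<in> U" using r [OF that] epU by metis
      ultimately show ?thesis using opU openin_subset by (auto simp: W_def)
    qed
    then show "(\<phi> \<circ> \<epsilon>) ` ball 0 \<rho>' \<subseteq> \<phi> ` W" by auto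
    show "f ((\<phi> \<circ> \<epsilon>) \<zeta>) = (\<phi> \<circ> \<epsilon>) (r \<zeta>)" if "\<zeta> \<in> ball 0 \<rho>'" for \<zeta>
      using epW [OF that] WU(1) injU r(2) [OF that] by (auto simp: f_def subset_iff)
  qed (use seg in auto)
  with op show False by simp
qed

lemma preserves_compose:
  assumes "preserves f" "preserves g" "f ` topspace X \<subseteq> topspace X"
  shows "preserves (g \<circ> f)"
  using assms unfolding preserves_def by (metis comp_apply image_subset_iff)

text \<open>The twist by the displacement of the lifted boundary map agrees with \<open>h\<close> on
  \<open>bd i\<close>; composing \<open>h\<close> with its inverse fixes that circle. The twist
  leaves the other pipes alone, so circles fixed earlier remain fixed.\<close>

lemma straighten_one:
  assumes i: "i \<in> {1..n}" and h: "h \<in> homeos X At (topspace X) {}" and resp: "preserves h"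
  obtains h' where "h' \<in> homeos X At (topspace X) {}" "isotopic X (topspace X) {} h' h" "preserves h'"
    "\<And>x. x \<in> bd i \<Longrightarrow> h' x = x" "\<And>j x. j \<in> {1..n} \<Longrightarrow> x \<in> bd j \<Longrightarrow> h x = x \<Longrightarrow> h' x = x"
proof -
  obtain e0 where "collar i e0" using some_collar [OF i] .
  then obtain e where e: "bicollar i e" using bicollar_exists [OF i] by metis
  have col: "collar i e" using e by (simp add: bicollar_def)
  note c = bicollar_facts [OF i e] and cc = collar_facts [OF i col]
  have hX: "h ` topspace X = topspace X" by (rule homeos_image [OF h]) simp
  have hc: "continuous_map X X h"
    using homeosD(1) [OF h] homeomorphic_imp_continuous_map by fastforce
  have hinj: "inj_on h (topspace X)" by (rule homeos_inj [OF h]) simp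
  have hbd: "h x \<in> bd j" if "j \<in> {1..n}" "x \<in> bd j" for j x
  proof -
    have "x \<in> P j \<inter> K" using that P_Int_K by blast
    then show ?thesis using resp that P_Int_K K_subset unfolding preserves_def by blast
  qed
  \<comment> \<open>The restriction of \<open>h\<close> to the boundary circle, read in the collar
    coordinate.\<close>
  define k where "k = inv_into outer e \<circ> (h \<circ> e)"
  have sph: "e z \<in> bd i" if "z \<in> sphere 0 1" for z using that c(6) by blast
  have k: "k z \<in> sphere 0 1" "e (k z) = h (e z)" if z: "z \<in> sphere 0 1" for z
  proof -
    obtain v where v: "v \<in> sphere 0 1" "h (e z) = e v" using hbd [OF i sph [OF z]] c(6) by blast
    then have "k z = v" using cc(2) by (simp add: k_def)
    then show "k z \<in> sphere 0 1" "e (k z) = h (e z)" using v by auto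
  qed
  have kc: "continuous_on (sphere 0 1) k"
  proof -
    have "continuous_map (top_of_set (sphere 0 1)) X (h \<circ> e)"
      by (rule continuous_map_compose [OF continuous_map_from_subtopology_mono [OF cc(1)] hc]) auto
    moreover have "(h \<circ> e) z \<in> e ` outer" if "z \<in> sphere 0 1" for z
      using k [OF that] by (auto intro!: image_eqI [of _ e "k z"])
    ultimately have "continuous_map (top_of_set (sphere 0 1)) (subtopology X (e ` outer)) (h \<circ> e)"
      by (auto simp: continuous_map_in_subtopology)
    from continuous_map_compose [OF this cc(3)] show ?thesis
      by (simp add: k_def continuous_map_in_subtopology)
  qed
  have kinj: "inj_on k (sphere 0 1)"
  proof (rule inj_onI)
    fix v w assume vw: "v \<in> sphere 0 1" "w \<in> sphere 0 1" "k v = k w"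
    then have "h (e v) = h (e w)" using k(2) by metis
    then have "e v = e w" using inj_onD [OF hinj] c(3) [of v] c(3) [of w] vw by auto
    then show "v = w" using inj_onD [OF cc(2)] vw by auto
  qed
  have kim: "k ` sphere 0 1 \<subseteq> sphere 0 1" using k(1) by blast
  obtain F where F: "continuous_on UNIV F" "\<And>x. k (cis x) = cis (F x)"
    "\<And>x y. x < y \<Longrightarrow> F x < F y" "\<And>x. F (x + 2 * pi) = F x + 2 * pi"
  proof (rule circle_lift [OF kc kim kinj])
    fix F :: "real \<Rightarrow> real" and x assume F: "continuous_on UNIV F" "\<And>x. k (cis x) = cis (F x)"
      "\<And>x y. x < y \<Longrightarrow> F y < F x" "F x = x"
    have hF: "h (e (cis x)) = e (cis (F x))" for x using k(2) [of "cis x"] F(2) by simp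
    have False by (rule boundary_not_reversed [OF i e h resp F(1) F(3) F(4) hF])
    then show thesis ..
  qed (rule that)
  obtain G where G: "continuous_on (sphere 0 1) G" "\<And>x. G (cis x) = F x - x"
    by (rule circle_displacement [OF F(1,4)], rule that)
  obtain f where f: "homeomorphic_map X X f" "isotopic X (topspace X) {} f id" "preserves f"
    "\<And>z. norm z = 1 \<Longrightarrow> f (e z) = e (z * cis (G z))"
    "\<And>j x. j \<in> {1..n} \<Longrightarrow> j \<noteq> i \<Longrightarrow> x \<in> P j \<Longrightarrow> f x = x"
    by (rule twist [OF i e G(1)]) (use G(2) F(3) in auto)
  have fh: "f x = h x" if "x \<in> bd i" for x
  proof -
    obtain z where z: "z \<in> sphere 0 1" "x = e z" using c(6) \<open>x \<in> bd i\<close> by blast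
    then obtain t where t: "z = cis t" by (metis complex_norm_eq_1_exp cis_conv_exp mem_sphere_0)
    have "f x = e (k z)" using f(4) [of z] z t G(2) [of t] F(2) by (simp add: cis_mult)
    then show ?thesis using k(2) [OF z(1)] z by simp
  qed
  have fhom: "f \<in> homeos X At (topspace X) {}"
    by (rule homeos_isotopic [OF isotopic_sym [OF f(2)] homeos_id]) simp
  obtain g where g: "g \<in> homeos X At (topspace X) {}"
    "\<And>x. x \<in> topspace X \<Longrightarrow> g (f x) = x \<and> f (g x) = x \<and> g x \<in> topspace X \<and> f x \<in> topspace X"
    using homeos_inverse [OF fhom] by auto
  have grefl: "isotopic X (topspace X) {} g g"
    by (rule isotopic_refl [OF homeosD(1) [OF g(1)]]) simp
  have "isotopic X (topspace X) {} id g"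
    by (rule isotopic_cong [OF isotopic_compose [OF grefl f(2)]]) (use g(2) in auto)
  then have gid: "isotopic X (topspace X) {} g id" by (rule isotopic_sym)
  have hrefl: "isotopic X (topspace X) {} h h"
    by (rule isotopic_refl [OF homeosD(1) [OF h]]) simp
  have gresp: "preserves g"
    using f(3) g(2) unfolding preserves_def by metis
  have bdX: "x \<in> topspace X" if "j \<in> {1..n}" "x \<in> bd j" for j x
    using that bd_subset K_subset by blast
  show ?thesis
  proof (rule that)
    show "g \<circ> h \<in> homeos X At (topspace X) {}" by (rule homeos_compose [OF h g(1)]) simp
    show "isotopic X (topspace X) {} (g \<circ> h) h"
      using isotopic_compose [OF gid hrefl] by simp
    show "preserves (g \<circ> h)" using preserves_compose [OF resp gresp] hX by simp
    show fixi: "(g \<circ> h) x = x" if "x \<in> bd i" for x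
      using fh [OF that] g(2) [OF bdX [OF i that]] by simp
    show "(g \<circ> h) x = x" if "j \<in> {1..n}" "x \<in> bd j" "h x = x" for j x
    proof (cases "j = i")
      case False
      then have "f x = x" using f(5) that bd_subset by blast
      then have "g x = x" using g(2) [OF bdX [OF that(1,2)]] by metis
      then show ?thesis using that by simp
    qed (use fixi that in blast)
  qed
qed

lemma straighten:
  assumes h: "h \<in> homeos X At (topspace X) {}" and resp: "preserves h"
  obtains h' where "h' \<in> homeos X At (topspace X) {}" "isotopic X (topspace X) {} h' h" "preserves h'"
    "\<And>x. x \<in> bdK \<Longrightarrow> h' x = x"
proof -
  have "\<exists>h'. h' \<in> homeos X At (topspace X) {} \<and> isotopic X (topspace X) {} h' h \<and> preserves h' \<and>
    (\<forall>i\<in>A. \<forall>x \<in> bd i. h' x = x)" if "finite A" "A \<subseteq> {1..n}" for A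
    using that
  proof (induction A rule: finite_induct)
    case empty
    then show ?case
      using h resp isotopic_refl [OF homeosD(1) [OF h], of "{}"] by (intro exI [of _ h]) auto
  next
    case (insert a A)
    then obtain h' where h': "h' \<in> homeos X At (topspace X) {}" "isotopic X (topspace X) {} h' h" "preserves h'"
      "\<forall>i\<in>A. \<forall>x \<in> bd i. h' x = x" by auto
    have a: "a \<in> {1..n}" using insert by auto
    obtain h'' where h'': "h'' \<in> homeos X At (topspace X) {}" "isotopic X (topspace X) {} h'' h'" "preserves h''"
      "\<And>x. x \<in> bd a \<Longrightarrow> h'' x = x" "\<And>j x. j \<in> {1..n} \<Longrightarrow> x \<in> bd j \<Longrightarrow> h' x = x \<Longrightarrow> h'' x = x"
      using straighten_one [OF a h'(1,3)] by metis
    have "isotopic X (topspace X) {} h'' h"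
      by (rule isotopic_trans [OF h''(2) h'(2)]) (use homeosD(1) [OF h'(1)] in auto)
    moreover have "\<forall>i\<in>insert a A. \<forall>x\<in>bd i. h'' x = x"
      using h''(4,5) h'(4) insert.prems by blast
    ultimately show ?case using h'' by blast
  qed
  from this [of "{1..n}"] obtain h' where "h' \<in> homeos X At (topspace X) {}"
    "isotopic X (topspace X) {} h' h" "preserves h'" "\<forall>i\<in>{1..n}. \<forall>x \<in> bd i. h' x = x" by auto
  then show ?thesis using that bdK_Union by blast
qed

end

section \<open>Gluing, normality and the epimorphism\<close>

context nyikos
begin

text \<open>Index 0 stands for \<open>K\<close>, as in \<open>factor_MCG\<close>, so that gluing
  treats all pieces alike.\<close>

definition piece :: "nat \<Rightarrow> 'a set" where "piece i = (if i = 0 then K else P i)"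

abbreviation "bdp i \<equiv> mbdry (subtopology X (piece i))"

lemma factor_MCG_eq: "factor_MCG X At K P i = MCG X At (piece i) (bdp i)"
  by (simp add: factor_MCG_def piece_def)

lemma piece_subset: "i \<in> {0..n} \<Longrightarrow> piece i \<subseteq> topspace X"
  using K_subset P_subset by (auto simp: piece_def)

lemma piece_closed: "i \<in> {0..n} \<Longrightarrow> closedin X (piece i)"
  using K_closed P_closed by (auto simp: piece_def)

lemma piece_cover: assumes "x \<in> topspace X" obtains i where "i \<in> {0..n}" "x \<in> piece i"
proof -
  consider "x \<in> K" | i where "i \<in> {1..n}" "x \<in> P i" using assms cover by blast
  then show ?thesis
  proof cases
    case 1
    then show ?thesis using that [of 0] by (simp add: piece_def)
  next
    case 2
    then show ?thesis using that [of i] by (simp add: piece_def)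
  qed
qed

lemma bdp_eq: "i \<in> {0..n} \<Longrightarrow> bdp i = piece i - X interior_of (piece i)"
  using mbdry_subtopology piece_subset by blast

lemma bdp_subset:
  assumes "i \<in> {0..n}" shows "bdp i \<subseteq> piece i" "bdp i \<subseteq> bdK"
proof -
  show "bdp i \<subseteq> piece i" using bdp_eq [OF assms] by blast
  show "bdp i \<subseteq> bdK"
  proof (cases "i = 0")
    case False
    then show ?thesis using bd_subset_bdK [of i] assms by (simp add: piece_def)
  qed (simp add: piece_def)
qed

lemma piece_overlap:
  assumes "i \<in> {0..n}" "j \<in> {0..n}" "i \<noteq> j" "x \<in> piece i" "x \<in> piece j"
  shows "x \<in> bdp i"
proof -
  have *: "x \<in> bdK \<and> x \<in> bd k" if "k \<in> {1..n}" "x \<in> P k" "x \<in> K" for k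
    using that P_Int_K bd_subset_bdK by blast
  show ?thesis
  proof (cases "i = 0 \<or> j = 0")
    case True
    then show ?thesis using assms * [of i] * [of j] by (auto simp: piece_def split: if_splits)
  next
    case False
    then show ?thesis using assms P_disjoint [of i j] by (auto simp: piece_def)
  qed
qed

text \<open>\<open>glue\<close> gives priority to \<open>K\<close> and selects a pipe by
  \<open>SOME\<close>. Two pieces meet only in points fixed by both maps, so any piece containing
  the point gives the value.\<close>

lemma glue_eq:
  assumes fixed: "\<forall>i\<in>{0..n}. \<forall>x\<in>bdp i. hs i x = x" and i: "i \<in> {0..n}" "x \<in> piece i"
  shows "glue K n P hs x = hs i x"
proof (cases "x \<in> K")
  case True
  then have x0: "x \<in> piece 0" by (simp add: piece_def)
  have "hs 0 x = hs i x"
  proof (cases "i = 0")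
    case False
    then have "x \<in> bdp i" "x \<in> bdp 0" using piece_overlap [of i 0] piece_overlap [of 0 i] i x0 by auto
    then show ?thesis using fixed i(1) by (metis atLeastAtMost_iff le0)
  qed simp
  then show ?thesis using True by (simp add: glue_def)
next
  case False
  have "i \<noteq> 0"
  proof
    assume "i = 0"
    then show False using i(2) False by (simp add: piece_def)
  qed
  then have iP: "i \<in> {1..n}" "x \<in> P i" using i by (auto simp: piece_def)
  have "(SOME j. j \<in> {1..n} \<and> x \<in> P j) = i"
  proof (rule some_equality)
    fix j assume "j \<in> {1..n} \<and> x \<in> P j"
    then show "j = i" using P_disjoint [of i j] iP by blast
  qed (use iP in simp)
  then show ?thesis using False iP by (auto simp: glue_def)
qed

text \<open>Finitely many closed pieces are pasted. The parameter space \<open>Y\<close> lets one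
  argument serve single maps and isotopies.\<close>

lemma glue_continuous:
  assumes cont: "\<And>i. i \<in> {0..n} \<Longrightarrow> continuous_map (prod_topology Y (subtopology X (piece i))) X (\<lambda>p. H i (fst p) (snd p))"
    and fixed: "\<And>i t x. i \<in> {0..n} \<Longrightarrow> t \<in> topspace Y \<Longrightarrow> x \<in> bdp i \<Longrightarrow> H i t x = x"
  shows "continuous_map (prod_topology Y X) X (\<lambda>p. glue K n P (\<lambda>i. H i (fst p)) (snd p))"
proof (rule pasting_lemma_closed [where I = "{0..n}" and T = "\<lambda>i. topspace Y \<times> piece i"])
  show "closedin (prod_topology Y X) (topspace Y \<times> piece i)" if "i \<in> {0..n}" for i
    using piece_closed [OF that] by (simp add: closedin_prod_Times_iff)
  have S: "subtopology (prod_topology Y X) (topspace Y \<times> piece i) = prod_topology Y (subtopology X (piece i))" for i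
    by (simp add: subtopology_Times)
  show "continuous_map (subtopology (prod_topology Y X) (topspace Y \<times> piece i)) X (\<lambda>p. H i (fst p) (snd p))"
    if "i \<in> {0..n}" for i
    unfolding S by (rule cont [OF that])
  show "H i (fst p) (snd p) = H j (fst p) (snd p)"
    if "i \<in> {0..n}" "j \<in> {0..n}" "p \<in> topspace (prod_topology Y X) \<inter> (topspace Y \<times> piece i) \<inter> (topspace Y \<times> piece j)" for i j p
  proof (cases "i = j")
    case False
    have p: "fst p \<in> topspace Y" "snd p \<in> piece i" "snd p \<in> piece j" using that by auto
    have "snd p \<in> bdp i" "snd p \<in> bdp j"
      using piece_overlap [OF that(1,2) False p(2,3)] piece_overlap [OF that(2,1) _ p(3,2)] False by auto
    then show ?thesis using fixed [OF that(1) p(1)] fixed [OF that(2) p(1)] by simp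
  qed simp
  show "\<exists>j. j \<in> {0..n} \<and> p \<in> topspace Y \<times> piece j \<and> glue K n P (\<lambda>i. H i (fst p)) (snd p) = H j (fst p) (snd p)"
    if "p \<in> topspace (prod_topology Y X)" for p
  proof -
    have p: "fst p \<in> topspace Y" "snd p \<in> topspace X" using that by auto
    obtain j where j: "j \<in> {0..n}" "snd p \<in> piece j" using piece_cover [OF p(2)] .
    have "glue K n P (\<lambda>i. H i (fst p)) (snd p) = H j (fst p) (snd p)"
      by (rule glue_eq [OF _ j]) (use fixed p in blast)
    then show ?thesis using j p by (intro exI [of _ j]) (auto simp: mem_Times_iff)
  qed
qed simp

text \<open>The inverses of the pieces also fix the boundaries, so they glue to an inverse.\<close>

lemma glue_homeomorphic:
  assumes hom: "\<forall>i\<in>{0..n}. homeomorphic_map (subtopology X (piece i)) (subtopology X (piece i)) (hs i)"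
    and fixed: "\<forall>i\<in>{0..n}. \<forall>x\<in>bdp i. hs i x = x"
  shows "homeomorphic_map X X (glue K n P hs)"
proof -
  have "\<exists>g. homeomorphic_map (subtopology X (piece i)) (subtopology X (piece i)) g \<and>
      (\<forall>x\<in>piece i. g (hs i x) = x \<and> hs i (g x) = x \<and> g x \<in> piece i \<and> hs i x \<in> piece i)" if "i \<in> {0..n}" for i
    by (rule homeomorphic_map_inverse [OF hom [THEN bspec, OF that] piece_subset [OF that]]) blast
  then obtain gs where gs: "\<forall>i\<in>{0..n}. homeomorphic_map (subtopology X (piece i)) (subtopology X (piece i)) (gs i)"
    "\<And>i x. i \<in> {0..n} \<Longrightarrow> x \<in> piece i \<Longrightarrow> gs i (hs i x) = x \<and> hs i (gs i x) = x \<and> gs i x \<in> piece i \<and> hs i x \<in> piece i"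
    by metis
  have gfixed: "\<forall>i\<in>{0..n}. \<forall>x\<in>bdp i. gs i x = x"
  proof (intro ballI)
    fix i x assume ix: "i \<in> {0..n}" "x \<in> bdp i"
    then have "hs i x = x" "x \<in> piece i" using fixed bdp_subset(1) by blast+
    then show "gs i x = x" using gs(2) [OF ix(1), of x] by simp
  qed
  have cont: "continuous_map X X (glue K n P ks)"
    if ks: "\<forall>i\<in>{0..n}. homeomorphic_map (subtopology X (piece i)) (subtopology X (piece i)) (ks i)"
      "\<forall>i\<in>{0..n}. \<forall>x\<in>bdp i. ks i x = x" for ks
  proof -
    let ?I = "top_of_set {0..1::real}"
    \<comment> \<open>The single map is treated as a family constant in time and then evaluated at
      time 0.\<close>
    have "continuous_map (prod_topology ?I X) X (\<lambda>p. glue K n P (\<lambda>i. ks i) (snd p))"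
    proof (rule glue_continuous)
      fix i assume i: "i \<in> {0..n}"
      have "continuous_map (subtopology X (piece i)) X (ks i)"
        using homeomorphic_imp_continuous_map [OF ks(1) [THEN bspec, OF i]] continuous_map_into_fulltopology by blast
      from continuous_map_compose [OF continuous_map_snd this]
      show "continuous_map (prod_topology ?I (subtopology X (piece i))) X (\<lambda>p. ks i (snd p))"
        by (simp add: o_def)
    qed (use ks(2) in blast)
    from continuous_map_o_Pair [OF this, of 0] show ?thesis by (simp add: o_def)
  qed
  have "homeomorphic_maps X X (glue K n P hs) (glue K n P gs)"
    unfolding homeomorphic_maps_def
  proof (intro conjI ballI)
    show "continuous_map X X (glue K n P hs)" by (rule cont [OF hom fixed])
    show "continuous_map X X (glue K n P gs)" by (rule cont [OF gs(1) gfixed])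
    fix x assume "x \<in> topspace X"
    then obtain i where i: "i \<in> {0..n}" "x \<in> piece i" by (rule piece_cover)
    note gx = gs(2) [OF i]
    have "glue K n P hs x = hs i x" "glue K n P gs x = gs i x"
      "glue K n P gs (hs i x) = gs i (hs i x)" "glue K n P hs (gs i x) = hs i (gs i x)"
      using glue_eq [OF fixed i] glue_eq [OF gfixed i] glue_eq [OF gfixed i(1), of "hs i x"]
        glue_eq [OF fixed i(1), of "gs i x"] gx by auto
    then show "glue K n P gs (glue K n P hs x) = x" "glue K n P hs (glue K n P gs x) = x"
      using gx by simp_all
  qed
  then show ?thesis using homeomorphic_maps_map by blast
qed

definition pieces_homeos :: "(nat \<Rightarrow> 'a \<Rightarrow> 'a) \<Rightarrow> bool" where
  "pieces_homeos hs \<longleftrightarrow> (\<forall>i\<in>{0..n}. hs i \<in> homeos X At (piece i) (bdp i))"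

lemma pieces_homeosD:
  assumes "pieces_homeos hs"
  shows "\<forall>i\<in>{0..n}. homeomorphic_map (subtopology X (piece i)) (subtopology X (piece i)) (hs i)"
    "\<forall>i\<in>{0..n}. \<forall>x\<in>bdp i. hs i x = x"
    "\<And>i x. i \<in> {0..n} \<Longrightarrow> x \<in> piece i \<Longrightarrow> hs i x \<in> piece i"
proof -
  have h: "hs i \<in> homeos X At (piece i) (bdp i)" if "i \<in> {0..n}" for i
    using assms that by (simp add: pieces_homeos_def)
  show "\<forall>i\<in>{0..n}. homeomorphic_map (subtopology X (piece i)) (subtopology X (piece i)) (hs i)"
    by (intro ballI homeosD(1) [OF h])
  show "\<forall>i\<in>{0..n}. \<forall>x\<in>bdp i. hs i x = x"
    by (intro ballI homeosD(2) [OF h])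
  show "hs i x \<in> piece i" if "i \<in> {0..n}" "x \<in> piece i" for i x
    using homeos_image [OF h [OF that(1)] piece_subset [OF that(1)]] that(2) by blast
qed

lemma preserves_iff:
  assumes h: "homeomorphic_map X X h"
  shows "preserves h \<longleftrightarrow> h ` K = K \<and> (\<forall>i\<in>{1..n}. h ` P i = P i)"
proof -
  have surj: "h ` topspace X = topspace X" and inj: "inj_on h (topspace X)"
    using homeomorphic_imp_surjective_map [OF h] homeomorphic_imp_injective_map [OF h] by auto
  have "(\<forall>x\<in>topspace X. h x \<in> S \<longleftrightarrow> x \<in> S) \<longleftrightarrow> h ` S = S" if S: "S \<subseteq> topspace X" for S
  proof
    assume *: "\<forall>x\<in>topspace X. h x \<in> S \<longleftrightarrow> x \<in> S"
    show "h ` S = S"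
    proof
      show "h ` S \<subseteq> S" using * S by blast
      show "S \<subseteq> h ` S"
      proof
        fix y assume y: "y \<in> S"
        then obtain x where "x \<in> topspace X" "y = h x" using surj S by blast
        then show "y \<in> h ` S" using * y by blast
      qed
    qed
  next
    assume *: "h ` S = S"
    show "\<forall>x\<in>topspace X. h x \<in> S \<longleftrightarrow> x \<in> S"
    proof
      fix x assume x: "x \<in> topspace X"
      have "x \<in> S" if "h x \<in> S"
      proof -
        obtain y where y: "y \<in> S" "h y = h x" using \<open>h x \<in> S\<close> * by (metis imageE)
        then have "y = x" using inj_onD [OF inj y(2)] S x by blast
        then show ?thesis using y by simp
      qed
      then show "h x \<in> S \<longleftrightarrow> x \<in> S" using * by blast
    qed
  qed
  note eq = this
  have "preserves h \<longleftrightarrow> (\<forall>x\<in>topspace X. h x \<in> K \<longleftrightarrow> x \<in> K) \<and>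
      (\<forall>j\<in>{1..n}. \<forall>x\<in>topspace X. h x \<in> P j \<longleftrightarrow> x \<in> P j)"
    unfolding preserves_def by blast
  also have "\<dots> \<longleftrightarrow> h ` K = K \<and> (\<forall>i\<in>{1..n}. h ` P i = P i)"
    unfolding eq [OF K_subset] by (intro arg_cong2 [where f = "(\<and>)"] ball_cong refl eq P_subset)
  finally show ?thesis .
qed

text \<open>Inside a piece orientation is that of its factor. A point on a gluing circle is a limit
  of interior points of \<open>K\<close>, and there local constancy decides.\<close>

lemma glue_homeos:
  assumes hs: "pieces_homeos hs"
  shows "glue K n P hs \<in> homeos X At (topspace X) {}" "preserves (glue K n P hs)"
proof -
  note h = pieces_homeosD [OF hs]
  let ?h = "glue K n P hs"
  have hom: "homeomorphic_map X X ?h" by (rule glue_homeomorphic [OF h(1,2)])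
  have eq: "?h x = hs i x" if "i \<in> {0..n}" "x \<in> piece i" for i x
    by (rule glue_eq [OF h(2) that])
  have emb: "open_embedding_on X (topspace X) ?h"
    using homeomorphic_imp_continuous_map [OF hom] homeomorphic_imp_injective_map [OF hom]
    by (simp add: open_embedding_on_def)
  have loc: "orient_pres_local X At ?h p" if i: "i \<in> {0..n}" "p \<in> X interior_of (piece i)" for i p
  proof (rule orient_pres_local_cong [OF _ openin_interior_of i(2)])
    have "hs i \<in> homeos X At (piece i) (bdp i)" using hs i(1) by (simp add: pieces_homeos_def)
    then show "orient_pres_local X At (hs i) p"
      using i(2) unfolding homeos_iff [OF piece_subset [OF i(1)]] by blast
    show "hs i x = ?h x" if "x \<in> X interior_of (piece i)" for x
      using eq [OF i(1)] interior_of_subset that by (metis subsetD)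
  qed
  have "orient_pres_local X At ?h p" if p: "p \<in> topspace X" for p
  proof -
    obtain i where i: "i \<in> {0..n}" "p \<in> piece i" using piece_cover [OF p] .
    show ?thesis
    proof (cases "p \<in> X interior_of (piece i)")
      case True
      then show ?thesis using loc i by blast
    next
      case False
      then have "p \<in> bdp i" using i bdp_eq by blast
      then have "p \<in> K" using bdp_subset(2) [OF i(1)] bdK_eq by blast
      then have cl: "p \<in> X closure_of (X interior_of K)" using surface_wb_dense [OF K_subset K_surface] by blast
      obtain M where M: "openin X M" "p \<in> M"
        "\<And>q. q \<in> M \<Longrightarrow> orient_pres_local X At ?h q \<longleftrightarrow> orient_pres_local X At ?h p"
        using orient_pres_local_near [OF emb p] by metis
      then obtain q where q: "q \<in> X interior_of K" "q \<in> M" using cl by (auto simp: in_closure_of)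
      have "orient_pres_local X At ?h q" by (rule loc [of 0]) (use q in \<open>auto simp: piece_def\<close>)
      then show ?thesis using M(3) q by blast
    qed
  qed
  then show "?h \<in> homeos X At (topspace X) {}"
    using hom by (simp add: homeos_iff interior_of_topspace)
  have im: "?h ` piece i = piece i" if "i \<in> {0..n}" for i
  proof -
    have "hs i \<in> homeos X At (piece i) (bdp i)" using hs that by (simp add: pieces_homeos_def)
    then have "hs i ` piece i = piece i" by (rule homeos_image [OF _ piece_subset [OF that]])
    moreover have "?h ` piece i = hs i ` piece i" using eq [OF that] by (intro image_cong) auto
    ultimately show ?thesis by simp
  qed
  have "?h ` K = K" using im [of 0] by (simp add: piece_def)
  moreover have "?h ` P i = P i" if "i \<in> {1..n}" for i using im [of i] that by (auto simp: piece_def)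
  ultimately show "preserves ?h" using preserves_iff [OF hom] by blast
qed

text \<open>The isotopies fix the boundaries at all times, so every level glues to a homeomorphism
  and the family is jointly continuous. This is the reason why \<open>theta\<close> is independent
  of representatives.\<close>

lemma glue_isotopic:
  assumes iso: "\<And>i. i \<in> {0..n} \<Longrightarrow> isotopic X (piece i) (bdp i) (hs i) (ks i)"
    and hs: "pieces_homeos hs" and ks: "pieces_homeos ks"
  shows "isotopic X (topspace X) {} (glue K n P hs) (glue K n P ks)"
proof -
  let ?I = "top_of_set {0..1::real}"
  define Q where "Q i H \<longleftrightarrow> continuous_map (prod_topology ?I (subtopology X (piece i))) (subtopology X (piece i)) H \<and>
     (\<forall>t\<in>{0..1}. homeomorphic_map (subtopology X (piece i)) (subtopology X (piece i)) (\<lambda>x. H (t, x))) \<and>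
     (\<forall>x\<in>piece i. H (0, x) = hs i x \<and> H (1, x) = ks i x) \<and>
     (\<forall>t\<in>{0..1}. \<forall>x\<in>bdp i. H (t, x) = x)" for i H
  have "\<exists>H. Q i H" if "i \<in> {0..n}" for i
    using iso [OF that] unfolding isotopic_def Q_def .
  then obtain H where "\<forall>i. i \<in> {0..n} \<longrightarrow> Q i (H i)" by metis
  note H = this [unfolded Q_def]
  let ?G = "\<lambda>p. glue K n P (\<lambda>i x. H i (fst p, x)) (snd p)"
  have ends: "glue K n P (\<lambda>i x. H i (t, x)) x = glue K n P fs x"
    if tf: "t \<in> {0..1}" "pieces_homeos fs" "\<forall>i\<in>{0..n}. \<forall>x\<in>piece i. H i (t, x) = fs i x"
      "x \<in> topspace X" for t fs x
  proof -
    obtain i where i: "i \<in> {0..n}" "x \<in> piece i" using piece_cover [OF tf(4)] .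
    have "glue K n P (\<lambda>i x. H i (t, x)) x = H i (t, x)"
      by (rule glue_eq [OF _ i]) (use H tf(1) in blast)
    moreover have "glue K n P fs x = fs i x"
      by (rule glue_eq [OF pieces_homeosD(2) [OF tf(2)] i])
    ultimately show ?thesis using tf(3) i by simp
  qed
  show ?thesis
    unfolding isotopic_def
  proof (intro exI [of _ ?G] conjI ballI)
    have "continuous_map (prod_topology ?I X) X ?G"
    proof (rule glue_continuous)
      fix i assume "i \<in> {0..n}"
      then have "continuous_map (prod_topology ?I (subtopology X (piece i))) X (H i)"
        using H continuous_map_into_fulltopology by blast
      then show "continuous_map (prod_topology ?I (subtopology X (piece i))) X (\<lambda>p. H i (fst p, snd p))"
        by simp
    qed (use H in auto)
    then show "continuous_map (prod_topology ?I (subtopology X (topspace X))) (subtopology X (topspace X)) ?G" by simp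
    fix t :: real assume t: "t \<in> {0..1}"
    have "homeomorphic_map X X (glue K n P (\<lambda>i x. H i (t, x)))"
      by (rule glue_homeomorphic) (use H t in auto)
    then show "homeomorphic_map (subtopology X (topspace X)) (subtopology X (topspace X)) (\<lambda>x. ?G (t, x))" by simp
  next
    fix x assume x: "x \<in> topspace X"
    show "?G (0, x) = glue K n P hs x"
      using ends [OF _ hs _ x, of 0] H by simp
    show "?G (1, x) = glue K n P ks x"
      using ends [OF _ ks _ x, of 1] H by simp
  qed simp
qed

lemma glue_compose:
  assumes hs: "pieces_homeos hs" and ks: "pieces_homeos ks" and x: "x \<in> topspace X"
  shows "glue K n P (\<lambda>i. hs i \<circ> ks i) x = (glue K n P hs \<circ> glue K n P ks) x"
proof -
  obtain i where i: "i \<in> {0..n}" "x \<in> piece i" using piece_cover [OF x] .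
  note h = pieces_homeosD [OF hs] and k = pieces_homeosD [OF ks]
  have "glue K n P (\<lambda>i. hs i \<circ> ks i) x = (hs i \<circ> ks i) x"
    by (rule glue_eq [OF _ i]) (use h(2) k(2) in simp)
  moreover have "glue K n P ks x = ks i x" by (rule glue_eq [OF k(2) i])
  moreover have "glue K n P hs (ks i x) = hs i (ks i x)" by (rule glue_eq [OF h(2) i(1) k(3) [OF i]])
  ultimately show ?thesis by simp
qed

lemma pieces_homeos_compose:
  "pieces_homeos hs \<Longrightarrow> pieces_homeos ks \<Longrightarrow> pieces_homeos (\<lambda>i. hs i \<circ> ks i)"
  unfolding pieces_homeos_def using homeos_compose piece_subset by blast

lemma restrict_homeos:
  assumes h: "h \<in> homeos X At (topspace X) {}" and pres: "preserves h" and fixed: "\<forall>x\<in>bdK. h x = x"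
    and i: "i \<in> {0..n}"
  shows "h \<in> homeos X At (piece i) (bdp i)"
  unfolding homeos_iff [OF piece_subset [OF i]]
proof (intro conjI ballI)
  have hom: "homeomorphic_map X X h" using homeosD(1) [OF h] by simp
  have "h ` piece i = piece i" using preserves_iff [OF hom] pres i by (auto simp: piece_def)
  then show "homeomorphic_map (subtopology X (piece i)) (subtopology X (piece i)) h"
    using homeomorphic_map_subtopologies [OF hom, of "piece i" "piece i"] piece_subset [OF i]
    by (simp add: Int_absorb1)
  show "h x = x" if "x \<in> bdp i" for x using fixed bdp_subset(2) [OF i] that by blast
  show "orient_pres_local X At h p" if "p \<in> X interior_of (piece i)" for p
  proof -
    have "p \<in> topspace X" using that interior_of_subset_topspace by fast
    then show ?thesis using h by (simp add: homeos_iff interior_of_topspace)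
  qed
qed

section \<open>Classes of the whole surface and the subgroup of decomposition preserving
  ones\<close>

abbreviation "G \<equiv> MCG X At (topspace X) {}"
abbreviation "cl \<equiv> iso_class X At (topspace X) {}"
abbreviation "Homeo \<equiv> homeos X At (topspace X) {}"

lemma cl_eq: "f \<in> Homeo \<Longrightarrow> g \<in> Homeo \<Longrightarrow> isotopic X (topspace X) {} f g \<Longrightarrow> cl f = cl g"
  using iso_class_eq_iff by simp

lemma cl_cong:
  assumes "f \<in> Homeo" "g \<in> Homeo" "\<And>x. x \<in> topspace X \<Longrightarrow> f x = g x"
  shows "cl f = cl g"
proof (rule cl_eq [OF assms(1,2)])
  have "isotopic X (topspace X) {} f f" by (rule isotopic_refl [OF homeosD(1) [OF assms(1)]]) simp
  then show "isotopic X (topspace X) {} f g" by (rule isotopic_cong) (use assms in auto)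
qed

lemma cl_mult: "f \<in> Homeo \<Longrightarrow> g \<in> Homeo \<Longrightarrow> cl f \<otimes>\<^bsub>G\<^esub> cl g = cl (f \<circ> g)"
  by (rule iso_class_mult) auto

lemma cl_carrier: "A \<in> carrier G \<longleftrightarrow> (\<exists>f \<in> Homeo. A = cl f)"
  by (auto simp: MCG_def)

lemma group_G: "group G"
  by (rule MCG_group) auto

lemma Homeo_inverse:
  assumes "f \<in> Homeo"
  obtains g where "g \<in> Homeo" "\<And>x. x \<in> topspace X \<Longrightarrow> g (f x) = x \<and> f (g x) = x \<and> g x \<in> topspace X \<and> f x \<in> topspace X"
    "inv\<^bsub>G\<^esub> (cl f) = cl g"
proof -
  obtain g where g: "g \<in> Homeo" "\<And>x. x \<in> topspace X \<Longrightarrow> g (f x) = x \<and> f (g x) = x \<and> g x \<in> topspace X \<and> f x \<in> topspace X"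
    by (rule homeos_inverse [OF assms order_refl empty_subsetI], rule that)
  have "cl g \<otimes>\<^bsub>G\<^esub> cl f = cl (g \<circ> f)" by (rule cl_mult [OF g(1) assms])
  also have "\<dots> = cl id"
    by (rule cl_cong) (use g homeos_compose [OF assms g(1)] homeos_id in auto)
  also have "\<dots> = \<one>\<^bsub>G\<^esub>" by (simp add: MCG_def)
  finally have "inv\<^bsub>G\<^esub> (cl f) = cl g"
    using group.inv_equality [OF group_G] assms g(1) cl_carrier by blast
  with g show ?thesis using that by blast
qed

lemma NF_iff: "A \<in> NF X At K n P \<longleftrightarrow> (\<exists>h \<in> Homeo. preserves h \<and> A = cl h)"
proof
  assume "A \<in> NF X At K n P"
  then obtain h where h: "A \<in> carrier G" "h \<in> A" "h ` K = K \<and> (\<forall>i\<in>{1..n}. h ` P i = P i)"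
    by (auto simp: NF_def)
  have "h \<in> Homeo" "A = cl h" using iso_class_member [OF h(1,2)] by auto
  then show "\<exists>h \<in> Homeo. preserves h \<and> A = cl h"
    using preserves_iff [of h] h(3) homeosD(1) [of h] by fastforce
next
  assume "\<exists>h \<in> Homeo. preserves h \<and> A = cl h"
  then obtain h where h: "h \<in> Homeo" "preserves h" "A = cl h" by blast
  then have "h \<in> A" using iso_class_self by blast
  moreover have "h ` K = K \<and> (\<forall>i\<in>{1..n}. h ` P i = P i)"
    using preserves_iff [of h] h(2) homeosD(1) [OF h(1)] by simp
  ultimately show "A \<in> NF X At K n P" using h cl_carrier by (auto simp: NF_def)
qed

lemma Homeo_image: "f \<in> Homeo \<Longrightarrow> f ` topspace X = topspace X"
  by (rule homeos_image) auto

lemma NF_subgroup: "subgroup (NF X At K n P) G"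
proof (rule group.subgroupI [OF group_G])
  show "NF X At K n P \<subseteq> carrier G" by (auto simp: NF_def)
  have "cl id \<in> NF X At K n P"
    unfolding NF_iff using homeos_id by (intro bexI [of _ id]) (auto simp: preserves_def)
  then show "NF X At K n P \<noteq> {}" by blast
  fix A assume "A \<in> NF X At K n P"
  then obtain f where f: "f \<in> Homeo" "preserves f" "A = cl f" using NF_iff by blast
  obtain g where g: "g \<in> Homeo" "\<And>x. x \<in> topspace X \<Longrightarrow> g (f x) = x \<and> f (g x) = x \<and> g x \<in> topspace X \<and> f x \<in> topspace X"
    "inv\<^bsub>G\<^esub> (cl f) = cl g"
    by (rule Homeo_inverse [OF f(1)], rule that)
  have "preserves g" using f(2) g(2) unfolding preserves_def by metis
  then show "inv\<^bsub>G\<^esub> A \<in> NF X At K n P" using f g NF_iff by auto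
  fix B assume "B \<in> NF X At K n P"
  then obtain k where k: "k \<in> Homeo" "preserves k" "B = cl k" using NF_iff by blast
  have "f \<circ> k \<in> Homeo" by (rule homeos_compose [OF k(1) f(1)]) simp
  moreover have "preserves (f \<circ> k)"
    by (rule preserves_compose [OF k(2) f(2)]) (simp add: Homeo_image [OF k(1)])
  ultimately show "A \<otimes>\<^bsub>G\<^esub> B \<in> NF X At K n P"
    using cl_mult [OF f(1) k(1)] f k NF_iff by auto
qed

text \<open>Off the boundary circle each collar is a continuous image of the complement of the
  closed unit disc, which is connected. Those containing a fixed collar share a point and cover the
  pipe.\<close>

lemma pipe_interior_connected:
  assumes i: "i \<in> {1..n}"
  shows "connectedin X (P i - K)"
proof -
  obtain I r and U :: "'a set \<Rightarrow> 'a set" where I: "well_order_on I r" "uncountable I" "(\<Union>\<alpha>\<in>I. U \<alpha>) = P i"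
    and col: "\<And>\<alpha>. \<alpha> \<in> I \<Longrightarrow> \<exists>e. collar i e \<and> e ` outer = U \<alpha>"
    and mono: "\<And>\<alpha> \<beta>. \<alpha> \<in> I \<Longrightarrow> \<beta> \<in> I \<Longrightarrow> (\<alpha>,\<beta>) \<in> r \<Longrightarrow> U \<alpha> \<subseteq> U \<beta>"
    by (rule pipe_exhaustion [OF i], rule that)
  have tot: "U \<alpha> \<subseteq> U \<beta> \<or> U \<beta> \<subseteq> U \<alpha>" if "\<alpha> \<in> I" "\<beta> \<in> I" for \<alpha> \<beta>
    using I(1) mono that unfolding well_order_on_def linear_order_on_def total_on_def by (metis order_refl)
  have UK: "connectedin X (U \<alpha> - K) \<and> U \<alpha> - K \<noteq> {}" if \<alpha>: "\<alpha> \<in> I" for \<alpha>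
  proof -
    obtain e where e: "collar i e" "e ` outer = U \<alpha>" using col [OF \<alpha>] by blast
    note c = collar_facts [OF i e(1)]
    have "U \<alpha> - K = e ` {w \<in> outer. norm w \<noteq> 1}"
      using c(6) unfolding e(2) [symmetric] by blast
    moreover have "{w \<in> outer. norm w \<noteq> 1} = - cball 0 1" by auto
    ultimately have eq: "U \<alpha> - K = e ` (- cball 0 1)" by simp
    have "connected (- cball (0::complex) 1)"
      by (rule connected_complement_bounded_convex) auto
    then have "connectedin (top_of_set outer) (- cball 0 1)"
      by (auto simp: connectedin_subtopology)
    then have "connectedin X (e ` (- cball 0 1))"
      using connectedin_continuous_map_image c(1) by blast
    moreover have "(2::complex) \<in> - cball 0 1" by simp
    ultimately show ?thesis unfolding eq by blast
  qed
  obtain \<alpha>0 where \<alpha>0: "\<alpha>0 \<in> I" using I(2) by fastforce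
  obtain p where p: "p \<in> U \<alpha>0 - K" using UK [OF \<alpha>0] by blast
  have "P i - K = \<Union>{U \<alpha> - K | \<alpha>. \<alpha> \<in> I \<and> U \<alpha>0 \<subseteq> U \<alpha>}"
  proof
    show "P i - K \<subseteq> \<Union>{U \<alpha> - K | \<alpha>. \<alpha> \<in> I \<and> U \<alpha>0 \<subseteq> U \<alpha>}"
    proof
      fix x assume x: "x \<in> P i - K"
      then obtain \<alpha> where "\<alpha> \<in> I" "x \<in> U \<alpha>" using I(3) by blast
      then obtain \<beta> where "\<beta> \<in> I" "x \<in> U \<beta>" "U \<alpha>0 \<subseteq> U \<beta>" using tot [OF \<alpha>0, of \<alpha>] \<alpha>0 by blast
      then show "x \<in> \<Union>{U \<alpha> - K | \<alpha>. \<alpha> \<in> I \<and> U \<alpha>0 \<subseteq> U \<alpha>}" using x by blast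
    qed
    show "\<Union>{U \<alpha> - K | \<alpha>. \<alpha> \<in> I \<and> U \<alpha>0 \<subseteq> U \<alpha>} \<subseteq> P i - K" using I(3) by blast
  qed
  moreover have "connectedin X (\<Union>{U \<alpha> - K | \<alpha>. \<alpha> \<in> I \<and> U \<alpha>0 \<subseteq> U \<alpha>})"
    by (rule connectedin_Union) (use UK p in blast)+
  ultimately show ?thesis by simp
qed

lemma interior_pipe: "i \<in> {1..n} \<Longrightarrow> X interior_of (P i) = P i - K"
  using bd_eq P_Int_K interior_of_subset [of X "P i"] by blast

text \<open>The danger is that the pipes are permuted. The image of the connected set
  \<open>P i - K\<close> lies in one open pipe \<open>P j - K\<close>; by continuity the boundary
  circle \<open>bd i\<close>, which is fixed, lies in the closed set \<open>P j\<close>, so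
  \<open>j = i\<close>.\<close>

lemma fixing_K_preserves:
  assumes k: "k \<in> Homeo" and fix_K: "\<forall>x\<in>K. k x = x"
  shows "preserves k"
proof -
  have fixed: "k x = x" if "x \<in> K" for x using fix_K that by blast
  have hom: "homeomorphic_map X X k" using homeosD(1) [OF k] by simp
  have inj: "inj_on k (topspace X)" using homeomorphic_imp_injective_map [OF hom] .
  have cont: "continuous_map X X k" using homeomorphic_imp_continuous_map [OF hom] .
  have memK: "k x \<in> K \<longleftrightarrow> x \<in> K" if "x \<in> topspace X" for x
    using fixed [of x] fixed [of "k x"] inj_onD [OF inj, of "k x" x] that K_subset by (metis subsetD)
  have sub: "k x \<in> P i" if i: "i \<in> {1..n}" and x: "x \<in> P i" for i x
  proof (cases "x \<in> K")
    case True
    then show ?thesis using fixed x by simp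
  next
    case False
    have xX: "x \<in> topspace X" using P_subset [OF i] x by blast
    then have "k x \<in> topspace X" using cont by (auto simp: continuous_map_def Pi_iff)
    then obtain j where j: "j \<in> {1..n}" "k x \<in> P j" using cover memK [OF xX] False by blast
    let ?A = "k ` (P i - K)"
    have conn: "connectedin X ?A"
      by (rule connectedin_continuous_map_image [OF cont pipe_interior_connected [OF i]])
    have opj: "openin X (P l - K)" if "l \<in> {1..n}" for l
      using interior_pipe [OF that] openin_interior_of by metis
    have Acov: "?A \<subseteq> (P j - K) \<union> (\<Union>l\<in>{1..n}-{j}. P l - K)"
    proof
      fix w assume "w \<in> ?A"
      then obtain y where y: "y \<in> P i" "y \<notin> K" "w = k y" by blast
      have yX: "y \<in> topspace X" using P_subset [OF i] y by blast
      then have "k y \<in> topspace X" "k y \<notin> K" using cont memK y by (auto simp: continuous_map_def Pi_iff)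
      then show "w \<in> (P j - K) \<union> (\<Union>l\<in>{1..n}-{j}. P l - K)" using cover y(3) by blast
    qed
    have op2: "openin X (\<Union>l\<in>{1..n}-{j}. P l - K)" using opj by blast
    have disj: "(P j - K) \<inter> (\<Union>l\<in>{1..n}-{j}. P l - K) \<inter> ?A = {}"
      using P_disjoint [OF j(1)] by blast
    have ne: "(P j - K) \<inter> ?A \<noteq> {}" using j(2) x False memK [OF xX] by blast
    have "(\<Union>l\<in>{1..n}-{j}. P l - K) \<inter> ?A = {}"
      using conn opj [OF j(1)] op2 Acov disj ne unfolding connectedin by blast
    then have Aj: "?A \<subseteq> P j" using Acov by blast
    obtain q where q: "q \<in> bd i" using bd_nonempty [OF i] by blast
    have wb: "surface_wb (subtopology X (P i))" using P_pipe [OF i] by (simp add: long_pipe_def)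
    have "q \<in> X closure_of (P i - K)"
      using surface_wb_dense [OF P_subset [OF i] wb] q bd_subset(1) [OF i] interior_pipe [OF i] by auto
    then have "k q \<in> X closure_of ?A"
      using continuous_map_image_closure_subset [OF cont, of "P i - K"] by blast
    then have "k q \<in> P j" using closure_of_minimal [OF Aj P_closed [OF j(1)]] by blast
    moreover have "k q = q" by (rule fixed) (use q bd_subset(2) [OF i] in blast)
    ultimately have "q \<in> P j" "q \<in> P i" using q bd_subset(1) [OF i] by auto
    then have "i = j" using P_disjoint [OF i j(1)] by blast
    then show ?thesis using j by simp
  qed
  have "x \<in> P i" if i: "i \<in> {1..n}" and x: "x \<in> topspace X" "k x \<in> P i" for i x
  proof (cases "x \<in> K")
    case True
    then show ?thesis using fixed x by simp
  next
    case False
    then obtain j where j: "j \<in> {1..n}" "x \<in> P j" using cover x(1) by blast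
    then have "k x \<in> P j" by (rule sub)
    then have "j = i" using P_disjoint [OF j(1) i] x(2) by blast
    then show ?thesis using j by simp
  qed
  then show ?thesis unfolding preserves_def using memK sub by blast
qed

text \<open>By injectivity nothing enters or leaves a pipe, and points off all pipes belong to
  \<open>K\<close>.\<close>

lemma fixing_pipes_preserves:
  assumes k: "k \<in> Homeo" and fix_P: "\<forall>i\<in>{1..n}. \<forall>x\<in>P i. k x = x"
  shows "preserves k"
proof -
  have fixed: "k x = x" if "i \<in> {1..n}" "x \<in> P i" for i x using fix_P that by blast
  have hom: "homeomorphic_map X X k" using homeosD(1) [OF k] by simp
  have inj: "inj_on k (topspace X)" using homeomorphic_imp_injective_map [OF hom] .
  have kX: "k x \<in> topspace X" if "x \<in> topspace X" for x using Homeo_image [OF k] that by blast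
  have memP: "k x \<in> P i \<longleftrightarrow> x \<in> P i" if i: "i \<in> {1..n}" and x: "x \<in> topspace X" for i x
    using fixed [OF i, of x] fixed [OF i, of "k x"] inj_onD [OF inj, of "k x" x] kX [OF x] x by metis
  have "k x \<in> K \<longleftrightarrow> x \<in> K" if x: "x \<in> topspace X" for x
  proof (cases "\<exists>i\<in>{1..n}. x \<in> P i")
    case True
    then show ?thesis using fixed by auto
  next
    case False
    then have "\<not> (\<exists>i\<in>{1..n}. k x \<in> P i)" using memP x by blast
    then show ?thesis using False x kX [OF x] cover by blast
  qed
  then show ?thesis unfolding preserves_def using memP by blast
qed

lemma push_Homeo:
  assumes "compactin X C"
  obtains f g where "f \<in> Homeo" "g \<in> Homeo" "isotopic X (topspace X) {} f id" "isotopic X (topspace X) {} g id"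
    "\<And>x. x \<in> topspace X \<Longrightarrow> g (f x) = x \<and> f (g x) = x \<and> g x \<in> topspace X \<and> f x \<in> topspace X"
    "\<And>i. i \<in> {1..n} \<Longrightarrow> f ` P i \<subseteq> P i - C"
proof -
  obtain f where f: "homeomorphic_map X X f" "isotopic X (topspace X) {} f id" "\<And>i. i \<in> {1..n} \<Longrightarrow> f ` P i \<subseteq> P i - C"
    by (rule push [OF assms], rule that)
  have fH: "f \<in> Homeo"
    by (rule homeos_isotopic [OF isotopic_sym [OF f(2)] homeos_id]) simp
  obtain g where g: "g \<in> Homeo" "\<And>x. x \<in> topspace X \<Longrightarrow> g (f x) = x \<and> f (g x) = x \<and> g x \<in> topspace X \<and> f x \<in> topspace X"
    by (rule Homeo_inverse [OF fH], rule that)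
  have grefl: "isotopic X (topspace X) {} g g"
    by (rule isotopic_refl [OF homeosD(1) [OF g(1)]]) simp
  have "isotopic X (topspace X) {} id g"
    by (rule isotopic_cong [OF isotopic_compose [OF grefl f(2)]]) (use g(2) in auto)
  then have "isotopic X (topspace X) {} g id" by (rule isotopic_sym)
  then show ?thesis using that fH g f by blast
qed

lemma isotopic_refl_Homeo: "f \<in> Homeo \<Longrightarrow> isotopic X (topspace X) {} f f"
  by (rule isotopic_refl [OF homeosD(1)]) auto

text \<open>A conjugate of a homeomorphism supported in K is supported in a compact set, hence is the identity
  on the pipes after they have been pushed off this set.\<close>
lemma conjugate_K_supported:
  assumes g: "g \<in> Homeo" and g': "g' \<in> Homeo" "\<forall>x\<in>topspace X. g' (g x) = x \<and> g (g' x) = x"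
    and h: "h \<in> Homeo" and fixed: "\<forall>i\<in>{1..n}. \<forall>x\<in>P i. h x = x"
  shows "cl (g \<circ> h \<circ> g') \<in> NF X At K n P"
proof -
  have gc: "continuous_map X X g" using homeosD(1) [OF g] homeomorphic_imp_continuous_map by fastforce
  have "compactin X K" using K_compact K_subset by (simp add: compactin_subspace)
  then have C: "compactin X (g ` K)" using image_compactin gc by blast
  obtain f f' where f: "f \<in> Homeo" "f' \<in> Homeo" "isotopic X (topspace X) {} f id" "isotopic X (topspace X) {} f' id"
    and ff': "\<And>x. x \<in> topspace X \<Longrightarrow> f' (f x) = x \<and> f (f' x) = x \<and> f' x \<in> topspace X \<and> f x \<in> topspace X"
    and fC: "\<And>i. i \<in> {1..n} \<Longrightarrow> f ` P i \<subseteq> P i - g ` K"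
    by (rule push_Homeo [OF C], rule that)
  let ?q = "g \<circ> h \<circ> g'"
  \<comment> \<open>The push \<open>f\<close> is isotopic to the identity, so the class does not
    change. On a pushed pipe point, \<open>g'\<close> leads outside \<open>K\<close> and hence into
    a pipe, where \<open>h\<close> is the identity.\<close>
  let ?k = "f' \<circ> ?q \<circ> f"
  have q: "?q \<in> Homeo" by (intro homeos_compose g g' h order_refl)
  have k: "?k \<in> Homeo" by (intro homeos_compose [OF f(1)] homeos_compose [OF q f(2)] order_refl)
  have "\<forall>i\<in>{1..n}. \<forall>x\<in>P i. ?k x = x"
  proof (intro ballI)
    fix i x assume i: "i \<in> {1..n}" and x: "x \<in> P i"
    have xX: "x \<in> topspace X" using P_subset [OF i] x by blast
    let ?y = "f x"
    have yX: "?y \<in> topspace X" and yC: "?y \<notin> g ` K" using ff' [OF xX] fC [OF i] x by auto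
    have g'y: "g' ?y \<in> topspace X" using Homeo_image [OF g'(1)] yX by blast
    have "g' ?y \<notin> K" using yC g'(2) [THEN bspec, OF yX] by force
    then obtain j where "j \<in> {1..n}" "g' ?y \<in> P j" using cover g'y by blast
    then have "?q ?y = ?y" using fixed g'(2) [THEN bspec, OF yX] by simp
    then show "?k x = x" using ff' [OF xX] by simp
  qed
  then have "preserves ?k" by (rule fixing_pipes_preserves [OF k])
  moreover have "isotopic X (topspace X) {} ?k ?q"
    using isotopic_compose [OF isotopic_compose [OF f(4) isotopic_refl_Homeo [OF q]] f(3)] by simp
  then have "cl ?k = cl ?q" by (rule cl_eq [OF k q])
  ultimately show ?thesis using k NF_iff by metis
qed

lemma conjugate_pipe_supported:
  assumes g: "g \<in> Homeo" and g': "g' \<in> Homeo" "\<forall>x\<in>topspace X. g' (g x) = x \<and> g (g' x) = x"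
    and h: "h \<in> Homeo" and fixed: "\<forall>x\<in>K. h x = x"
  shows "cl (g \<circ> h \<circ> g') \<in> NF X At K n P"
proof -
  have gc: "continuous_map X X g'" using homeosD(1) [OF g'(1)] homeomorphic_imp_continuous_map by fastforce
  have "compactin X K" using K_compact K_subset by (simp add: compactin_subspace)
  then have C: "compactin X (g' ` K)" using image_compactin gc by blast
  obtain f f' where f: "f \<in> Homeo" "f' \<in> Homeo" "isotopic X (topspace X) {} f id" "isotopic X (topspace X) {} f' id"
    and ff': "\<And>x. x \<in> topspace X \<Longrightarrow> f' (f x) = x \<and> f (f' x) = x \<and> f' x \<in> topspace X \<and> f x \<in> topspace X"
    and fC: "\<And>i. i \<in> {1..n} \<Longrightarrow> f ` P i \<subseteq> P i - g' ` K"
    by (rule push_Homeo [OF C], rule that)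
  let ?m = "f \<circ> h \<circ> f'"
  let ?k = "g \<circ> ?m \<circ> g'"
  have m: "?m \<in> Homeo" by (intro homeos_compose [OF f(2)] homeos_compose [OF h f(1)] order_refl)
  have k: "?k \<in> Homeo" by (intro homeos_compose [OF g'(1)] homeos_compose [OF m g] order_refl)
  have q: "g \<circ> h \<circ> g' \<in> Homeo" by (intro homeos_compose g g' h order_refl)
  have "\<forall>x\<in>K. ?k x = x"
  proof
    fix x assume x: "x \<in> K"
    have xX: "x \<in> topspace X" using K_subset x by blast
    have zX: "g' x \<in> topspace X" using Homeo_image [OF g'(1)] xX by blast
    let ?y = "f' (g' x)"
    have yX: "?y \<in> topspace X" and fy: "f ?y = g' x" using ff' [OF zX] by auto
    have "?y \<notin> P i" if "i \<in> {1..n}" for i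
    proof
      assume "?y \<in> P i"
      then have "f ?y \<notin> g' ` K" using fC [OF that] by blast
      then show False using fy x by auto
    qed
    then have "?y \<in> K" using yX cover by blast
    then show "?k x = x" using fixed fy g'(2) [THEN bspec, OF xX] by simp
  qed
  then have "preserves ?k" by (rule fixing_K_preserves [OF k])
  moreover have "isotopic X (topspace X) {} ?m h"
    using isotopic_compose [OF isotopic_compose [OF f(3) isotopic_refl_Homeo [OF h]] f(4)] by simp
  then have "isotopic X (topspace X) {} ?k (g \<circ> h \<circ> g')"
    by (intro isotopic_compose isotopic_refl_Homeo g g' order_refl)
  then have "cl ?k = cl (g \<circ> h \<circ> g')" by (rule cl_eq [OF k q])
  ultimately show ?thesis using k NF_iff by metis
qed

lemma NF_normal: "NF X At K n P \<lhd> G"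
  unfolding group.normal_inv_iff [OF group_G]
proof (intro conjI ballI NF_subgroup)
  fix A B assume "A \<in> carrier G" "B \<in> NF X At K n P"
  obtain g where g: "g \<in> Homeo" "A = cl g" using \<open>A \<in> carrier G\<close> cl_carrier by auto
  obtain h0 where h0: "h0 \<in> Homeo" "preserves h0" "B = cl h0"
    using \<open>B \<in> NF X At K n P\<close> NF_iff by auto
  obtain h where h: "h \<in> Homeo" "isotopic X (topspace X) {} h h0" "preserves h" "\<forall>x\<in>bdK. h x = x"
    using straighten [OF h0(1,2)] by metis
  have B: "B = cl h" using cl_eq [OF h(1) h0(1) h(2)] h0(3) by simp
  obtain g' where g': "g' \<in> Homeo" "\<And>x. x \<in> topspace X \<Longrightarrow> g' (g x) = x \<and> g (g' x) = x \<and> g' x \<in> topspace X \<and> g x \<in> topspace X"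
    "inv\<^bsub>G\<^esub> (cl g) = cl g'"
    by (rule Homeo_inverse [OF g(1)], rule that)
  have g'': "\<forall>x\<in>topspace X. g' (g x) = x \<and> g (g' x) = x" using g'(2) by blast
  \<comment> \<open>Families indexed by the pieces. Both are admissible for gluing because the
    straightened \<open>h\<close> is the identity on \<open>bdK\<close>; their glued maps are the
    two factors of \<open>h\<close>.\<close>
  define h1 where "h1 = (\<lambda>i::nat. if i = 0 then h else id)"
  define h2 where "h2 = (\<lambda>i::nat. if i = 0 then id else h)"
  have ph: "pieces_homeos h1" "pieces_homeos h2"
    unfolding pieces_homeos_def h1_def h2_def
    using restrict_homeos [OF h(1,3,4)] homeos_id piece_subset by auto
  let ?f1 = "glue K n P h1" and ?f2 = "glue K n P h2"
  note f1 = glue_homeos(1) [OF ph(1)] and f2 = glue_homeos(1) [OF ph(2)]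
  have "\<forall>i\<in>{1..n}. \<forall>x\<in>P i. ?f1 x = x"
    using glue_eq [OF pieces_homeosD(2) [OF ph(1)]] by (auto simp: piece_def h1_def)
  then have 1: "cl (g \<circ> ?f1 \<circ> g') \<in> NF X At K n P"
    by (rule conjugate_K_supported [OF g(1) g'(1) g'' f1])
  have "\<forall>x\<in>K. ?f2 x = x"
    using glue_eq [OF pieces_homeosD(2) [OF ph(2)], of 0] by (auto simp: piece_def h2_def)
  then have 2: "cl (g \<circ> ?f2 \<circ> g') \<in> NF X At K n P"
    by (rule conjugate_pipe_supported [OF g(1) g'(1) g'' f2])
  have c1: "g \<circ> ?f1 \<circ> g' \<in> Homeo" and c2: "g \<circ> ?f2 \<circ> g' \<in> Homeo" and c3: "g \<circ> h \<circ> g' \<in> Homeo"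
    by (intro homeos_compose g g' f1 f2 h(1) order_refl)+
  have f12: "?f1 (?f2 x) = h x" if x: "x \<in> topspace X" for x
  proof -
    obtain i where i: "i \<in> {0..n}" "x \<in> piece i" using piece_cover [OF x] .
    have "(?f1 \<circ> ?f2) x = glue K n P (\<lambda>i. h1 i \<circ> h2 i) x"
      using glue_compose [OF ph x] by simp
    also have "\<dots> = (h1 i \<circ> h2 i) x"
      by (rule glue_eq [OF pieces_homeosD(2) [OF pieces_homeos_compose [OF ph]] i])
    also have "\<dots> = h x" by (simp add: h1_def h2_def)
    finally show ?thesis by simp
  qed
  have f2X: "?f2 x \<in> topspace X" if "x \<in> topspace X" for x using Homeo_image [OF f2] that by blast
  have "cl (g \<circ> ?f1 \<circ> g') \<otimes>\<^bsub>G\<^esub> cl (g \<circ> ?f2 \<circ> g') = cl ((g \<circ> ?f1 \<circ> g') \<circ> (g \<circ> ?f2 \<circ> g'))"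
    by (rule cl_mult [OF c1 c2])
  also have "\<dots> = cl (g \<circ> h \<circ> g')"
    by (rule cl_cong [OF homeos_compose [OF c2 c1 order_refl] c3]) (use g'(2) f12 f2X in simp)
  also have "\<dots> = A \<otimes>\<^bsub>G\<^esub> B \<otimes>\<^bsub>G\<^esub> inv\<^bsub>G\<^esub> A"
    using cl_mult [OF g(1) h(1)] cl_mult [OF homeos_compose [OF h(1) g(1) order_refl] g'(1)] g(2) B g'(3) by simp
  finally show "A \<otimes>\<^bsub>G\<^esub> B \<otimes>\<^bsub>G\<^esub> inv\<^bsub>G\<^esub> A \<in> NF X At K n P"
    using subgroup.m_closed [OF NF_subgroup 1 2] by simp
qed

section \<open>Choice of representatives and the epimorphism\<close>

abbreviation "M \<equiv> product_group {0..n} (factor_MCG X At K P)"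

lemma representatives:
  assumes A: "A \<in> carrier M" and hs: "\<forall>i\<in>{0..n}. hs i \<in> A i"
  shows "pieces_homeos hs" "\<And>i. i \<in> {0..n} \<Longrightarrow> A i = iso_class X At (piece i) (bdp i) (hs i)"
proof -
  have "A i \<in> carrier (MCG X At (piece i) (bdp i))" if "i \<in> {0..n}" for i
    using A that factor_MCG_eq by (auto simp: PiE_iff)
  note m = iso_class_member [OF this _ piece_subset bdp_subset(1)]
  show "pieces_homeos hs"
    unfolding pieces_homeos_def by (intro ballI m(1)) (use hs in auto)
  show "A i = iso_class X At (piece i) (bdp i) (hs i)" if "i \<in> {0..n}" for i
    by (rule m(2)) (use hs that in auto)
qed

lemma representatives_exist:
  assumes A: "A \<in> carrier M"
  shows "\<forall>i\<in>{0..n}. (SOME h. h \<in> A i) \<in> A i"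
proof
  fix i assume i: "i \<in> {0..n}"
  have "A i \<in> carrier (MCG X At (piece i) (bdp i))"
    using A i factor_MCG_eq by (auto simp: PiE_iff)
  then obtain f where "f \<in> homeos X At (piece i) (bdp i)" "A i = iso_class X At (piece i) (bdp i) f"
    by (auto simp: MCG_def)
  then have "f \<in> A i" using iso_class_self by simp
  then show "(SOME h. h \<in> A i) \<in> A i" by (rule someI [of "\<lambda>h. h \<in> A i"])
qed

text \<open>\<open>theta\<close> uses an arbitrary choice of representatives; isotopic ones on every
  piece glue to isotopic maps, so any other choice gives the same class.\<close>

lemma theta_eq:
  assumes A: "A \<in> carrier M" and hs: "\<forall>i\<in>{0..n}. hs i \<in> A i"
  shows "cl (glue K n P hs) = theta X At K n P A"
proof -
  let ?ks = "\<lambda>i. SOME h. h \<in> A i"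
  note h = representatives [OF A hs]
  note k = representatives [OF A representatives_exist [OF A]]
  have iso: "isotopic X (piece i) (bdp i) (hs i) (?ks i)" if i: "i \<in> {0..n}" for i
    using iso_class_eq_iff [OF _ _ piece_subset [OF i] bdp_subset(1) [OF i], of "hs i" "?ks i"] h k i
    by (simp add: pieces_homeos_def)
  have "isotopic X (topspace X) {} (glue K n P hs) (glue K n P ?ks)"
    by (rule glue_isotopic [OF iso h(1) k(1)])
  from cl_eq [OF glue_homeos(1) [OF h(1)] glue_homeos(1) [OF k(1)] this]
  show ?thesis unfolding theta_def .
qed

lemma product_mult:
  assumes A: "A \<in> carrier M" and B: "B \<in> carrier M"
    and hs: "\<forall>i\<in>{0..n}. hs i \<in> A i" and ks: "\<forall>i\<in>{0..n}. ks i \<in> B i"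
  shows "A \<otimes>\<^bsub>M\<^esub> B \<in> carrier M" "\<forall>i\<in>{0..n}. hs i \<circ> ks i \<in> (A \<otimes>\<^bsub>M\<^esub> B) i"
proof -
  note h = representatives [OF A hs] and k = representatives [OF B ks]
  have mem: "hs i \<circ> ks i \<in> homeos X At (piece i) (bdp i)" if "i \<in> {0..n}" for i
    using pieces_homeos_compose [OF h(1) k(1)] that by (simp add: pieces_homeos_def)
  have eq: "(A \<otimes>\<^bsub>M\<^esub> B) i = iso_class X At (piece i) (bdp i) (hs i \<circ> ks i)" if i: "i \<in> {0..n}" for i
  proof -
    have "(A \<otimes>\<^bsub>M\<^esub> B) i = A i \<otimes>\<^bsub>MCG X At (piece i) (bdp i)\<^esub> B i"
      using i by (simp add: product_group_def factor_MCG_eq)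
    also have "\<dots> = iso_class X At (piece i) (bdp i) (hs i) \<otimes>\<^bsub>MCG X At (piece i) (bdp i)\<^esub>
        iso_class X At (piece i) (bdp i) (ks i)"
      using h(2) [OF i] k(2) [OF i] by simp
    also have "\<dots> = iso_class X At (piece i) (bdp i) (hs i \<circ> ks i)"
      by (rule iso_class_mult) (use h(1) k(1) i piece_subset bdp_subset(1) in \<open>auto simp: pieces_homeos_def\<close>)
    finally show ?thesis .
  qed
  show "\<forall>i\<in>{0..n}. hs i \<circ> ks i \<in> (A \<otimes>\<^bsub>M\<^esub> B) i"
    using eq iso_class_self [OF mem] by simp
  have "(A \<otimes>\<^bsub>M\<^esub> B) \<in> extensional {0..n}" by (simp add: product_group_def)
  moreover have "(A \<otimes>\<^bsub>M\<^esub> B) i \<in> carrier (factor_MCG X At K P i)" if i: "i \<in> {0..n}" for i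
    using eq [OF i] iso_class_carrier [OF mem [OF i]] by (simp add: factor_MCG_eq)
  ultimately show "A \<otimes>\<^bsub>M\<^esub> B \<in> carrier M" by (simp add: PiE_iff)
qed

lemma theta_epi: "theta X At K n P \<in> epi M (G\<lparr>carrier := NF X At K n P\<rparr>)"
  unfolding epi_def
proof (intro CollectI conjI)
  have NFmem: "theta X At K n P A \<in> NF X At K n P" if A: "A \<in> carrier M" for A
  proof -
    note h = representatives [OF A representatives_exist [OF A]]
    show ?thesis
      unfolding theta_def NF_iff using glue_homeos [OF h(1)] by blast
  qed
  show "theta X At K n P \<in> hom M (G\<lparr>carrier := NF X At K n P\<rparr>)"
  proof (rule homI)
    show "theta X At K n P A \<in> carrier (G\<lparr>carrier := NF X At K n P\<rparr>)" if "A \<in> carrier M" for A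
      using NFmem [OF that] by simp
    fix A B assume A: "A \<in> carrier M" and B: "B \<in> carrier M"
    let ?hs = "\<lambda>i. SOME h. h \<in> A i" and ?ks = "\<lambda>i. SOME h. h \<in> B i"
    note hA = representatives_exist [OF A] and kB = representatives_exist [OF B]
    note ph = representatives(1) [OF A hA] and pk = representatives(1) [OF B kB]
    note pm = product_mult [OF A B hA kB]
    \<comment> \<open>Independence of representatives allows the composites here in place of the
      chosen elements of the product classes.\<close>
    have "theta X At K n P (A \<otimes>\<^bsub>M\<^esub> B) = cl (glue K n P (\<lambda>i. ?hs i \<circ> ?ks i))"
      by (rule theta_eq [OF pm, symmetric])
    also have "\<dots> = cl (glue K n P ?hs \<circ> glue K n P ?ks)"
      by (rule cl_cong [OF glue_homeos(1) [OF pieces_homeos_compose [OF ph pk]]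
            homeos_compose [OF glue_homeos(1) [OF pk] glue_homeos(1) [OF ph] order_refl] glue_compose [OF ph pk]])
    also have "\<dots> = cl (glue K n P ?hs) \<otimes>\<^bsub>G\<^esub> cl (glue K n P ?ks)"
      by (rule cl_mult [OF glue_homeos(1) [OF ph] glue_homeos(1) [OF pk], symmetric])
    finally show "theta X At K n P (A \<otimes>\<^bsub>M\<^esub> B) =
        theta X At K n P A \<otimes>\<^bsub>G\<lparr>carrier := NF X At K n P\<rparr>\<^esub> theta X At K n P B"
      by (simp add: theta_def)
  qed
  show "theta X At K n P ` carrier M = carrier (G\<lparr>carrier := NF X At K n P\<rparr>)"
  proof
    show "theta X At K n P ` carrier M \<subseteq> carrier (G\<lparr>carrier := NF X At K n P\<rparr>)" using NFmem by auto
    show "carrier (G\<lparr>carrier := NF X At K n P\<rparr>) \<subseteq> theta X At K n P ` carrier M"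
    proof
      fix c assume "c \<in> carrier (G\<lparr>carrier := NF X At K n P\<rparr>)"
      then obtain h0 where h0: "h0 \<in> Homeo" "preserves h0" "c = cl h0" using NF_iff by auto
      obtain h where h: "h \<in> Homeo" "isotopic X (topspace X) {} h h0" "preserves h" "\<forall>x\<in>bdK. h x = x"
        using straighten [OF h0(1,2)] by metis
      note hp = restrict_homeos [OF h(1,3,4)]
      \<comment> \<open>The classes of the restrictions of the straightened map. The function is cut
        off outside the index set because elements of a product group are extensional.\<close>
      define A where "A = (\<lambda>i\<in>{0..n}. iso_class X At (piece i) (bdp i) h)"
      have A: "A \<in> carrier M"
        using hp iso_class_carrier by (auto simp: A_def factor_MCG_eq)
      have hA: "\<forall>i\<in>{0..n}. h \<in> A i"
        using iso_class_self [OF hp] by (simp add: A_def)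
      have ph: "pieces_homeos (\<lambda>i. h)" using hp by (simp add: pieces_homeos_def)
      have "theta X At K n P A = cl (glue K n P (\<lambda>i. h))"
        by (rule theta_eq [OF A hA, symmetric])
      also have "\<dots> = cl h"
      proof (rule cl_cong [OF glue_homeos(1) [OF ph] h(1)])
        fix x assume "x \<in> topspace X"
        then obtain i where i: "i \<in> {0..n}" "x \<in> piece i" by (rule piece_cover)
        show "glue K n P (\<lambda>i. h) x = h x" by (rule glue_eq [OF pieces_homeosD(2) [OF ph] i])
      qed
      also have "\<dots> = c" using cl_eq [OF h(1) h0(1) h(2)] h0(3) by simp
      finally show "c \<in> theta X At K n P ` carrier M" using A by blast
    qed
  qed
qed

end

theorem theorem4p3:
  fixes X :: "'a topology" and At :: "(('a \<Rightarrow> complex) \<times> 'a set) set"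
    and K :: "'a set" and n :: nat and P :: "nat \<Rightarrow> 'a set"
  assumes "surface X" and "omega_bounded X" and "oriented_atlas X At"
    and "nyikos_decomposition X K n P"
  shows "NF X At K n P \<lhd> MCG X At (topspace X) {} \<and>
         (\<forall>A \<in> carrier (product_group {0..n} (factor_MCG X At K P)). \<forall>hs.
           (\<forall>i\<in>{0..n}. hs i \<in> A i) \<longrightarrow>
           glue K n P hs \<in> homeos X At (topspace X) {} \<and>
           iso_class X At (topspace X) {} (glue K n P hs) = theta X At K n P A) \<and>
         theta X At K n P \<in> epi (product_group {0..n} (factor_MCG X At K P))
           ((MCG X At (topspace X) {}) \<lparr>carrier := NF X At K n P\<rparr>)"
proof -
  interpret nyikos X At K n P
    using assms by unfold_locales
  show ?thesis
    using NF_normal theta_epi theta_eq glue_homeos(1) [OF representatives(1)] by blast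
qed

end
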